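(* Let $G$ be a connected reductive algebraic group over $\mathbb{C}$, let $\theta$ be a non-trivial involutive automorphism of $G$, and let $K = G^{\theta}$ be its fixed point subgroup. Let $P$ be a parabolic subgroup of $G$, let $Q$ be a parabolic subgroup of $K$, and let $P'$ be a $\theta$-stable parabolic subgroup of $G$ such that $P' \cap K = Q$. If the number of $G$-orbits on $G/P \times G/\theta(P) \times G/P'$ (diagonal action of $G$) is finite, then there are only finitely many $K$-orbits on $G/P \times K/Q$ (diagonal action of $K$).
   Context: "$\theta$-stable" means $\theta(P') = P'$. The group $K$ is reductive (possibly disconnected). For a $\theta$-stable parabolic subgroup $P'$ of $G$, the intersection $P' \cap K$ is a parabolic subgroup of $K$, and every parabolic subgroup of $K$ arises in this way. The variety $G/P \times K/Q$ is called the double flag variety. $K$ acts on $G/P$ by left translation through the inclusion $K\subset G$, and on $K/Q$ by left translation. *)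

theory Defs
  imports "HOL-Analysis.Abstract_Topology" "HOL-Algebra.Left_Coset"
    "HOL-Algebra.Group_Action" "HOL-Algebra.Solvable_Groups"
begin

text \<open>An affine variety over the complex numbers is a set \<open>X\<close> together with its coordinate ring
  \<open>A\<close>, a finitely generated algebra of complex-valued functions on \<open>X\<close> (extensional outside \<open>X\<close>)
  such that evaluation identifies \<open>X\<close> with the set of algebra homomorphisms from \<open>A\<close> to the
  complex numbers. No embedding into affine space is chosen.\<close>

inductive_set generated_algebra :: "'a set \<Rightarrow> ('a \<Rightarrow> complex) set \<Rightarrow> ('a \<Rightarrow> complex) set"
  for X S where
    const: "(\<lambda>x\<in>X. c) \<in> generated_algebra X S"
  | gen: "f \<in> S \<Longrightarrow> f \<in> generated_algebra X S"
  | add: "f \<in> generated_algebra X S \<Longrightarrow> g \<in> generated_algebra X S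
      \<Longrightarrow> (\<lambda>x\<in>X. f x + g x) \<in> generated_algebra X S"
  | mult: "f \<in> generated_algebra X S \<Longrightarrow> g \<in> generated_algebra X S
      \<Longrightarrow> (\<lambda>x\<in>X. f x * g x) \<in> generated_algebra X S"

definition algebra_point ::
  "'a set \<Rightarrow> ('a \<Rightarrow> complex) set \<Rightarrow> (('a \<Rightarrow> complex) \<Rightarrow> complex) \<Rightarrow> bool" where
  "algebra_point X A \<phi> \<longleftrightarrow>
     (\<forall>c. \<phi> (\<lambda>x\<in>X. c) = c) \<and>
     (\<forall>f\<in>A. \<forall>g\<in>A. \<phi> (\<lambda>x\<in>X. f x + g x) = \<phi> f + \<phi> g) \<and>
     (\<forall>f\<in>A. \<forall>g\<in>A. \<phi> (\<lambda>x\<in>X. f x * g x) = \<phi> f * \<phi> g)"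

definition affine_variety :: "'a set \<Rightarrow> ('a \<Rightarrow> complex) set \<Rightarrow> bool" where
  "affine_variety X A \<longleftrightarrow>
     (\<exists>S. finite S \<and> S \<subseteq> extensional X \<and> A = generated_algebra X S) \<and>
     (\<forall>\<phi>. algebra_point X A \<phi> \<longrightarrow> (\<exists>!x. x \<in> X \<and> (\<forall>f\<in>A. \<phi> f = f x)))"

definition regular_map ::
  "'a set \<Rightarrow> ('a \<Rightarrow> complex) set \<Rightarrow> 'b set \<Rightarrow> ('b \<Rightarrow> complex) set \<Rightarrow> ('a \<Rightarrow> 'b) \<Rightarrow> bool" where
  "regular_map X A Y B \<phi> \<longleftrightarrow> \<phi> \<in> X \<rightarrow> Y \<and> (\<forall>f\<in>B. (\<lambda>x\<in>X. f (\<phi> x)) \<in> A)"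

text \<open>The coordinate ring of the product variety, i.e. the image of the tensor product of
  \<open>A\<close> and \<open>B\<close> in the functions on the product set.\<close>

definition product_ring ::
  "'a set \<Rightarrow> ('a \<Rightarrow> complex) set \<Rightarrow> 'b set \<Rightarrow> ('b \<Rightarrow> complex) set \<Rightarrow> ('a \<times> 'b \<Rightarrow> complex) set" where
  "product_ring X A Y B = generated_algebra (X \<times> Y)
     ((\<lambda>f. \<lambda>p\<in>X \<times> Y. f (fst p)) ` A \<union> (\<lambda>g. \<lambda>p\<in>X \<times> Y. g (snd p)) ` B)"

definition restrict_ring :: "'a set \<Rightarrow> ('a \<Rightarrow> complex) set \<Rightarrow> ('a \<Rightarrow> complex) set" where
  "restrict_ring Z A = (\<lambda>f. restrict f Z) ` A"

definition zariski :: "'a set \<Rightarrow> ('a \<Rightarrow> complex) set \<Rightarrow> 'a topology" where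
  "zariski X A = topology_generated_by ((\<lambda>f. {x \<in> X. f x \<noteq> 0}) ` A)"

text \<open>The Zariski-closed sets are exactly the common zero sets of families of regular functions.\<close>

lemma closedin_zariski_iff:
  assumes A: "A = generated_algebra X S"
  shows "closedin (zariski X A) Z \<longleftrightarrow> (\<exists>T\<subseteq>A. Z = {x \<in> X. \<forall>f\<in>T. f x = 0})"
proof -
  let ?D = "\<lambda>f :: _ \<Rightarrow> complex. {x \<in> X. f x \<noteq> 0}"
  have one: "?D (\<lambda>x\<in>X. 1) = X" by auto
  have oneA: "(\<lambda>x\<in>X. 1) \<in> A" unfolding A by (rule generated_algebra.const)
  have top: "topspace (zariski X A) = X"
    unfolding zariski_def topology_generated_by_topspace using one oneA by blast
  have gen: "\<exists>T\<subseteq>A. U = (\<Union>f\<in>T. ?D f)" if "generate_topology_on (?D ` A) U" for U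
    using that
  proof induction
    case Empty
    show ?case by (rule exI[of _ "{}"]) auto
  next
    case (Int a b)
    then obtain T1 T2 where T: "T1 \<subseteq> A" "T2 \<subseteq> A" "a = (\<Union>f\<in>T1. ?D f)" "b = (\<Union>f\<in>T2. ?D f)"
      by blast
    let ?T = "{h. \<exists>f\<in>T1. \<exists>g\<in>T2. h = (\<lambda>x\<in>X. f x * g x)}"
    have "?T \<subseteq> A" using T(1,2) unfolding A by (auto intro: generated_algebra.mult)
    moreover have "a \<inter> b = (\<Union>f\<in>?T. ?D f)" unfolding T(3,4)
    proof (intro subset_antisym subsetI)
      fix x assume "x \<in> (\<Union>f\<in>T1. ?D f) \<inter> (\<Union>f\<in>T2. ?D f)"
      then obtain f g where "f \<in> T1" "g \<in> T2" "x \<in> ?D f" "x \<in> ?D g" by blast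
      then show "x \<in> (\<Union>f\<in>?T. ?D f)" by (intro UN_I[of "\<lambda>x\<in>X. f x * g x"]) force+
    next
      fix x assume "x \<in> (\<Union>f\<in>?T. ?D f)"
      then obtain h where "h \<in> ?T" "x \<in> ?D h" by (rule UN_E)
      moreover from this obtain f g where "f \<in> T1" "g \<in> T2" "h = (\<lambda>x\<in>X. f x * g x)" by blast
      ultimately show "x \<in> (\<Union>f\<in>T1. ?D f) \<inter> (\<Union>f\<in>T2. ?D f)" by auto
    qed
    ultimately show ?case by (intro exI[of _ ?T] conjI)
  next
    case (UN K)
    have "\<forall>k\<in>K. \<exists>T. T \<subseteq> A \<and> k = (\<Union>f\<in>T. ?D f)" using UN.IH by simp
    from bchoice[OF this] obtain T where "\<forall>k\<in>K. T k \<subseteq> A \<and> k = (\<Union>f\<in>T k. ?D f)"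
      by (rule exE)
    then have T: "\<And>k. k \<in> K \<Longrightarrow> T k \<subseteq> A" "\<And>k. k \<in> K \<Longrightarrow> k = (\<Union>f\<in>T k. ?D f)" by simp_all
    have "(\<Union>k\<in>K. T k) \<subseteq> A" using T(1) by (rule UN_least)
    moreover have "\<Union>K = (\<Union>k\<in>K. \<Union>f\<in>T k. ?D f)"
    proof -
      have "\<Union>K = (\<Union>k\<in>K. k)" by simp
      also have "\<dots> = (\<Union>k\<in>K. \<Union>f\<in>T k. ?D f)" using T(2) by (rule SUP_cong[OF refl])
      finally show ?thesis .
    qed
    ultimately show ?case by (intro exI[of _ "\<Union>k\<in>K. T k"] conjI) simp_all
  next
    case (Basis s)
    then obtain f where "f \<in> A" "s = ?D f" by blast
    then show ?case by (intro exI[of _ "{f}"]) auto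
  qed
  have opn: "openin (zariski X A) U \<longleftrightarrow> (\<exists>T\<subseteq>A. U = (\<Union>f\<in>T. ?D f))" for U
  proof
    assume "openin (zariski X A) U"
    then show "\<exists>T\<subseteq>A. U = (\<Union>f\<in>T. ?D f)"
      unfolding zariski_def by (intro gen openin_topology_generated_by)
  next
    assume "\<exists>T\<subseteq>A. U = (\<Union>f\<in>T. ?D f)"
    then obtain T where T: "T \<subseteq> A" "U = (\<Union>f\<in>T. ?D f)" by blast
    have "openin (zariski X A) (?D f)" if "f \<in> T" for f
      unfolding zariski_def using that T(1) by (intro topology_generated_by_Basis imageI) blast
    then show "openin (zariski X A) U" unfolding T(2) by (intro openin_Union) blast
  qed
  show ?thesis
  proof
    assume "closedin (zariski X A) Z"
    then obtain T where T: "Z \<subseteq> X" "T \<subseteq> A" "X - Z = (\<Union>f\<in>T. ?D f)"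
      unfolding closedin_def top opn by blast
    then have "Z = {x \<in> X. \<forall>f\<in>T. f x = 0}" by blast
    then show "\<exists>T\<subseteq>A. Z = {x \<in> X. \<forall>f\<in>T. f x = 0}" using T(2) by blast
  next
    assume "\<exists>T\<subseteq>A. Z = {x \<in> X. \<forall>f\<in>T. f x = 0}"
    then obtain T where "T \<subseteq> A" "Z = {x \<in> X. \<forall>f\<in>T. f x = 0}" by blast
    then have "Z \<subseteq> X" "X - Z = (\<Union>f\<in>T. ?D f)" by auto
    then show "closedin (zariski X A) Z"
      unfolding closedin_def top opn using \<open>T \<subseteq> A\<close> by blast
  qed
qed

definition affine_algebraic_group ::
  "('a, 'b) monoid_scheme \<Rightarrow> ('a \<Rightarrow> complex) set \<Rightarrow> bool" where
  "affine_algebraic_group G A \<longleftrightarrow>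
     group G \<and> affine_variety (carrier G) A \<and>
     regular_map (carrier G \<times> carrier G) (product_ring (carrier G) A (carrier G) A)
       (carrier G) A (\<lambda>(x, y). x \<otimes>\<^bsub>G\<^esub> y) \<and>
     regular_map (carrier G) A (carrier G) A (\<lambda>x. inv\<^bsub>G\<^esub> x)"

definition closed_subgroup ::
  "('a, 'b) monoid_scheme \<Rightarrow> ('a \<Rightarrow> complex) set \<Rightarrow> 'a set \<Rightarrow> bool" where
  "closed_subgroup G A H \<longleftrightarrow> subgroup H G \<and> closedin (zariski (carrier G) A) H"

text \<open>An element \<open>u\<close> is unipotent iff right translation by \<open>u\<close> acts locally unipotently on the
  coordinate ring.\<close>

definition unipotent_element ::
  "('a, 'b) monoid_scheme \<Rightarrow> ('a \<Rightarrow> complex) set \<Rightarrow> 'a \<Rightarrow> bool" where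
  "unipotent_element G A u \<longleftrightarrow> u \<in> carrier G \<and>
     (\<forall>f\<in>A. \<exists>n. ((\<lambda>h. \<lambda>x\<in>carrier G. h (x \<otimes>\<^bsub>G\<^esub> u) - h x) ^^ n) f = (\<lambda>x\<in>carrier G. 0))"

text \<open>The last clause says that the unipotent radical, the largest closed connected normal
  unipotent subgroup, is trivial.\<close>

definition connected_reductive_group ::
  "('a, 'b) monoid_scheme \<Rightarrow> ('a \<Rightarrow> complex) set \<Rightarrow> bool" where
  "connected_reductive_group G A \<longleftrightarrow>
     affine_algebraic_group G A \<and>
     connected_space (zariski (carrier G) A) \<and>
     (\<forall>U. U \<lhd> G \<and> closed_subgroup G A U \<and> connectedin (zariski (carrier G) A) U \<and>
          (\<forall>u\<in>U. unipotent_element G A u) \<longrightarrow> U = {\<one>\<^bsub>G\<^esub>})"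

definition connected_solvable_subgroup ::
  "('a, 'b) monoid_scheme \<Rightarrow> ('a \<Rightarrow> complex) set \<Rightarrow> 'a set \<Rightarrow> bool" where
  "connected_solvable_subgroup G A B \<longleftrightarrow>
     closed_subgroup G A B \<and> connectedin (zariski (carrier G) A) B \<and> solvable (G\<lparr>carrier := B\<rparr>)"

definition borel_subgroup ::
  "('a, 'b) monoid_scheme \<Rightarrow> ('a \<Rightarrow> complex) set \<Rightarrow> 'a set \<Rightarrow> bool" where
  "borel_subgroup G A B \<longleftrightarrow> connected_solvable_subgroup G A B \<and>
     (\<forall>B'. connected_solvable_subgroup G A B' \<and> B \<subseteq> B' \<longrightarrow> B' = B)"

text \<open>This is also meaningful for disconnected groups: since Borel subgroups are connected, those
  of \<open>G\<close> are those of its identity component.\<close>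

definition parabolic_subgroup ::
  "('a, 'b) monoid_scheme \<Rightarrow> ('a \<Rightarrow> complex) set \<Rightarrow> 'a set \<Rightarrow> bool" where
  "parabolic_subgroup G A P \<longleftrightarrow> closed_subgroup G A P \<and> (\<exists>B. borel_subgroup G A B \<and> B \<subseteq> P)"

definition algebraic_automorphism ::
  "('a, 'b) monoid_scheme \<Rightarrow> ('a \<Rightarrow> complex) set \<Rightarrow> ('a \<Rightarrow> 'a) \<Rightarrow> bool" where
  "algebraic_automorphism G A \<theta> \<longleftrightarrow> \<theta> \<in> iso G G \<and>
     regular_map (carrier G) A (carrier G) A \<theta> \<and>
     regular_map (carrier G) A (carrier G) A (inv_into (carrier G) \<theta>)"

definition nontrivial_involution ::
  "('a, 'b) monoid_scheme \<Rightarrow> ('a \<Rightarrow> complex) set \<Rightarrow> ('a \<Rightarrow> 'a) \<Rightarrow> bool" where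
  "nontrivial_involution G A \<theta> \<longleftrightarrow> algebraic_automorphism G A \<theta> \<and>
     (\<forall>x\<in>carrier G. \<theta> (\<theta> x) = x) \<and> (\<exists>x\<in>carrier G. \<theta> x \<noteq> x)"

definition fixed_points :: "('a, 'b) monoid_scheme \<Rightarrow> ('a \<Rightarrow> 'a) \<Rightarrow> 'a set" where
  "fixed_points G \<theta> = {x \<in> carrier G. \<theta> x = x}"

definition diagonal_action2 ::
  "('a, 'b) monoid_scheme \<Rightarrow> 'a \<Rightarrow> 'a set \<times> 'a set \<Rightarrow> 'a set \<times> 'a set" where
  "diagonal_action2 G g = (\<lambda>(X, Y). (g <#\<^bsub>G\<^esub> X, g <#\<^bsub>G\<^esub> Y))"

definition diagonal_action3 ::
  "('a, 'b) monoid_scheme \<Rightarrow> 'a \<Rightarrow> 'a set \<times> 'a set \<times> 'a set \<Rightarrow> 'a set \<times> 'a set \<times> 'a set" where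
  "diagonal_action3 G g = (\<lambda>(X, Y, Z). (g <#\<^bsub>G\<^esub> X, g <#\<^bsub>G\<^esub> Y, g <#\<^bsub>G\<^esub> Z))"

end

theory Submission
  imports Defs "Jordan_Normal_Form.Jordan_Normal_Form_Existence"
begin

text \<open>Send a point \<open>(gP, kQ)\<close> to \<open>(gP, \<theta>(g)\<theta>(P), kP')\<close>. There are finitely many \<open>G\<close>-orbits of
  triples, so it suffices that the images of only finitely many \<open>K\<close>-orbits meet a given
  \<open>G\<close>-orbit. Fix one image \<open>x\<^sub>0\<close> in that orbit and let \<open>H\<close> be its stabiliser, a \<open>\<theta>\<close>-stable
  closed subgroup. When \<open>a x\<^sub>0\<close> is another image, applying the involution
  \<open>(x, y, z) \<mapsto> (\<theta> y, \<theta> x, \<theta> z)\<close>, which fixes every image, shows that \<open>a\<inverse>\<theta>(a)\<close> lies in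
  \<open>Z = {z \<in> H. \<theta>(z) = z\<inverse>}\<close>. Two images with values \<open>z\<close> and \<open>w\<close> come from the same \<open>K\<close>-orbit as
  soon as \<open>z = b w \<theta>(b)\<inverse>\<close> for some \<open>b \<in> H\<close>; the claim is thus a finiteness statement about the
  nonabelian cohomology of a group of order two with values in \<open>H\<close>.

  The set \<open>Z\<close> is Zariski closed and stable under \<open>(x, y) \<mapsto> x y\<inverse> x\<close>, and an equation
  \<open>z = y w\<inverse> y\<close> with \<open>y \<in> Z\<close> gives \<open>z = b w \<theta>(b)\<inverse>\<close> for \<open>b = y w\<inverse>\<close>. Everything therefore follows
  from \<open>symmetric_zero_set_finite\<close>: in a closed subset of an affine algebraic group that is
  stable under \<open>x y\<inverse> x\<close>, a set of elements no two distinct ones of which satisfy \<open>z = y w\<inverse> y\<close>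
  for a \<open>y\<close> of the closed set is finite. The group may be taken to consist of matrices
  (\<open>linearization\<close>).

  To solve \<open>z = y w\<inverse> y\<close> put \<open>h = z w\<inverse>\<close>; then \<open>y\<close> should be \<open>h\<^sup>k w\<close> for \<open>k = 1/2\<close>. For natural
  numbers \<open>k\<close> the element \<open>h\<^sup>k w\<close> lies in \<open>Z\<close>, and its entries are exponential polynomials,
  sums of terms \<open>p(k) \<alpha>\<^sup>k\<close> where \<open>\<alpha>\<close> is an eigenvalue of \<open>h\<close> and \<open>p\<close> is a polynomial. Once
  square roots of the eigenvalues are chosen, these can be evaluated at \<open>1/2\<close>. Evaluation
  preserves polynomial identities of degree at most \<open>d\<close> if the chosen roots satisfy every
  multiplicative relation of size at most \<open>d\<close> that the eigenvalues satisfy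
  (\<open>half_value_unique\<close>); by Hilbert's basis theorem \<open>Z\<close> is defined by equations of bounded
  degree, so one \<open>d\<close> serves for all \<open>z\<close> and \<open>w\<close>.

  Such roots exist unless \<open>-1\<close> is a product of powers of the eigenvalues with exponents of
  bounded size (\<open>multiplicative_square_roots\<close>). In that case one of finitely many determinants
  \<open>det (h\<^sup>\<otimes>\<^sup>a \<otimes> 1 + 1 \<otimes> h\<^sup>\<otimes>\<^sup>b)\<close> vanishes. Let \<open>\<Phi>(z, w)\<close> be the product of these determinants.
  It is a finite sum of terms \<open>f(z) g(w)\<close>, it is nonzero for \<open>z = w\<close>, and it vanishes whenever
  \<open>z = y w\<inverse> y\<close> has no solution in \<open>Z\<close>. On a set of pairwise unrelated elements \<open>\<Phi>\<close> is a
  diagonal matrix with nonzero diagonal entries and bounded rank, so the set is finite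
  (\<open>card_diagonal_le_rank\<close>).\<close>

section \<open>Functions of two variables of finite rank\<close>

text \<open>Membership of \<open>\<Phi>\<close> in \<open>A \<otimes> A\<close>, up to its values outside \<open>X\<close>. It is used with a coordinate
  ring \<open>A\<close> to express comultiplication, and with \<open>A = UNIV\<close> to express that \<open>\<Phi>\<close> has finite
  rank.\<close>
definition separable :: "'a set \<Rightarrow> ('a \<Rightarrow> complex) set \<Rightarrow> ('a \<Rightarrow> 'a \<Rightarrow> complex) \<Rightarrow> bool" where
  "separable X A \<Phi> \<longleftrightarrow> (\<exists>L. set L \<subseteq> A \<times> A \<and>
     (\<forall>x\<in>X. \<forall>y\<in>X. \<Phi> x y = (\<Sum>(f, g)\<leftarrow>L. f x * g y)))"

lemma separable_single:
  assumes "f \<in> A" "g \<in> A" "\<And>x y. x \<in> X \<Longrightarrow> y \<in> X \<Longrightarrow> \<Phi> x y = f x * g y"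
  shows "separable X A \<Phi>"
  unfolding separable_def by (rule exI[of _ "[(f, g)]"]) (use assms in auto)

lemma separable_add:
  assumes "separable X A \<Phi>" "separable X A \<Psi>"
    and "\<And>x y. x \<in> X \<Longrightarrow> y \<in> X \<Longrightarrow> \<Theta> x y = \<Phi> x y + \<Psi> x y"
  shows "separable X A \<Theta>"
proof -
  obtain L L' where "set L \<subseteq> A \<times> A" "\<forall>x\<in>X. \<forall>y\<in>X. \<Phi> x y = (\<Sum>(f, g)\<leftarrow>L. f x * g y)"
    "set L' \<subseteq> A \<times> A" "\<forall>x\<in>X. \<forall>y\<in>X. \<Psi> x y = (\<Sum>(f, g)\<leftarrow>L'. f x * g y)"
    using assms(1,2) unfolding separable_def by blast
  then show ?thesis
    unfolding separable_def by (intro exI[of _ "L @ L'"]) (simp add: assms(3))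
qed

lemma separable_mult:
  assumes mult: "\<And>f g. f \<in> A \<Longrightarrow> g \<in> A \<Longrightarrow> \<exists>h\<in>A. \<forall>x\<in>X. h x = f x * g x"
    and "separable X A \<Phi>" "separable X A \<Psi>"
    and "\<And>x y. x \<in> X \<Longrightarrow> y \<in> X \<Longrightarrow> \<Theta> x y = \<Phi> x y * \<Psi> x y"
  shows "separable X A \<Theta>"
proof -
  obtain L where L: "set L \<subseteq> A \<times> A" "\<forall>x\<in>X. \<forall>y\<in>X. \<Phi> x y = (\<Sum>(f, g)\<leftarrow>L. f x * g y)"
    using assms(2) unfolding separable_def by blast
  obtain L' where L': "set L' \<subseteq> A \<times> A" "\<forall>x\<in>X. \<forall>y\<in>X. \<Psi> x y = (\<Sum>(f, g)\<leftarrow>L'. f x * g y)"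
    using assms(3) unfolding separable_def by blast
  have single: "separable X A (\<lambda>x y. f x * g y * (\<Sum>(f', g')\<leftarrow>L'. f' x * g' y))"
    if fg: "f \<in> A" "g \<in> A" for f g
    using L'(1)
  proof (induction L')
    case Nil
    show ?case unfolding separable_def by (rule exI[of _ "[]"]) simp
  next
    case (Cons p L')
    obtain f' g' where p: "p = (f', g')" "f' \<in> A" "g' \<in> A" using Cons.prems by (cases p) auto
    obtain f'' where f'': "f'' \<in> A" "\<forall>x\<in>X. f'' x = f x * f' x" using mult[OF fg(1) p(2)] by blast
    obtain g'' where g'': "g'' \<in> A" "\<forall>x\<in>X. g'' x = g x * g' x" using mult[OF fg(2) p(3)] by blast
    from f'' g'' have "separable X A (\<lambda>x y. f x * g y * (f' x * g' y))"
      by (intro separable_single[of f'' _ g'']) (simp_all add: mult_ac)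
    moreover have "separable X A (\<lambda>x y. f x * g y * (\<Sum>(f', g')\<leftarrow>L'. f' x * g' y))"
      using Cons by simp
    ultimately show ?case by (rule separable_add) (simp add: p distrib_left)
  qed
  have "separable X A (\<lambda>x y. (\<Sum>(f, g)\<leftarrow>L. f x * g y) * (\<Sum>(f', g')\<leftarrow>L'. f' x * g' y))"
    using L(1)
  proof (induction L)
    case Nil
    show ?case unfolding separable_def by (rule exI[of _ "[]"]) simp
  next
    case (Cons p L)
    obtain f g where p: "p = (f, g)" "f \<in> A" "g \<in> A" using Cons.prems by (cases p) auto
    have "separable X A (\<lambda>x y. (\<Sum>(f, g)\<leftarrow>L. f x * g y) * (\<Sum>(f', g')\<leftarrow>L'. f' x * g' y))"
      using Cons by simp
    with single[OF p(2,3)] show ?case by (rule separable_add) (simp add: p(1) distrib_right)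
  qed
  then show ?thesis
    unfolding separable_def using L(2) L'(2) assms(4) by simp
qed

text \<open>Gaussian elimination: either the first equation is trivial, or it determines one unknown,
  which is then eliminated from the remaining equations.\<close>
lemma underdetermined_system:
  fixes a :: "'e \<Rightarrow> 'j \<Rightarrow> complex"
  assumes "finite J" "card J > length es"
  shows "\<exists>c. (\<exists>j\<in>J. c j \<noteq> 0) \<and> (\<forall>e\<in>set es. (\<Sum>j\<in>J. c j * a e j) = 0)"
  using assms
proof (induction es arbitrary: J a)
  case Nil
  then have "J \<noteq> {}" by auto
  then show ?case by (intro exI[of _ "\<lambda>_. 1"]) auto
next
  case (Cons e es)
  show ?case
  proof (cases "\<forall>j\<in>J. a e j = 0")
    case True
    obtain c where "\<exists>j\<in>J. c j \<noteq> 0" "\<forall>e\<in>set es. (\<Sum>j\<in>J. c j * a e j) = 0"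
      using Cons.IH[of J a] Cons.prems by auto
    with True show ?thesis by (intro exI[of _ c]) simp
  next
    case False
    then obtain p where p: "p \<in> J" "a e p \<noteq> 0" by blast
    define b where "b e' j = a e' j - a e j / a e p * a e' p" for e' j
    obtain c where c: "\<exists>j\<in>J - {p}. c j \<noteq> 0"
      "\<forall>e'\<in>set es. (\<Sum>j\<in>J - {p}. c j * b e' j) = 0"
    proof -
      have "card (J - {p}) > length es" using Cons.prems p by (simp add: card_Diff_singleton)
      then show ?thesis using Cons.IH[of "J - {p}" b] Cons.prems(1) that by auto
    qed
    \<comment> \<open>the value of the unknown \<open>p\<close> that solves the equation \<open>e\<close> with pivot \<open>a e p\<close>\<close>
    define c' where "c' = c(p := - (\<Sum>j\<in>J - {p}. c j * a e j) / a e p)"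
    have eq: "(\<Sum>j\<in>J. c' j * a e' j) = (\<Sum>j\<in>J - {p}. c j * b e' j)" for e'
    proof -
      have "(\<Sum>j\<in>J. c' j * a e' j) = c' p * a e' p + (\<Sum>j\<in>J - {p}. c j * a e' j)"
        by (subst sum.remove[OF Cons.prems(1) p(1)]) (auto simp: c'_def intro!: sum.cong)
      also have "c' p * a e' p = - (\<Sum>j\<in>J - {p}. c j * (a e j / a e p * a e' p))"
        by (simp add: c'_def sum_distrib_right sum_distrib_left sum_divide_distrib mult_ac)
      finally show ?thesis by (simp add: b_def right_diff_distrib sum_subtractf)
    qed
    have "b e j = 0" for j using p by (simp add: b_def)
    then have "(\<Sum>j\<in>J. c' j * a e j) = 0" by (simp add: eq)
    moreover have "\<exists>j\<in>J. c' j \<noteq> 0" using c(1) by (auto simp: c'_def)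
    ultimately show ?thesis using c(2) eq by (intro exI[of _ c']) auto
  qed
qed

text \<open>A diagonal matrix with nonzero diagonal entries has full rank, whereas a matrix that is a
  sum of \<open>r\<close> products \<open>f i * g j\<close> has rank at most \<open>r\<close>: a nontrivial combination of any
  \<open>r + 1\<close> columns vanishes.\<close>
lemma card_diagonal_le_rank:
  assumes "\<And>i j. i \<in> I \<Longrightarrow> j \<in> I \<Longrightarrow> \<Phi> i j = (\<Sum>(f, g)\<leftarrow>L. f i * g j)"
    and "\<And>i. i \<in> I \<Longrightarrow> \<Phi> i i \<noteq> 0" and "\<And>i j. i \<in> I \<Longrightarrow> j \<in> I \<Longrightarrow> i \<noteq> j \<Longrightarrow> \<Phi> i j = (0::complex)"
  shows "finite I \<and> card I \<le> length L"
proof (rule ccontr)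
  assume big: "\<not> ?thesis"
  obtain J where J: "J \<subseteq> I" "finite J" "card J = Suc (length L)"
  proof (cases "finite I")
    case True
    with big have "Suc (length L) \<le> card I" by simp
    then show ?thesis using obtain_subset_with_card_n[of "Suc (length L)" I] that by blast
  next
    case False
    then show ?thesis using infinite_arbitrarily_large[of I "Suc (length L)"] that by blast
  qed
  obtain c where c: "\<exists>j\<in>J. c j \<noteq> 0" "\<forall>e\<in>set L. (\<Sum>j\<in>J. c j * snd e j) = 0"
    using underdetermined_system[of J L "\<lambda>e j. snd e j"] J by auto
  obtain i where i: "i \<in> J" "c i \<noteq> 0" using c(1) by blast
  have "c i * \<Phi> i i = (\<Sum>j\<in>J. c j * \<Phi> i j)"
  proof -
    have "c j * \<Phi> i j = 0" if "j \<in> J - {i}" for j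
      using assms(3)[of i j] J(1) i(1) that by auto
    then show ?thesis by (subst sum.remove[OF J(2) i(1)]) (simp add: sum.neutral)
  qed
  also have "\<dots> = (\<Sum>j\<in>J. c j * (\<Sum>(f, g)\<leftarrow>L. f i * g j))"
    using J i assms(1) by (intro sum.cong) auto
  also have "\<dots> = (\<Sum>(f, g)\<leftarrow>L. f i * (\<Sum>j\<in>J. c j * g j))"
    by (induction L) (auto simp: distrib_left sum.distrib sum_distrib_left mult_ac)
  also have "\<dots> = (\<Sum>e\<leftarrow>L. 0)"
    using c(2) by (intro arg_cong[of _ _ sum_list] map_cong) (auto simp: split_beta)
  finally show False using i J(1) assms(2)[of i] by auto
qed

section \<open>Hilbert's basis theorem for rings of functions\<close>

text \<open>Only the values on \<open>X\<close> are compared, so that \<open>f\<close> can be a plain \<open>\<lambda>\<close>-expression.\<close>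
definition in_ideal :: "'a set \<Rightarrow> ('a \<Rightarrow> complex) set \<Rightarrow> ('a \<Rightarrow> complex) set \<Rightarrow> ('a \<Rightarrow> complex) \<Rightarrow> bool" where
  "in_ideal X R T f \<longleftrightarrow> (\<exists>L. set L \<subseteq> R \<times> T \<and> (\<forall>x\<in>X. f x = (\<Sum>(r, t)\<leftarrow>L. r x * t x)))"

lemma in_ideal_mono: "in_ideal X R T f \<Longrightarrow> T \<subseteq> T' \<Longrightarrow> in_ideal X R T' f"
  unfolding in_ideal_def by blast

lemma in_ideal_cong: "in_ideal X R T f \<Longrightarrow> (\<And>x. x \<in> X \<Longrightarrow> f x = g x) \<Longrightarrow> in_ideal X R T g"
  unfolding in_ideal_def by auto

lemma in_ideal_zero: "(\<And>x. x \<in> X \<Longrightarrow> f x = 0) \<Longrightarrow> in_ideal X R T f"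
  unfolding in_ideal_def by (rule exI[of _ "[]"]) simp

lemma in_ideal_add:
  assumes "in_ideal X R T f" "in_ideal X R T g" shows "in_ideal X R T (\<lambda>x. f x + g x)"
proof -
  obtain L L' where "set L \<subseteq> R \<times> T" "\<forall>x\<in>X. f x = (\<Sum>(r, t)\<leftarrow>L. r x * t x)"
    "set L' \<subseteq> R \<times> T" "\<forall>x\<in>X. g x = (\<Sum>(r, t)\<leftarrow>L'. r x * t x)"
    using assms unfolding in_ideal_def by blast
  then show ?thesis unfolding in_ideal_def by (intro exI[of _ "L @ L'"]) auto
qed

lemma in_ideal_scale:
  assumes "r \<in> generated_algebra X S" "in_ideal X (generated_algebra X S) T f"
  shows "in_ideal X (generated_algebra X S) T (\<lambda>x. r x * f x)"
proof -
  obtain L where L: "set L \<subseteq> generated_algebra X S \<times> T" "\<forall>x\<in>X. f x = (\<Sum>(r, t)\<leftarrow>L. r x * t x)"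
    using assms unfolding in_ideal_def by blast
  let ?L = "map (\<lambda>(r', t). (\<lambda>x\<in>X. r x * r' x, t)) L"
  have "set ?L \<subseteq> generated_algebra X S \<times> T"
    using L(1) assms(1) by (auto intro: generated_algebra.mult)
  moreover have "r x * (\<Sum>(r, t)\<leftarrow>L. r x * t x) = (\<Sum>(r, t)\<leftarrow>?L. r x * t x)" if "x \<in> X" for x
    using that by (induction L) (auto simp: distrib_left mult_ac)
  ultimately show ?thesis unfolding in_ideal_def using L(2) by (intro exI[of _ ?L]) auto
qed

lemma in_ideal_trans:
  assumes "in_ideal X (generated_algebra X S) T' f"
    and "\<And>t. t \<in> T' \<Longrightarrow> in_ideal X (generated_algebra X S) T t"
  shows "in_ideal X (generated_algebra X S) T f"
proof -
  obtain L where L: "set L \<subseteq> generated_algebra X S \<times> T'" "\<forall>x\<in>X. f x = (\<Sum>(r, t)\<leftarrow>L. r x * t x)"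
    using assms(1) unfolding in_ideal_def by blast
  have "in_ideal X (generated_algebra X S) T (\<lambda>x. \<Sum>(r, t)\<leftarrow>L. r x * t x)"
    using L(1)
  proof (induction L)
    case Nil
    show ?case by (rule in_ideal_zero) simp
  next
    case (Cons e L)
    obtain r t where e: "e = (r, t)" "r \<in> generated_algebra X S" "t \<in> T'"
      using Cons.prems by (cases e) auto
    have "in_ideal X (generated_algebra X S) T (\<lambda>x. r x * t x + (\<Sum>(r, t)\<leftarrow>L. r x * t x))"
      by (rule in_ideal_add[OF in_ideal_scale[OF e(2) assms(2)[OF e(3)]]]) (use Cons in simp)
    then show ?case by (simp add: e(1))
  qed
  then show ?thesis using L(2) by (auto intro: in_ideal_cong)
qed

lemma in_ideal_member:
  assumes "f \<in> T" shows "in_ideal X (generated_algebra X S) T f"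
  unfolding in_ideal_def
  by (rule exI[of _ "[(\<lambda>x\<in>X. 1, f)]"]) (use assms generated_algebra.const[of 1 X S] in auto)

lemma in_ideal_finite:
  assumes "in_ideal X R T f" obtains T0 where "finite T0" "T0 \<subseteq> T" "in_ideal X R T0 f"
proof -
  obtain L where L: "set L \<subseteq> R \<times> T" "\<forall>x\<in>X. f x = (\<Sum>(r, t)\<leftarrow>L. r x * t x)"
    using assms unfolding in_ideal_def by blast
  show ?thesis
    by (rule that[of "snd ` set L"]) (use L in \<open>force simp: in_ideal_def\<close>)+
qed

lemma generated_algebra_mono: "S \<subseteq> S' \<Longrightarrow> generated_algebra X S \<subseteq> generated_algebra X S'"
proof
  fix f assume "S \<subseteq> S'" "f \<in> generated_algebra X S"
  from this(2,1) show "f \<in> generated_algebra X S'"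
    by induction (auto intro: generated_algebra.intros)
qed

lemma generated_algebra_add':
  assumes "(\<lambda>x\<in>X. f x) \<in> generated_algebra X S" "(\<lambda>x\<in>X. g x) \<in> generated_algebra X S"
  shows "(\<lambda>x\<in>X. f x + g x) \<in> generated_algebra X S"
proof -
  have "(\<lambda>x\<in>X. f x + g x) = (\<lambda>x\<in>X. (\<lambda>x\<in>X. f x) x + (\<lambda>x\<in>X. g x) x)"
    by (rule restrict_ext) simp
  also have "\<dots> \<in> generated_algebra X S" by (rule generated_algebra.add[OF assms])
  finally show ?thesis .
qed

lemma generated_algebra_mult':
  assumes "(\<lambda>x\<in>X. f x) \<in> generated_algebra X S" "(\<lambda>x\<in>X. g x) \<in> generated_algebra X S"
  shows "(\<lambda>x\<in>X. f x * g x) \<in> generated_algebra X S"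
proof -
  have "(\<lambda>x\<in>X. f x * g x) = (\<lambda>x\<in>X. (\<lambda>x\<in>X. f x) x * (\<lambda>x\<in>X. g x) x)"
    by (rule restrict_ext) simp
  also have "\<dots> \<in> generated_algebra X S" by (rule generated_algebra.mult[OF assms])
  finally show ?thesis .
qed

lemma generated_algebra_restrict:
  assumes "f \<in> generated_algebra X S"
  shows "(\<lambda>x\<in>X. f x) \<in> generated_algebra X S"
proof -
  have "(\<lambda>x\<in>X. f x) = (\<lambda>x\<in>X. f x * (\<lambda>x\<in>X. 1) x)"
    by (rule restrict_ext) simp
  also have "\<dots> \<in> generated_algebra X S"
    by (rule generated_algebra.mult[OF assms generated_algebra.const])
  finally show ?thesis .
qed

lemma generated_algebra_sum:
  assumes "finite I" "\<And>i. i \<in> I \<Longrightarrow> (\<lambda>x\<in>X. f i x) \<in> generated_algebra X S"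
  shows "(\<lambda>x\<in>X. \<Sum>i\<in>I. f i x) \<in> generated_algebra X S"
  using assms
proof (induction I rule: finite_induct)
  case empty
  show ?case unfolding sum.empty by (rule generated_algebra.const)
next
  case (insert i I)
  show ?case
    unfolding sum.insert[OF insert.hyps]
    by (rule generated_algebra_add') (use insert in blast)+
qed

text \<open>An element of \<open>R[y]\<close> of degree at most \<open>k\<close>, encoded as a family of complex polynomials
  indexed by the points of \<open>X\<close>, so that the arithmetic of complex polynomials applies at every
  point.\<close>
definition polynomial_over ::
  "'a set \<Rightarrow> ('a \<Rightarrow> complex) set \<Rightarrow> nat \<Rightarrow> ('a \<Rightarrow> complex poly) \<Rightarrow> bool" where
  "polynomial_over X R k q \<longleftrightarrow>
     (\<forall>x\<in>X. degree (q x) \<le> k) \<and> (\<forall>i. (\<lambda>x\<in>X. coeff (q x) i) \<in> R)"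

lemma polynomial_over_add:
  assumes "polynomial_over X (generated_algebra X S) k q" "polynomial_over X (generated_algebra X S) k' q'"
  shows "polynomial_over X (generated_algebra X S) (max k k') (\<lambda>x. q x + q' x)"
  unfolding polynomial_over_def
proof (intro conjI ballI allI)
  show "degree (q x + q' x) \<le> max k k'" if "x \<in> X" for x
    using assms that unfolding polynomial_over_def by (intro degree_add_le) force+
  show "(\<lambda>x\<in>X. coeff (q x + q' x) i) \<in> generated_algebra X S" for i
    unfolding coeff_add
    by (rule generated_algebra_add') (use assms in \<open>unfold polynomial_over_def, blast\<close>)+
qed

lemma polynomial_over_mult:
  assumes "polynomial_over X (generated_algebra X S) k q" "polynomial_over X (generated_algebra X S) k' q'"
  shows "polynomial_over X (generated_algebra X S) (k + k') (\<lambda>x. q x * q' x)"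
  unfolding polynomial_over_def
proof (intro conjI ballI allI)
  show "degree (q x * q' x) \<le> k + k'" if "x \<in> X" for x
    using assms that unfolding polynomial_over_def
    by (intro order.trans[OF degree_mult_le]) (force intro: add_mono)
  show "(\<lambda>x\<in>X. coeff (q x * q' x) i) \<in> generated_algebra X S" for i
    unfolding coeff_mult
    by (intro generated_algebra_sum generated_algebra_mult')
      (use assms in \<open>unfold polynomial_over_def, blast+\<close>)
qed

lemma polynomial_over_monom:
  assumes "(\<lambda>x\<in>X. r x) \<in> generated_algebra X S"
  shows "polynomial_over X (generated_algebra X S) k (\<lambda>x. monom (r x) k)"
  unfolding polynomial_over_def
proof (intro conjI ballI allI)
  fix i
  show "(\<lambda>x\<in>X. coeff (monom (r x) k) i) \<in> generated_algebra X S"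
  proof (cases "k = i")
    case True
    show ?thesis using assms unfolding coeff_monom True by (simp only: simp_thms if_True)
  next
    case False
    then show ?thesis unfolding coeff_monom by (simp only: if_False) (rule generated_algebra.const)
  qed
qed (simp add: degree_monom_le)

lemma generated_algebra_insert_polynomial:
  assumes "f \<in> generated_algebra X (insert y S)"
  shows "\<exists>k q. polynomial_over X (generated_algebra X S) k q \<and> (\<forall>x\<in>X. f x = poly (q x) (y x))"
  using assms
proof induction
  case (const c)
  show ?case
    using polynomial_over_monom[OF generated_algebra.const[of c X S], of 0]
    by (intro exI[of _ 0] exI[of _ "\<lambda>x. monom c 0"]) (simp add: poly_monom)
next
  case (gen f)
  show ?case
  proof (cases "f = y")
    case True
    then show ?thesis
      using polynomial_over_monom[OF generated_algebra.const[of 1 X S], of 1]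
      by (intro exI[of _ 1] exI[of _ "\<lambda>x. monom 1 1"]) (simp add: poly_monom)
  next
    case False
    then have "f \<in> generated_algebra X S" using gen by (auto intro: generated_algebra.gen)
    from polynomial_over_monom[OF generated_algebra_restrict[OF this], of 0] show ?thesis
      by (intro exI[of _ 0] exI[of _ "\<lambda>x. monom (f x) 0"]) (simp add: poly_monom)
  qed
next
  case (add f g)
  from add.IH(1) obtain k q where
    q: "polynomial_over X (generated_algebra X S) k q" "\<forall>x\<in>X. f x = poly (q x) (y x)" by blast
  from add.IH(2) obtain k' q' where
    q': "polynomial_over X (generated_algebra X S) k' q'" "\<forall>x\<in>X. g x = poly (q' x) (y x)" by blast
  from q q' show ?case
    by (intro exI[of _ "max k k'"] exI[of _ "\<lambda>x. q x + q' x"]) (simp add: polynomial_over_add)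
next
  case (mult f g)
  from mult.IH(1) obtain k q where
    q: "polynomial_over X (generated_algebra X S) k q" "\<forall>x\<in>X. f x = poly (q x) (y x)" by blast
  from mult.IH(2) obtain k' q' where
    q': "polynomial_over X (generated_algebra X S) k' q'" "\<forall>x\<in>X. g x = poly (q' x) (y x)" by blast
  from q q' show ?case
    by (intro exI[of _ "k + k'"] exI[of _ "\<lambda>x. q x * q' x"]) (simp add: polynomial_over_mult)
qed

text \<open>The finite set of generators is required inside \<open>T\<close> itself, not only in the ideal that \<open>T\<close>
  generates; this is what makes a finite subset of a given set of equations sufficient.\<close>
definition noetherian_functions :: "'a set \<Rightarrow> ('a \<Rightarrow> complex) set \<Rightarrow> bool" where
  "noetherian_functions X R \<longleftrightarrow>
     (\<forall>T\<subseteq>R. \<exists>T0\<subseteq>T. finite T0 \<and> (\<forall>f\<in>T. in_ideal X R T0 f))"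

text \<open>Hilbert's argument. If no finite subset of \<open>T\<close> generates, choose successively elements
  \<open>f 0, f 1, \<dots>\<close> of the ideal \<open>I\<close> of \<open>T\<close>, each of minimal degree in \<open>y\<close> among the elements
  outside the ideal of the previous ones. The leading coefficient of some \<open>f N\<close> is a
  combination of earlier leading coefficients; subtracting the corresponding combination of
  multiples \<open>y ^ l * f j\<close> gives an element of smaller degree that is still outside the ideal
  of the previous ones, a contradiction. The degree of a function is the least one among its
  representations as a polynomial in \<open>y\<close>, since such representations are not unique.\<close>
lemma hilbert_basis_step:
  assumes noeth: "noetherian_functions X (generated_algebra X S)"
  shows "noetherian_functions X (generated_algebra X (insert y S))"
  unfolding noetherian_functions_def
proof (intro allI impI, rule ccontr)
  define R where "R = generated_algebra X S"
  define R' where "R' = generated_algebra X (insert y S)"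
  have RR': "R \<subseteq> R'" unfolding R_def R'_def by (rule generated_algebra_mono) blast
  fix T
  assume "T \<subseteq> generated_algebra X (insert y S)"
  then have T: "T \<subseteq> R'" by (simp add: R'_def)
  assume "\<not> (\<exists>T0\<subseteq>T. finite T0 \<and> (\<forall>f\<in>T. in_ideal X (generated_algebra X (insert y S)) T0 f))"
  then have nofin: "\<exists>f\<in>T. \<not> in_ideal X R' T0 f" if "T0 \<subseteq> T" "finite T0" for T0
    using that unfolding R'_def by blast
  define rep where "rep f k q \<longleftrightarrow> polynomial_over X R k q \<and> (\<forall>x\<in>X. f x = poly (q x) (y x))" for f k q
  define deg where "deg f = (LEAST k. \<exists>q. rep f k q)" for f
  define I where "I = {f. in_ideal X R' T f}"
  have I_rep: "\<exists>k q. rep f k q" if f: "f \<in> I" for f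
  proof -
    obtain L where L: "set L \<subseteq> R' \<times> T" "\<forall>x\<in>X. f x = (\<Sum>(r, t)\<leftarrow>L. r x * t x)"
      using f unfolding I_def in_ideal_def by blast
    have "(\<lambda>x\<in>X. \<Sum>(r, t)\<leftarrow>L. r x * t x) \<in> R'"
      using L(1)
    proof (induction L)
      case Nil
      show ?case unfolding R'_def list.map sum_list.Nil by (rule generated_algebra.const)
    next
      case (Cons p L)
      obtain r t where p: "p = (r, t)" by (cases p)
      have rt: "r \<in> R'" "t \<in> R'" using Cons.prems T p by auto
      have IH: "(\<lambda>x\<in>X. \<Sum>(r, t)\<leftarrow>L. r x * t x) \<in> R'"
        by (rule Cons.IH) (use Cons.prems in simp)
      show ?case
        using generated_algebra_add'[OF generated_algebra_mult'[OF
            rt[unfolded R'_def, THEN generated_algebra_restrict]] IH[unfolded R'_def]]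
        unfolding R'_def p list.map sum_list.Cons prod.case .
    qed
    from generated_algebra_insert_polynomial[OF this[unfolded R'_def]] L(2)
    show ?thesis unfolding rep_def R_def by auto
  qed
  define P where "P f n r \<longleftrightarrow> r \<in> I \<and> \<not> in_ideal X R' (f ` {..<n}) r \<and>
    (\<forall>r'\<in>I. \<not> in_ideal X R' (f ` {..<n}) r' \<longrightarrow> deg r \<le> deg r')" for f and n :: nat and r
  have "\<exists>f. \<forall>n. P f n (f n)"
  proof (rule dependent_wellorder_choice)
    fix r :: "'a \<Rightarrow> complex" and f g :: "nat \<Rightarrow> 'a \<Rightarrow> complex" and n :: nat
    assume "\<And>m. m < n \<Longrightarrow> f m = g m"
    then have "f ` {..<n} = g ` {..<n}" by auto
    then show "P f n r = P g n r" unfolding P_def by simp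
  next
    fix n :: nat and f :: "nat \<Rightarrow> 'a \<Rightarrow> complex"
    assume prev: "\<And>m. m < n \<Longrightarrow> P f m (f m)"
    have "\<exists>r\<in>I. \<not> in_ideal X R' (f ` {..<n}) r"
    proof (rule ccontr)
      assume all: "\<not> ?thesis"
      have "\<forall>m\<in>{..<n}. \<exists>T0. finite T0 \<and> T0 \<subseteq> T \<and> in_ideal X R' T0 (f m)"
      proof
        fix m assume "m \<in> {..<n}"
        then have "in_ideal X R' T (f m)" using prev[of m] unfolding P_def I_def by simp
        then obtain T0 where "finite T0" "T0 \<subseteq> T" "in_ideal X R' T0 (f m)"
          by (rule in_ideal_finite)
        then show "\<exists>T0. finite T0 \<and> T0 \<subseteq> T \<and> in_ideal X R' T0 (f m)" by (intro exI[of _ T0] conjI)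
      qed
      then have "\<exists>T0. \<forall>m\<in>{..<n}. finite (T0 m) \<and> T0 m \<subseteq> T \<and> in_ideal X R' (T0 m) (f m)"
        by (rule bchoice)
      then obtain T0
        where "\<forall>m\<in>{..<n}. finite (T0 m) \<and> T0 m \<subseteq> T \<and> in_ideal X R' (T0 m) (f m)" by (rule exE)
      then have T0: "\<And>m. m < n \<Longrightarrow> finite (T0 m) \<and> T0 m \<subseteq> T \<and> in_ideal X R' (T0 m) (f m)"
        by simp
      obtain t where t: "t \<in> T" "\<not> in_ideal X R' (\<Union>m<n. T0 m) t"
        using nofin[of "\<Union>m<n. T0 m"] T0 by auto
      have "t \<in> I" using t unfolding I_def R'_def by (simp add: in_ideal_member)
      then have "in_ideal X R' (f ` {..<n}) t" using all by blast
      then have "in_ideal X R' (\<Union>m<n. T0 m) t"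
        unfolding R'_def
      proof (rule in_ideal_trans)
        fix s assume "s \<in> f ` {..<n}"
        then obtain m where "m < n" "s = f m" by auto
        then show "in_ideal X (generated_algebra X (insert y S)) (\<Union>m<n. T0 m) s"
          using T0[of m] unfolding R'_def by (auto elim!: in_ideal_mono)
      qed
      with t show False by blast
    qed
    then obtain r0 where "r0 \<in> I \<and> \<not> in_ideal X R' (f ` {..<n}) r0" by blast
    from ex_has_least_nat[of "\<lambda>r. r \<in> I \<and> \<not> in_ideal X R' (f ` {..<n}) r", OF this, of deg]
    show "\<exists>r. P f n r" unfolding P_def by blast
  qed
  then obtain f where f: "\<And>n. P f n (f n)" by blast
  have fI: "f n \<in> I" and fnew: "\<not> in_ideal X R' (f ` {..<n}) (f n)" for n
    using f[of n] unfolding P_def by auto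
  have fmin: "deg (f n) \<le> deg r" if "r \<in> I" "\<not> in_ideal X R' (f ` {..<n}) r" for n r
    using f[of n] that unfolding P_def by blast
  define q where "q n = (SOME q. rep (f n) (deg (f n)) q)" for n
  have "\<exists>q. rep (f n) (deg (f n)) q" for n
    unfolding deg_def by (rule LeastI_ex) (rule I_rep[OF fI])
  then have q: "rep (f n) (deg (f n)) (q n)" for n unfolding q_def by (rule someI_ex)
  have mono: "deg (f m) \<le> deg (f n)" if "m \<le> n" for m n
  proof (rule fmin[OF fI])
    show "\<not> in_ideal X R' (f ` {..<m}) (f n)"
      using fnew[of n] in_ideal_mono[of X R' "f ` {..<m}" "f n" "f ` {..<n}"] that by fastforce
  qed
  define a where "a n = (\<lambda>x\<in>X. coeff (q n x) (deg (f n)))" for n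
  have "a n \<in> R" for n using q[of n] unfolding rep_def polynomial_over_def a_def by blast
  then have aR: "range a \<subseteq> R" by blast
  obtain A0 where A0: "A0 \<subseteq> range a" "finite A0" "\<forall>t\<in>range a. in_ideal X R A0 t"
    using noeth aR unfolding noetherian_functions_def R_def by meson
  then obtain J where J: "finite J" "A0 = a ` J" using finite_subset_image[of A0 a UNIV] by auto
  \<comment> \<open>an index beyond all those needed to express the other leading coefficients\<close>
  define N where "N = Suc (Max (insert 0 J))"
  have JN: "j < N" if "j \<in> J" for j unfolding N_def using J(1) that by (simp add: le_imp_less_Suc)
  obtain L where L: "set L \<subseteq> R \<times> A0" "\<forall>x\<in>X. a N x = (\<Sum>(r, t)\<leftarrow>L. r x * t x)"
    using A0(3) unfolding in_ideal_def by blast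
  define \<iota> where "\<iota> t = (SOME j. j \<in> J \<and> t = a j)" for t
  have \<iota>: "\<iota> t \<in> J \<and> t = a (\<iota> t)" if "t \<in> A0" for t
    unfolding \<iota>_def by (rule someI_ex) (use that J in auto)
  define D where "D = deg (f N)"
  \<comment> \<open>the combination of multiples of earlier elements with the leading term of \<open>f N\<close>\<close>
  define corr where "corr L x = (\<Sum>(r, t)\<leftarrow>L. r x * y x ^ (D - deg (f (\<iota> t))) * f (\<iota> t) x)" for L x
  have main: "in_ideal X R' (f ` {..<N}) (corr L) \<and>
      (\<exists>p. rep (corr L) D p \<and> (\<forall>x\<in>X. coeff (p x) D = (\<Sum>(r, t)\<leftarrow>L. r x * t x)))"
    using L(1)
  proof (induction L)
    case Nil
    have "rep (corr []) D (\<lambda>x. 0)"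
      using generated_algebra.const[of 0 X S]
      by (auto simp: rep_def polynomial_over_def corr_def R_def)
    moreover have "in_ideal X R' (f ` {..<N}) (corr [])" by (rule in_ideal_zero) (simp add: corr_def)
    ultimately show ?case by (intro conjI exI[of _ "\<lambda>x. 0"]) simp_all
  next
    case (Cons e L)
    obtain r t where e: "e = (r, t)" "r \<in> R" "t \<in> A0" using Cons.prems by (cases e) auto
    define j where "j = \<iota> t"
    have j: "j < N" "t = a j" using \<iota>[OF e(3)] JN unfolding j_def by auto
    have le: "deg (f j) \<le> D" unfolding D_def by (rule mono) (use j in simp)
    define l where "l = D - deg (f j)"
    define s where "s x = r x * y x ^ l * f j x" for x
    have corr: "corr (e # L) x = s x + corr L x" for x
      by (simp add: corr_def e j_def l_def s_def)
    from Cons obtain p where IH: "in_ideal X R' (f ` {..<N}) (corr L)" "rep (corr L) D p"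
      "\<forall>x\<in>X. coeff (p x) D = (\<Sum>(r, t)\<leftarrow>L. r x * t x)" by auto
    have pow: "(\<lambda>x\<in>X. y x ^ l) \<in> R'" for l
    proof (induction l)
      case 0
      show ?case unfolding R'_def power_0 by (rule generated_algebra.const)
    next
      case (Suc l)
      have "(\<lambda>x\<in>X. y x) \<in> R'" unfolding R'_def
        by (intro generated_algebra_restrict generated_algebra.gen) blast
      then show ?case using Suc unfolding R'_def power_Suc by (rule generated_algebra_mult')
    qed
    have r: "(\<lambda>x\<in>X. r x) \<in> R'" using e(2) RR' unfolding R'_def
      by (intro generated_algebra_restrict) blast
    have "(\<lambda>x\<in>X. r x * y x ^ l) \<in> R'"
      using r pow[of l] unfolding R'_def by (rule generated_algebra_mult')
    then have "in_ideal X R' (f ` {..<N}) (\<lambda>x. (\<lambda>x\<in>X. r x * y x ^ l) x * f j x)"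
      unfolding R'_def by (rule in_ideal_scale) (rule in_ideal_member, use j in blast)
    then have "in_ideal X R' (f ` {..<N}) s"
      by (rule in_ideal_cong) (simp add: s_def)
    from in_ideal_add[OF this IH(1)] have 1: "in_ideal X R' (f ` {..<N}) (corr (e # L))"
      by (rule in_ideal_cong) (simp add: corr)
    define p' where "p' x = monom (r x) l * q j x + p x" for x
    have "polynomial_over X R (max (l + deg (f j)) D) p'"
      using e(2) q[of j] IH(2) unfolding p'_def R_def rep_def
      by (intro polynomial_over_add polynomial_over_mult polynomial_over_monom
          generated_algebra_restrict) blast+
    then have "polynomial_over X R D p'" using le by (simp add: l_def)
    moreover have "corr (e # L) x = poly (p' x) (y x)" if "x \<in> X" for x
      using q[of j] IH(2) that by (simp add: corr s_def p'_def rep_def poly_monom)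
    ultimately have 2: "rep (corr (e # L)) D p'" unfolding rep_def by blast
    have "coeff (p' x) D = (\<Sum>(r, t)\<leftarrow>e # L. r x * t x)" if "x \<in> X" for x
    proof -
      have "coeff (monom (r x) l * q j x) D = r x * coeff (q j x) (deg (f j))"
        using le by (simp add: coeff_monom_mult l_def)
      then show ?thesis using that IH(3) by (simp add: p'_def e j a_def)
    qed
    with 1 2 show ?case by blast
  qed
  then obtain p where p: "in_ideal X R' (f ` {..<N}) (corr L)" "rep (corr L) D p"
    "\<forall>x\<in>X. coeff (p x) D = a N x" using L(2) by auto
  define g where "g x = f N x + (\<lambda>x\<in>X. -1) x * corr L x" for x
  have cI: "in_ideal X R' (f ` {..<N}) (\<lambda>x. (\<lambda>x\<in>X. c) x * corr L x)" for c
    using p(1) unfolding R'_def by (intro in_ideal_scale generated_algebra.const)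
  have gnew: "\<not> in_ideal X R' (f ` {..<N}) g"
  proof
    assume "in_ideal X R' (f ` {..<N}) g"
    from in_ideal_add[OF this cI[of 1]] have "in_ideal X R' (f ` {..<N}) (f N)"
      by (rule in_ideal_cong) (simp add: g_def)
    with fnew show False by blast
  qed
  have "in_ideal X R' T (\<lambda>x. (\<lambda>x\<in>X. -1) x * corr L x)"
    using cI[of "-1"] unfolding R'_def
    by (rule in_ideal_trans) (use fI in \<open>auto simp: I_def R'_def\<close>)
  then have gI: "g \<in> I"
    using fI[of N] unfolding I_def g_def by (simp add: in_ideal_add)
  define p' where "p' x = q N x + monom (-1) 0 * p x" for x
  have "polynomial_over X R (max D (0 + D)) p'"
    using q[of N] p(2) unfolding p'_def R_def rep_def D_def
    by (intro polynomial_over_add polynomial_over_mult polynomial_over_monom generated_algebra.const) blast+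
  then have p'D: "polynomial_over X R D p'" by simp
  have gp': "g x = poly (p' x) (y x)" if "x \<in> X" for x
    using q[of N] p(2) that by (simp add: g_def p'_def rep_def poly_monom)
  have top: "coeff (p' x) D = 0" if "x \<in> X" for x
    using p(3) that by (simp add: p'_def coeff_monom_mult a_def D_def)
  show False
  proof (cases "D = 0")
    case True
    have "g x = 0" if "x \<in> X" for x
    proof -
      have "degree (p' x) = 0" using p'D that True by (simp add: polynomial_over_def)
      then have "p' x = 0" using top[OF that] True by (metis leading_coeff_0_iff)
      then show ?thesis using gp'[OF that] by simp
    qed
    then show False using gnew in_ideal_zero by blast
  next
    case False
    have "polynomial_over X R (D - 1) p'"
      unfolding polynomial_over_def
    proof (intro conjI ballI)
      show "degree (p' x) \<le> D - 1" if "x \<in> X" for x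
      proof (cases "p' x = 0")
        case False
        then have "degree (p' x) \<noteq> D" using top[OF that] by (metis leading_coeff_0_iff)
        moreover have "degree (p' x) \<le> D" using p'D that by (simp add: polynomial_over_def)
        ultimately show ?thesis by linarith
      qed simp
    qed (use p'D in \<open>simp add: polynomial_over_def\<close>)
    then have "rep g (D - 1) p'" unfolding rep_def using gp' by blast
    then have "deg g \<le> D - 1" unfolding deg_def by (intro Least_le) blast
    moreover have "D \<le> deg g" unfolding D_def by (rule fmin[OF gI gnew])
    ultimately show False using False by simp
  qed
qed

theorem hilbert_basis:
  assumes "finite S"
  shows "noetherian_functions X (generated_algebra X S)"
  using assms
proof (induction S rule: finite_induct)
  case empty
  have const: "\<exists>c. f = (\<lambda>x\<in>X. c)" if "f \<in> generated_algebra X {}" for f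
    using that
  proof induction
    case (add f g)
    then obtain c d where "f = (\<lambda>x\<in>X. c)" "g = (\<lambda>x\<in>X. d)" by blast
    then have "(\<lambda>x\<in>X. f x + g x) = (\<lambda>x\<in>X. c + d)" by (intro restrict_ext) simp
    then show ?case by blast
  next
    case (mult f g)
    then obtain c d where "f = (\<lambda>x\<in>X. c)" "g = (\<lambda>x\<in>X. d)" by blast
    then have "(\<lambda>x\<in>X. f x * g x) = (\<lambda>x\<in>X. c * d)" by (intro restrict_ext) simp
    then show ?case by blast
  qed blast+
  show ?case
    unfolding noetherian_functions_def
  proof (intro allI impI)
    fix T assume T: "T \<subseteq> generated_algebra X {}"
    show "\<exists>T0\<subseteq>T. finite T0 \<and> (\<forall>f\<in>T. in_ideal X (generated_algebra X {}) T0 f)"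
    proof (cases "\<exists>t\<in>T. \<exists>x\<in>X. t x \<noteq> 0")
      case True
      then obtain t where t: "t \<in> T" "\<exists>x\<in>X. t x \<noteq> 0" by blast
      obtain c where c: "t = (\<lambda>x\<in>X. c)" using t T const by blast
      have "in_ideal X (generated_algebra X {}) {t} f" if f: "f \<in> T" for f
      proof -
        obtain d where d: "f = (\<lambda>x\<in>X. d)" using f T const by blast
        have "in_ideal X (generated_algebra X {}) {t} (\<lambda>x. (\<lambda>x\<in>X. d / c) x * t x)"
          by (intro in_ideal_scale generated_algebra.const in_ideal_member) simp
        then show ?thesis by (rule in_ideal_cong) (use t c d in auto)
      qed
      then show ?thesis using t by (intro exI[of _ "{t}"]) auto
    next
      case False
      then show ?thesis by (intro exI[of _ "{}"]) (auto intro: in_ideal_zero)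
    qed
  qed
next
  case (insert y S)
  then show ?case by (intro hilbert_basis_step)
qed

text \<open>Noetherianity enters the main argument only through this consequence: it bounds the degree
  of the equations of a closed set.\<close>
corollary finitely_many_equations:
  assumes "finite S" "T \<subseteq> generated_algebra X S"
  obtains T0 where "finite T0" "T0 \<subseteq> T" "\<And>x. x \<in> X \<Longrightarrow> (\<forall>f\<in>T0. f x = 0) \<Longrightarrow> (\<forall>f\<in>T. f x = 0)"
proof -
  obtain T0 where T0: "T0 \<subseteq> T" "finite T0" "\<forall>f\<in>T. in_ideal X (generated_algebra X S) T0 f"
    using hilbert_basis[OF assms(1)] assms(2) unfolding noetherian_functions_def by meson
  show ?thesis
  proof (rule that[OF T0(2,1)])
    fix x assume x: "x \<in> X" "\<forall>f\<in>T0. f x = 0"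
    show "\<forall>f\<in>T. f x = 0"
    proof
      fix f assume "f \<in> T"
      then obtain L where L: "set L \<subseteq> generated_algebra X S \<times> T0" "f x = (\<Sum>(r, t)\<leftarrow>L. r x * t x)"
        using T0(3) x(1) unfolding in_ideal_def by blast
      have "(\<Sum>(r, t)\<leftarrow>L. r x * t x) = 0" using L(1) x(2) by (induction L) auto
      then show "f x = 0" using L(2) by simp
    qed
  qed
qed

section \<open>Exponential polynomials and square roots of their frequencies\<close>

text \<open>Induction on the total size of the coefficients. If the coefficient at \<open>\<alpha>0\<close> is nonzero,
  apply the difference operator \<open>a \<mapsto> (\<lambda>k. a (k + 1) - \<alpha>0 * a k)\<close>. It lowers the degree of the
  coefficient at \<open>\<alpha>0\<close>; at another frequency \<open>\<alpha>\<close> it multiplies the leading coefficient by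
  \<open>\<alpha> - \<alpha>0\<close> and so does not lose information.\<close>
lemma exponential_polynomials_independent:
  fixes P :: "complex \<Rightarrow> complex poly"
  assumes "finite E" and "0 \<notin> E"
    and "\<And>k::nat. (\<Sum>\<alpha>\<in>E. poly (P \<alpha>) (of_nat k) * \<alpha> ^ k) = 0"
    and "\<alpha> \<in> E"
  shows "P \<alpha> = 0"
proof -
  define w :: "complex poly \<Rightarrow> nat" where "w p = (if p = 0 then 0 else Suc (degree p))" for p
  have "\<forall>\<alpha>\<in>E. P \<alpha> = 0"
    using assms(3)
  proof (induction "\<Sum>\<alpha>\<in>E. w (P \<alpha>)" arbitrary: P rule: less_induct)
    case less
    show ?case
    proof (rule ccontr)
      assume "\<not> ?thesis"
      then obtain \<alpha>0 where \<alpha>0: "\<alpha>0 \<in> E" "P \<alpha>0 \<noteq> 0" by blast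
      define P' where "P' \<alpha> = Polynomial.smult \<alpha> (P \<alpha> \<circ>\<^sub>p [:1, 1:]) - Polynomial.smult \<alpha>0 (P \<alpha>)" for \<alpha>
      have deg: "degree (P' \<alpha>) \<le> degree (P \<alpha>)" for \<alpha>
        unfolding P'_def
        by (rule degree_diff_le) (auto intro: order.trans[OF degree_smult_le] simp: degree_pcompose)
      have top: "coeff (P' \<alpha>) (degree (P \<alpha>)) = (\<alpha> - \<alpha>0) * lead_coeff (P \<alpha>)" for \<alpha>
      proof -
        have "coeff (P \<alpha> \<circ>\<^sub>p [:1, 1:]) (degree (P \<alpha>)) = lead_coeff (P \<alpha>)"
          using lead_coeff_comp[of "[:1, 1:]" "P \<alpha>"] by (simp add: degree_pcompose)
        then show ?thesis by (simp add: P'_def algebra_simps)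
      qed
      have le: "w (P' \<alpha>) \<le> w (P \<alpha>)" for \<alpha>
      proof (cases "P \<alpha> = 0")
        case True
        then have "P' \<alpha> = 0" by (simp add: P'_def)
        then show ?thesis by (simp add: w_def)
      qed (use deg[of \<alpha>] in \<open>simp add: w_def\<close>)
      have lt: "w (P' \<alpha>0) < w (P \<alpha>0)"
      proof (cases "P' \<alpha>0 = 0")
        case False
        have "degree (P' \<alpha>0) \<noteq> degree (P \<alpha>0)"
          using top[of \<alpha>0] False by (metis diff_self leading_coeff_0_iff mult_zero_left)
        with deg[of \<alpha>0] show ?thesis using \<alpha>0 False by (simp add: w_def)
      qed (use \<alpha>0 in \<open>simp add: w_def\<close>)
      have "(\<Sum>\<alpha>\<in>E. w (P' \<alpha>)) < (\<Sum>\<alpha>\<in>E. w (P \<alpha>))"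
        by (rule sum_strict_mono_ex1) (use assms(1) le lt \<alpha>0 in auto)
      moreover have "(\<Sum>\<alpha>\<in>E. poly (P' \<alpha>) (of_nat k) * \<alpha> ^ k) = 0" for k
      proof -
        have "(\<Sum>\<alpha>\<in>E. poly (P' \<alpha>) (of_nat k) * \<alpha> ^ k)
            = (\<Sum>\<alpha>\<in>E. poly (P \<alpha>) (of_nat (Suc k)) * \<alpha> ^ Suc k)
              - \<alpha>0 * (\<Sum>\<alpha>\<in>E. poly (P \<alpha>) (of_nat k) * \<alpha> ^ k)"
          unfolding P'_def sum_distrib_left sum_subtractf[symmetric]
          by (rule sum.cong) (simp_all add: poly_pcompose algebra_simps)
        then show ?thesis using less.prems[of k] less.prems[of "Suc k"] by simp
      qed
      ultimately have P'0: "\<forall>\<alpha>\<in>E. P' \<alpha> = 0" by (rule less.hyps)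
      have oth: "P \<alpha> = 0" if "\<alpha> \<in> E - {\<alpha>0}" for \<alpha>
        using top[of \<alpha>] P'0 that by auto
      have "poly (P \<alpha>0) (of_nat k) = 0" for k
      proof -
        have "0 = poly (P \<alpha>0) (of_nat k) * \<alpha>0 ^ k"
          using less.prems[of k] oth by (subst (asm) sum.remove[OF assms(1) \<alpha>0(1)]) simp
        then show ?thesis using \<alpha>0(1) assms(2) by auto
      qed
      then have "range (of_nat :: nat \<Rightarrow> complex) \<subseteq> {x. poly (P \<alpha>0) x = 0}" by auto
      moreover have "infinite (range (of_nat :: nat \<Rightarrow> complex))"
        by (rule range_inj_infinite) (simp add: inj_on_def)
      ultimately show False using poly_roots_finite[OF \<alpha>0(2)] finite_subset by blast
    qed
  qed
  then show ?thesis using assms(4) by blast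
qed

lemma power_int_square: "(x powi m) ^ 2 = (x ^ 2) powi m" for x :: complex
  by (simp add: power_int_power power_int_power' mult.commute)

text \<open>Start from arbitrary square roots and change their signs by \<open>s\<close>. For a relation \<open>m\<close> among
  the elements of \<open>E\<close>, the corresponding product \<open>e s m\<close> of roots is \<open>1\<close> or \<open>-1\<close>, and a sign
  vector is wanted for which all of them are \<open>1\<close>. Such a vector exists if the sum over all \<open>s\<close>
  of the products of all \<open>e s m + 1\<close> is nonzero. Expanding the product gives one term for each
  set \<open>C'\<close> of relations. Averaging over the signs kills the term if the sum of the relations
  in \<open>C'\<close> has an odd exponent. Otherwise half of that sum is an exponent vector for which the
  product over \<open>E\<close> has square \<open>1\<close>, and the last hypothesis leaves only the value \<open>1\<close>, so that
  the term is positive. The bound \<open>N\<close> covers half of the sum of all relations with exponents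
  up to \<open>d\<close>.\<close>
lemma multiplicative_square_roots:
  fixes E :: "complex set" and d N :: nat
  assumes E: "finite E" "0 \<notin> E" and N: "d * (2 * d + 1) ^ card E \<le> N"
    and no: "\<And>m. (\<And>\<alpha>. \<alpha> \<in> E \<Longrightarrow> \<bar>m \<alpha>\<bar> \<le> int N) \<Longrightarrow> (\<Prod>\<alpha>\<in>E. \<alpha> powi m \<alpha>) \<noteq> -1"
  obtains \<mu> where "\<And>\<alpha>. \<alpha> \<in> E \<Longrightarrow> \<mu> \<alpha> ^ 2 = \<alpha>"
    and "\<And>m. (\<And>\<alpha>. \<alpha> \<in> E \<Longrightarrow> \<bar>m \<alpha>\<bar> \<le> int d) \<Longrightarrow> (\<Prod>\<alpha>\<in>E. \<alpha> powi m \<alpha>) = 1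
            \<Longrightarrow> (\<Prod>\<alpha>\<in>E. \<mu> \<alpha> powi m \<alpha>) = 1"
proof -
  define B where "B = (\<Pi>\<^sub>E \<alpha>\<in>E. {- int d..int d})"
  define C where "C = {m \<in> B. (\<Prod>\<alpha>\<in>E. \<alpha> powi m \<alpha>) = 1}"
  define \<Sigma> where "\<Sigma> = (\<Pi>\<^sub>E \<alpha>\<in>E. {1, -1 :: complex})"
  define e where "e s m = (\<Prod>\<alpha>\<in>E. (s \<alpha> * csqrt \<alpha>) powi m \<alpha>)" for s :: "complex \<Rightarrow> complex" and m
  have finB: "finite B" unfolding B_def by (intro finite_PiE E) simp
  have cardB: "card B = (2 * d + 1) ^ card E"
    unfolding B_def by (subst card_PiE) (use E in \<open>simp_all add: nat_add_distrib nat_mult_distrib\<close>)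
  have finC: "finite C" unfolding C_def using finB by simp
  have cardC: "card C \<le> (2 * d + 1) ^ card E"
    unfolding cardB[symmetric] by (rule card_mono[OF finB]) (auto simp: C_def)
  have fin\<Sigma>: "finite \<Sigma>" unfolding \<Sigma>_def by (intro finite_PiE E) simp
  have nz: "s \<alpha> * csqrt \<alpha> \<noteq> 0" if "s \<in> \<Sigma>" "\<alpha> \<in> E" for s \<alpha>
    using that E unfolding \<Sigma>_def by (fastforce simp: PiE_iff)
  have sq: "(s \<alpha> * csqrt \<alpha>) ^ 2 = \<alpha>" if "s \<in> \<Sigma>" "\<alpha> \<in> E" for s \<alpha>
  proof -
    have "s \<alpha> ^ 2 = 1" using that unfolding \<Sigma>_def by (fastforce simp: PiE_iff)
    then show ?thesis by (simp add: power_mult_distrib)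
  qed
  have e2: "e s m ^ 2 = (\<Prod>\<alpha>\<in>E. \<alpha> powi m \<alpha>)" if "s \<in> \<Sigma>" for s m
    unfolding e_def prod_power_distrib
    by (rule prod.cong) (simp_all add: power_int_square sq[OF that])
  have esum: "(\<Prod>m\<in>C'. e s m) = e s (\<lambda>\<alpha>. \<Sum>m\<in>C'. m \<alpha>)" if "s \<in> \<Sigma>" "finite C'" for s C'
    using that(2)
  proof (induction C' rule: finite_induct)
    case (insert m C')
    have "e s (\<lambda>\<alpha>. \<Sum>m\<in>insert m C'. m \<alpha>)
        = (\<Prod>\<alpha>\<in>E. (s \<alpha> * csqrt \<alpha>) powi m \<alpha> * (s \<alpha> * csqrt \<alpha>) powi (\<Sum>m\<in>C'. m \<alpha>))"
      unfolding e_def sum.insert[OF insert.hyps]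
      by (rule prod.cong[OF refl], rule power_int_add) (use nz[OF that(1)] in blast)
    also have "\<dots> = e s m * e s (\<lambda>\<alpha>. \<Sum>m\<in>C'. m \<alpha>)" by (simp only: e_def prod.distrib)
    finally show ?case unfolding prod.insert[OF insert.hyps] insert.IH by (rule sym)
  qed (simp add: e_def)
  define f where "f C' = (\<Sum>s\<in>\<Sigma>. \<Prod>m\<in>C'. e s m)" for C'
  have f: "f C' = 0 \<or> f C' = 2 ^ card E" if "C' \<subseteq> C" for C'
  proof -
    have finC': "finite C'" using that finC finite_subset by blast
    define M where "M \<alpha> = (\<Sum>m\<in>C'. m \<alpha>)" for \<alpha>
    have "f C' = (\<Sum>s\<in>\<Sigma>. (\<Prod>\<alpha>\<in>E. s \<alpha> powi M \<alpha>) * (\<Prod>\<alpha>\<in>E. csqrt \<alpha> powi M \<alpha>))"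
      unfolding f_def using esum[OF _ finC']
      by (intro sum.cong) (auto simp: e_def M_def power_int_mult_distrib prod.distrib)
    also have "\<dots> = (\<Sum>s\<in>\<Sigma>. (\<Prod>\<alpha>\<in>E. s \<alpha> powi M \<alpha>)) * (\<Prod>\<alpha>\<in>E. csqrt \<alpha> powi M \<alpha>)"
      by (simp add: sum_distrib_right)
    also have "(\<Sum>s\<in>\<Sigma>. (\<Prod>\<alpha>\<in>E. s \<alpha> powi M \<alpha>)) = (\<Prod>\<alpha>\<in>E. \<Sum>t\<in>{1,-1::complex}. t powi M \<alpha>)"
      unfolding \<Sigma>_def by (rule prod_sum_PiE[symmetric]) (use E in auto)
    finally have fC: "f C' = (\<Prod>\<alpha>\<in>E. \<Sum>t\<in>{1,-1::complex}. t powi M \<alpha>) * (\<Prod>\<alpha>\<in>E. csqrt \<alpha> powi M \<alpha>)" .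
    show ?thesis
    proof (cases "\<exists>\<alpha>\<in>E. odd (M \<alpha>)")
      case True
      then have "(\<Prod>\<alpha>\<in>E. \<Sum>t\<in>{1,-1::complex}. t powi M \<alpha>) = 0"
        using E by (auto simp: power_int_minus_left intro!: prod_zero)
      then show ?thesis unfolding fC by simp
    next
      case False
      \<comment> \<open>all exponents are even, so the relation has a square root, which is not \<open>-1\<close> by hypothesis\<close>
      define h where "h \<alpha> = M \<alpha> div 2" for \<alpha>
      have Mh: "M \<alpha> = 2 * h \<alpha>" if "\<alpha> \<in> E" for \<alpha> using False that by (auto simp: h_def)
      define \<kappa> where "\<kappa> = (\<Prod>\<alpha>\<in>E. \<alpha> powi h \<alpha>)"
      have c2: "csqrt \<alpha> powi (2 * i) = \<alpha> powi i" for \<alpha> i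
        by (metis power2_csqrt power_int_power of_nat_numeral)
      have "\<kappa> ^ 2 = (\<Prod>\<alpha>\<in>E. \<alpha> powi M \<alpha>)"
        unfolding \<kappa>_def prod_power_distrib
        by (rule prod.cong) (simp_all add: Mh power_int_square power_int_power)
      also have "\<dots> = (\<Prod>m\<in>C'. \<Prod>\<alpha>\<in>E. \<alpha> powi m \<alpha>)"
        using finC'
      proof (unfold M_def, induction C' rule: finite_induct)
        case (insert m C')
        have ne: "\<alpha> \<in> E \<Longrightarrow> \<alpha> \<noteq> 0" for \<alpha> using E by auto
        show ?case using insert
          by (simp add: power_int_add ne prod.distrib cong: prod.cong)
      qed simp
      also have "\<dots> = 1" using that by (intro prod.neutral) (auto simp: C_def)
      finally have "\<kappa> = 1 \<or> \<kappa> = -1" by (simp add: power2_eq_1_iff)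
      moreover have "\<kappa> \<noteq> -1"
        unfolding \<kappa>_def
      proof (rule no)
        fix \<alpha> assume l: "\<alpha> \<in> E"
        have "\<bar>m \<alpha>\<bar> \<le> int d" if "m \<in> C'" for m
          using that \<open>C' \<subseteq> C\<close> l unfolding C_def B_def by (force simp: PiE_iff abs_le_iff)
        then have "\<bar>M \<alpha>\<bar> \<le> int (card C') * int d"
          unfolding M_def using order.trans[OF sum_abs sum_bounded_above[of C' "\<lambda>m. \<bar>m \<alpha>\<bar>" "int d"]] by simp
        also have "\<dots> \<le> int N"
        proof -
          have "card C' \<le> (2 * d + 1) ^ card E" using card_mono[OF finC that] cardC by linarith
          then have "card C' * d \<le> N" using N by (metis mult.commute mult_le_mono1 order.trans)
          then show ?thesis by (metis of_nat_le_iff of_nat_mult)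
        qed
        finally show "\<bar>h \<alpha>\<bar> \<le> int N" using Mh[OF l] by simp
      qed
      ultimately have "\<kappa> = 1" by blast
      moreover have "(\<Prod>\<alpha>\<in>E. csqrt \<alpha> powi M \<alpha>) = \<kappa>"
        unfolding \<kappa>_def by (rule prod.cong) (simp_all add: Mh c2)
      moreover have "(\<Prod>\<alpha>\<in>E. \<Sum>t\<in>{1,-1::complex}. t powi M \<alpha>) = 2 ^ card E"
        using False by (simp add: power_int_minus_left)
      ultimately show ?thesis unfolding fC by simp
    qed
  qed
  have f0: "f {} = 2 ^ card E"
    unfolding f_def \<Sigma>_def using E by (simp add: card_PiE card_insert_if numeral_2_eq_2)
  have "(\<Sum>s\<in>\<Sigma>. \<Prod>m\<in>C. e s m + 1) = (\<Sum>C'\<in>Pow C. f C')"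
    unfolding f_def by (subst sum.swap) (simp add: prod_add[OF finC])
  moreover have "Re (\<Sum>C'\<in>Pow C. f C') > 0"
  proof -
    have real: "Re (2 ^ card E) = 2 ^ card E"
      by (metis Re_complex_of_real of_real_numeral of_real_power)
    have "Re (f {}) \<le> (\<Sum>C'\<in>Pow C. Re (f C'))"
    proof (rule member_le_sum)
      fix C' assume "C' \<in> Pow C - {{}}"
      then have "f C' = 0 \<or> f C' = 2 ^ card E" using f by blast
      then show "0 \<le> Re (f C')" using real by auto
    qed (use finC in auto)
    then show ?thesis using f0 real by (simp add: order.strict_trans2[rotated])
  qed
  ultimately have "(\<Sum>s\<in>\<Sigma>. \<Prod>m\<in>C. e s m + 1) \<noteq> 0"
    by (metis less_irrefl zero_complex.sel(1))
  then obtain s where s: "s \<in> \<Sigma>" "(\<Prod>m\<in>C. e s m + 1) \<noteq> 0"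
    by (meson sum.not_neutral_contains_not_neutral)
  show ?thesis
  proof (rule that[of "\<lambda>\<alpha>. s \<alpha> * csqrt \<alpha>"])
    show "(s \<alpha> * csqrt \<alpha>)\<^sup>2 = \<alpha>" if "\<alpha> \<in> E" for \<alpha> by (rule sq[OF s(1) that])
    fix m :: "complex \<Rightarrow> int"
    assume m: "\<And>\<alpha>. \<alpha> \<in> E \<Longrightarrow> \<bar>m \<alpha>\<bar> \<le> int d" and m1: "(\<Prod>\<alpha>\<in>E. \<alpha> powi m \<alpha>) = 1"
    have "restrict m E \<in> C"
      using m m1 unfolding C_def B_def by (auto simp: abs_le_iff minus_le_iff cong: prod.cong)
    then have "e s (restrict m E) \<noteq> -1"
      using s(2) finC by (auto simp: eq_neg_iff_add_eq_0)
    moreover have "e s (restrict m E) = e s m" unfolding e_def by (rule prod.cong) auto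
    moreover have "e s m ^ 2 = 1" using e2[OF s(1)] m1 by simp
    ultimately show "(\<Prod>\<alpha>\<in>E. (s \<alpha> * csqrt \<alpha>) powi m \<alpha>) = 1"
      unfolding e_def[symmetric] by (auto simp: power2_eq_1_iff)
  qed
qed

section \<open>Evaluating exponential polynomials at one half\<close>

text \<open>\<open>half_value E \<mu> d a x\<close> says that \<open>a\<close> is an exponential polynomial in \<open>k\<close> whose frequencies
  are monomials in the elements of \<open>E\<close> with exponents at most \<open>d\<close>, and that \<open>x\<close> arises by
  substituting \<open>k = 1/2\<close>, where \<open>\<mu> \<alpha>\<close> plays the role of the square root of \<open>\<alpha>\<close>. It is a
  relation because the same sequence may have several expressions; \<open>half_value_unique\<close> gives
  the condition under which the value is determined.\<close>
inductive half_value :: "complex set \<Rightarrow> (complex \<Rightarrow> complex) \<Rightarrow> nat \<Rightarrow> (nat \<Rightarrow> complex) \<Rightarrow> complex \<Rightarrow> bool"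
  for E \<mu> d where
    monomial: "(\<And>\<alpha>. \<alpha> \<in> E \<Longrightarrow> m \<alpha> \<le> d) \<Longrightarrow>
      half_value E \<mu> d (\<lambda>k. poly p (of_nat k) * (\<Prod>\<alpha>\<in>E. \<alpha> ^ m \<alpha>) ^ k)
        (poly p (1/2) * (\<Prod>\<alpha>\<in>E. \<mu> \<alpha> ^ m \<alpha>))"
  | add: "half_value E \<mu> d a x \<Longrightarrow> half_value E \<mu> d b y \<Longrightarrow>
      half_value E \<mu> d (\<lambda>k. a k + b k) (x + y)"

lemma half_value_mono:
  "half_value E \<mu> d a x \<Longrightarrow> d \<le> d' \<Longrightarrow> half_value E \<mu> d' a x"
proof (induction rule: half_value.induct)
  case (monomial m p)
  then show ?case by (intro half_value.monomial) (auto intro: order.trans)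
qed (blast intro: half_value.add)

lemma half_value_const: "half_value E \<mu> d (\<lambda>k. c) c"
  using half_value.monomial[of E "\<lambda>_. 0" d \<mu> "[:c:]"] by simp

lemma half_value_mult:
  assumes "half_value E \<mu> d a x" and "half_value E \<mu> d' b y"
  shows "half_value E \<mu> (d + d') (\<lambda>k. a k * b k) (x * y)"
  using assms
proof (induction rule: half_value.induct)
  case (monomial m p)
  from monomial(2) show ?case
  proof (induction rule: half_value.induct)
    case (monomial m' p')
    have "half_value E \<mu> (d + d')
        (\<lambda>k. poly (p * p') (of_nat k) * (\<Prod>\<alpha>\<in>E. \<alpha> ^ (m \<alpha> + m' \<alpha>)) ^ k)
        (poly (p * p') (1/2) * (\<Prod>\<alpha>\<in>E. \<mu> \<alpha> ^ (m \<alpha> + m' \<alpha>)))"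
      by (rule half_value.monomial) (use monomial \<open>\<And>\<alpha>. \<alpha> \<in> E \<Longrightarrow> m \<alpha> \<le> d\<close> in \<open>auto intro: add_mono\<close>)
    then show ?case by (simp add: power_add prod.distrib power_mult_distrib mult_ac)
  next
    case (add a x b y)
    from half_value.add[OF add.IH] show ?case by (simp add: algebra_simps)
  qed
next
  case (add a x b y)
  from half_value.add[OF add.IH(1) add.IH(2)] add.prems show ?case by (simp add: algebra_simps)
qed

lemma half_value_sum:
  assumes "finite I" and "\<And>i. i \<in> I \<Longrightarrow> half_value E \<mu> d (a i) (x i)"
  shows "half_value E \<mu> d (\<lambda>k. \<Sum>i\<in>I. a i k) (\<Sum>i\<in>I. x i)"
  using assms
  by (induction I rule: finite_induct) (auto intro: half_value_const half_value.add)

text \<open>Substituting \<open>k = 1/2\<close> in \<open>a (2 * k)\<close> gives the true value \<open>a 1\<close>, because \<open>\<mu> \<alpha>\<close> squares to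
  \<open>\<alpha>\<close>.\<close>
lemma half_value_double:
  assumes "half_value E \<mu> d a x" and "\<And>\<alpha>. \<alpha> \<in> E \<Longrightarrow> \<mu> \<alpha> ^ 2 = \<alpha>"
  shows "half_value E \<mu> (2 * d) (\<lambda>k. a (2 * k)) (a 1)"
  using assms(1)
proof (induction rule: half_value.induct)
  case (monomial m p)
  have "half_value E \<mu> (2 * d)
      (\<lambda>k. poly (p \<circ>\<^sub>p [:0, 2:]) (of_nat k) * (\<Prod>\<alpha>\<in>E. \<alpha> ^ (2 * m \<alpha>)) ^ k)
      (poly (p \<circ>\<^sub>p [:0, 2:]) (1/2) * (\<Prod>\<alpha>\<in>E. \<mu> \<alpha> ^ (2 * m \<alpha>)))"
    by (rule half_value.monomial) (use monomial in auto)
  moreover have "(\<Prod>\<alpha>\<in>E. \<mu> \<alpha> ^ (2 * m \<alpha>)) = (\<Prod>\<alpha>\<in>E. \<alpha> ^ m \<alpha>)"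
    by (rule prod.cong) (simp_all add: power_mult assms(2))
  moreover have "(\<Prod>\<alpha>\<in>E. \<alpha> ^ (2 * m \<alpha>)) ^ k = (\<Prod>\<alpha>\<in>E. \<alpha> ^ m \<alpha>) ^ (2 * k)" for k
    by (simp add: prod_power_distrib mult_ac flip: power_mult)
  ultimately show ?case by (simp add: poly_pcompose mult_ac)
qed (auto intro: half_value.add)

text \<open>By the hypothesis on \<open>\<mu>\<close>, two monomials with exponents at most \<open>d\<close> that agree at the
  elements of \<open>E\<close> also agree at their roots, so that every frequency \<open>\<kappa>\<close> has a well-defined
  root \<open>g \<kappa>\<close>. After collecting terms by frequency, the coefficients are determined by the
  sequence.\<close>
lemma half_value_unique:
  assumes E: "finite E" "0 \<notin> E"
    and \<mu>: "\<And>m. (\<And>\<alpha>. \<alpha> \<in> E \<Longrightarrow> \<bar>m \<alpha>\<bar> \<le> int d) \<Longrightarrow> (\<Prod>\<alpha>\<in>E. \<alpha> powi m \<alpha>) = 1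
          \<Longrightarrow> (\<Prod>\<alpha>\<in>E. \<mu> \<alpha> powi m \<alpha>) = 1"
    and nz: "\<And>\<alpha>. \<alpha> \<in> E \<Longrightarrow> \<mu> \<alpha> \<noteq> 0"
    and "half_value E \<mu> d a x" and "half_value E \<mu> d a y"
  shows "x = y"
proof -
  define B where "B = (\<Pi>\<^sub>E \<alpha>\<in>E. {..d})"
  define K where "K = (\<lambda>m. \<Prod>\<alpha>\<in>E. \<alpha> ^ m \<alpha>) ` B"
  have fin: "finite K" unfolding K_def B_def by (intro finite_imageI finite_PiE E) simp
  have K0: "0 \<notin> K" unfolding K_def using E by auto
  define g where "g \<kappa> = (\<Prod>\<alpha>\<in>E. \<mu> \<alpha> ^ (SOME m. m \<in> B \<and> \<kappa> = (\<Prod>\<alpha>\<in>E. \<alpha> ^ m \<alpha>)) \<alpha>)" for \<kappa>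
  have g: "g (\<Prod>\<alpha>\<in>E. \<alpha> ^ m \<alpha>) = (\<Prod>\<alpha>\<in>E. \<mu> \<alpha> ^ m \<alpha>)" if m: "\<And>\<alpha>. \<alpha> \<in> E \<Longrightarrow> m \<alpha> \<le> d" for m
  proof -
    define m' where "m' = (SOME m'. m' \<in> B \<and> (\<Prod>\<alpha>\<in>E. \<alpha> ^ m \<alpha>) = (\<Prod>\<alpha>\<in>E. \<alpha> ^ m' \<alpha>))"
    have "restrict m E \<in> B \<and> (\<Prod>\<alpha>\<in>E. \<alpha> ^ m \<alpha>) = (\<Prod>\<alpha>\<in>E. \<alpha> ^ restrict m E \<alpha>)"
      using m unfolding B_def by (auto cong: prod.cong)
    then have ex: "\<exists>m'. m' \<in> B \<and> (\<Prod>\<alpha>\<in>E. \<alpha> ^ m \<alpha>) = (\<Prod>\<alpha>\<in>E. \<alpha> ^ m' \<alpha>)"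
      by (rule exI[of _ "restrict m E"])
    have "m' \<in> B \<and> (\<Prod>\<alpha>\<in>E. \<alpha> ^ m \<alpha>) = (\<Prod>\<alpha>\<in>E. \<alpha> ^ m' \<alpha>)"
      unfolding m'_def by (rule someI_ex[OF ex])
    then have m': "m' \<in> B" "(\<Prod>\<alpha>\<in>E. \<alpha> ^ m \<alpha>) = (\<Prod>\<alpha>\<in>E. \<alpha> ^ m' \<alpha>)" by simp_all
    have split: "(\<Prod>\<alpha>\<in>E. f \<alpha> powi (int (m \<alpha>) - int (m' \<alpha>)))
        = (\<Prod>\<alpha>\<in>E. f \<alpha> ^ m \<alpha>) / (\<Prod>\<alpha>\<in>E. f \<alpha> ^ m' \<alpha>)"
      if "\<And>\<alpha>. \<alpha> \<in> E \<Longrightarrow> f \<alpha> \<noteq> (0::complex)" for f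
      unfolding prod_dividef[symmetric]
      by (rule prod.cong) (simp_all add: power_int_diff that)
    have E0: "\<alpha> \<in> E \<Longrightarrow> \<alpha> \<noteq> 0" for \<alpha> using E by auto
    have "(\<Prod>\<alpha>\<in>E. \<mu> \<alpha> powi (int (m \<alpha>) - int (m' \<alpha>))) = 1"
    proof (rule \<mu>)
      show "\<bar>int (m \<alpha>) - int (m' \<alpha>)\<bar> \<le> int d" if "\<alpha> \<in> E" for \<alpha>
        using m[OF that] m'(1) that unfolding B_def by (fastforce simp: PiE_iff)
      show "(\<Prod>\<alpha>\<in>E. \<alpha> powi (int (m \<alpha>) - int (m' \<alpha>))) = 1"
        using split[OF E0] m'(2) E by simp
    qed
    then have "(\<Prod>\<alpha>\<in>E. \<mu> \<alpha> ^ m \<alpha>) = (\<Prod>\<alpha>\<in>E. \<mu> \<alpha> ^ m' \<alpha>)"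
      using split[OF nz] E nz by simp
    then show ?thesis unfolding g_def m'_def by simp
  qed
  have normal: "\<exists>P. (\<forall>k. a k = (\<Sum>\<kappa>\<in>K. poly (P \<kappa>) (of_nat k) * \<kappa> ^ k)) \<and>
      x = (\<Sum>\<kappa>\<in>K. poly (P \<kappa>) (1/2) * g \<kappa>)" if "half_value E \<mu> d a x" for a x
    using that
  proof (induction rule: half_value.induct)
    case (monomial m p)
    let ?\<kappa> = "\<Prod>\<alpha>\<in>E. \<alpha> ^ m \<alpha>"
    have "?\<kappa> = (\<Prod>\<alpha>\<in>E. \<alpha> ^ restrict m E \<alpha>)" "restrict m E \<in> B"
      using monomial unfolding B_def by (auto cong: prod.cong)
    then have \<kappa>: "?\<kappa> \<in> K" unfolding K_def by blast
    have "poly (if \<kappa> = ?\<kappa> then p else 0) z * w = (if \<kappa> = ?\<kappa> then poly p z * w else 0)" for \<kappa> z w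
      by simp
    then show ?case
      by (intro exI[of _ "\<lambda>\<kappa>. if \<kappa> = ?\<kappa> then p else 0"]) (simp add: fin \<kappa> g[OF monomial] sum.delta cong: if_cong)
  next
    case (add a x b y)
    then obtain P Q where
      "\<forall>k. a k = (\<Sum>\<kappa>\<in>K. poly (P \<kappa>) (of_nat k) * \<kappa> ^ k)" "x = (\<Sum>\<kappa>\<in>K. poly (P \<kappa>) (1/2) * g \<kappa>)"
      "\<forall>k. b k = (\<Sum>\<kappa>\<in>K. poly (Q \<kappa>) (of_nat k) * \<kappa> ^ k)" "y = (\<Sum>\<kappa>\<in>K. poly (Q \<kappa>) (1/2) * g \<kappa>)"
      by blast
    then show ?case
      by (intro exI[of _ "\<lambda>\<kappa>. P \<kappa> + Q \<kappa>"]) (simp add: algebra_simps sum.distrib)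
  qed
  obtain P Q where
    P: "\<And>k. a k = (\<Sum>\<kappa>\<in>K. poly (P \<kappa>) (of_nat k) * \<kappa> ^ k)" "x = (\<Sum>\<kappa>\<in>K. poly (P \<kappa>) (1/2) * g \<kappa>)"
    and Q: "\<And>k. a k = (\<Sum>\<kappa>\<in>K. poly (Q \<kappa>) (of_nat k) * \<kappa> ^ k)" "y = (\<Sum>\<kappa>\<in>K. poly (Q \<kappa>) (1/2) * g \<kappa>)"
    using normal[OF assms(5)] normal[OF assms(6)] by blast
  have "P \<kappa> - Q \<kappa> = 0" if "\<kappa> \<in> K" for \<kappa>
    by (rule exponential_polynomials_independent[OF fin K0 _ that, of "\<lambda>\<kappa>. P \<kappa> - Q \<kappa>"])
      (use P(1) Q(1) in \<open>simp add: algebra_simps sum_subtractf\<close>)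
  then show ?thesis using P(2) Q(2) by simp
qed

section \<open>Determinants that detect products of eigenvalues\<close>

lemma separable_const: "separable X UNIV (\<lambda>x y. c)"
  by (rule separable_single[of "\<lambda>x. c" _ "\<lambda>y. 1"]) simp_all

lemma separable_mult_UNIV:
  assumes "separable X UNIV \<Phi>" "separable X UNIV \<Psi>"
  shows "separable X UNIV (\<lambda>x y. \<Phi> x y * \<Psi> x y)"
proof (rule separable_mult[OF _ assms])
  show "\<exists>h\<in>UNIV. \<forall>x\<in>X. h x = f x * g x" for f g :: "'a \<Rightarrow> complex"
    by (rule bexI[of _ "\<lambda>x. f x * g x"]) simp_all
qed simp

lemma separable_sum:
  assumes "finite I" "\<And>i. i \<in> I \<Longrightarrow> separable X UNIV (\<lambda>x y. \<Phi> i x y)"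
  shows "separable X UNIV (\<lambda>x y. \<Sum>i\<in>I. \<Phi> i x y)"
  using assms
proof (induction I rule: finite_induct)
  case empty
  show ?case unfolding sum.empty by (rule separable_const)
next
  case (insert i I)
  have "separable X UNIV (\<lambda>x y. \<Phi> i x y)" "separable X UNIV (\<lambda>x y. \<Sum>i\<in>I. \<Phi> i x y)"
    using insert by blast+
  then show ?case by (rule separable_add) (simp add: insert.hyps)
qed

lemma separable_prod:
  assumes "finite I" "\<And>i. i \<in> I \<Longrightarrow> separable X UNIV (\<lambda>x y. \<Phi> i x y)"
  shows "separable X UNIV (\<lambda>x y. \<Prod>i\<in>I. \<Phi> i x y)"
  using assms
proof (induction I rule: finite_induct)
  case empty
  show ?case unfolding prod.empty by (rule separable_const)
next
  case (insert i I)
  show ?case unfolding prod.insert[OF insert.hyps]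
    by (rule separable_mult_UNIV) (use insert in blast)+
qed

text \<open>The Kronecker product, with pairs of indices encoded by quotient and remainder.\<close>
definition kron_mat :: "complex mat \<Rightarrow> complex mat \<Rightarrow> complex mat" where
  "kron_mat A B = mat (dim_row A * dim_row B) (dim_col A * dim_col B)
     (\<lambda>(i, j). A $$ (i div dim_row B, j div dim_col B) * B $$ (i mod dim_row B, j mod dim_col B))"

definition kron_vec :: "complex vec \<Rightarrow> complex vec \<Rightarrow> complex vec" where
  "kron_vec v w = vec (dim_vec v * dim_vec w) (\<lambda>i. v $ (i div dim_vec w) * w $ (i mod dim_vec w))"

lemma kron_mat_carrier [simp]:
  "A \<in> carrier_mat n n \<Longrightarrow> B \<in> carrier_mat m m \<Longrightarrow> kron_mat A B \<in> carrier_mat (n * m) (n * m)"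
  unfolding kron_mat_def by auto

lemma kron_mat_index:
  assumes "A \<in> carrier_mat n n" "B \<in> carrier_mat m m" "i < n * m" "j < n * m"
  shows "kron_mat A B $$ (i, j) = A $$ (i div m, j div m) * B $$ (i mod m, j mod m)"
  using assms unfolding kron_mat_def by auto

lemma kron_vec_carrier [simp]:
  "v \<in> carrier_vec n \<Longrightarrow> w \<in> carrier_vec m \<Longrightarrow> kron_vec v w \<in> carrier_vec (n * m)"
  unfolding kron_vec_def by auto

lemma div_mod_less: "(i::nat) < n * m \<Longrightarrow> i div m < n \<and> i mod m < m"
  by (metis less_mult_imp_div_less mod_less_divisor mult_0_right not_gr_zero not_less_zero)

lemma sum_div_mod:
  "(\<Sum>j<n * m. f (j div m) (j mod m)) = (\<Sum>a<n. \<Sum>b<m. f a b)" for f :: "nat \<Rightarrow> nat \<Rightarrow> complex"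
proof -
  have "a * m + b < n * m" if "a < n" "b < m" for a b :: nat
  proof -
    have "a * m + b < Suc a * m" using that by simp
    also have "\<dots> \<le> n * m" using that by (intro mult_right_mono) auto
    finally show ?thesis .
  qed
  then have "(\<Sum>(a, b)\<in>{..<n} \<times> {..<m}. f a b) = (\<Sum>j<n * m. f (j div m) (j mod m))"
    by (intro sum.reindex_bij_witness[of _ "\<lambda>j. (j div m, j mod m)" "\<lambda>(a, b). a * m + b"])
      (auto simp: div_mod_less)
  then show ?thesis by (simp add: sum.cartesian_product)
qed

lemma kron_mat_mult_vec:
  assumes "A \<in> carrier_mat n n" "B \<in> carrier_mat m m" "v \<in> carrier_vec n" "w \<in> carrier_vec m"
  shows "kron_mat A B *\<^sub>v kron_vec v w = kron_vec (A *\<^sub>v v) (B *\<^sub>v w)"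
proof (rule eq_vecI)
  have dims: "dim_row A = n" "dim_col A = n" "dim_row B = m" "dim_col B = m" "dim_vec v = n" "dim_vec w = m"
    using assms by auto
  show "dim_vec (kron_mat A B *\<^sub>v kron_vec v w) = dim_vec (kron_vec (A *\<^sub>v v) (B *\<^sub>v w))"
    by (simp add: kron_mat_def kron_vec_def dims)
  fix i assume "i < dim_vec (kron_vec (A *\<^sub>v v) (B *\<^sub>v w))"
  then have i: "i < n * m" by (simp add: kron_vec_def dims)
  note im = div_mod_less[OF i]
  have "(kron_mat A B *\<^sub>v kron_vec v w) $ i = (\<Sum>j<n * m. (A $$ (i div m, j div m) * v $ (j div m)) *
      (B $$ (i mod m, j mod m) * w $ (j mod m)))"
    using i by (simp add: kron_mat_def kron_vec_def dims scalar_prod_def lessThan_atLeast0 mult_ac)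
  also have "\<dots> = (\<Sum>a<n. \<Sum>b<m. (A $$ (i div m, a) * v $ a) * (B $$ (i mod m, b) * w $ b))"
    by (rule sum_div_mod)
  also have "\<dots> = (\<Sum>a<n. A $$ (i div m, a) * v $ a) * (\<Sum>b<m. B $$ (i mod m, b) * w $ b)"
    by (simp add: sum_product)
  also have "\<dots> = kron_vec (A *\<^sub>v v) (B *\<^sub>v w) $ i"
    using i im by (simp add: kron_vec_def dims scalar_prod_def lessThan_atLeast0)
  finally show "(kron_mat A B *\<^sub>v kron_vec v w) $ i = kron_vec (A *\<^sub>v v) (B *\<^sub>v w) $ i" .
qed

lemma kron_vec_smult:
  assumes "v \<in> carrier_vec n" "w \<in> carrier_vec m"
  shows "kron_vec (a \<cdot>\<^sub>v v) (b \<cdot>\<^sub>v w) = (a * b) \<cdot>\<^sub>v kron_vec v w"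
proof (rule eq_vecI)
  fix i assume "i < dim_vec ((a * b) \<cdot>\<^sub>v kron_vec v w)"
  then have "i < n * m" using assms by (simp add: kron_vec_def)
  from this div_mod_less[OF this]
  show "kron_vec (a \<cdot>\<^sub>v v) (b \<cdot>\<^sub>v w) $ i = ((a * b) \<cdot>\<^sub>v kron_vec v w) $ i"
    using assms by (simp add: kron_vec_def)
qed (simp add: kron_vec_def)

lemma kron_vec_nonzero:
  assumes "v \<in> carrier_vec n" "w \<in> carrier_vec m" "v \<noteq> 0\<^sub>v n" "w \<noteq> 0\<^sub>v m"
  shows "kron_vec v w \<noteq> 0\<^sub>v (n * m)"
proof -
  obtain i where i: "i < n" "v $ i \<noteq> 0" using assms(1,3) by (metis carrier_vecD eq_vecI index_zero_vec)
  obtain j where j: "j < m" "w $ j \<noteq> 0" using assms(2,4) by (metis carrier_vecD eq_vecI index_zero_vec)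
  have "i * m + j < Suc i * m" using j by simp
  also have "\<dots> \<le> n * m" using i by (intro mult_right_mono) auto
  finally have ij: "i * m + j < n * m" .
  then have "kron_vec v w $ (i * m + j) = v $ i * w $ j"
    using assms j by (simp add: kron_vec_def)
  then show ?thesis using ij i j by (metis index_zero_vec(1) mult_eq_0_iff)
qed

primrec tensor_power :: "complex mat \<Rightarrow> nat \<Rightarrow> complex mat" where
  "tensor_power h 0 = 1\<^sub>m 1"
| "tensor_power h (Suc a) = kron_mat h (tensor_power h a)"

lemma tensor_power_carrier [simp]:
  "h \<in> carrier_mat n n \<Longrightarrow> tensor_power h a \<in> carrier_mat (n ^ a) (n ^ a)"
  by (induction a) auto

text \<open>A tensor product of eigenvectors is an eigenvector for the product of the eigenvalues.\<close>
lemma tensor_power_eigenvector: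
  assumes h: "h \<in> carrier_mat n n" and "\<And>\<alpha>. \<alpha> \<in> set l \<Longrightarrow> eigenvalue h \<alpha>"
  shows "\<exists>v\<in>carrier_vec (n ^ length l). v \<noteq> 0\<^sub>v (n ^ length l) \<and>
    tensor_power h (length l) *\<^sub>v v = prod_list l \<cdot>\<^sub>v v"
  using assms(2)
proof (induction l)
  case Nil
  have "vec 1 (\<lambda>_. 1 :: complex) \<noteq> 0\<^sub>v 1" by (auto simp: vec_eq_iff)
  then show ?case by (intro bexI[of _ "vec 1 (\<lambda>_. 1)"]) auto
next
  case (Cons \<alpha> l)
  then obtain v where v: "v \<in> carrier_vec (n ^ length l)" "v \<noteq> 0\<^sub>v (n ^ length l)"
    "tensor_power h (length l) *\<^sub>v v = prod_list l \<cdot>\<^sub>v v" by auto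
  obtain u where u: "u \<in> carrier_vec n" "u \<noteq> 0\<^sub>v n" "h *\<^sub>v u = \<alpha> \<cdot>\<^sub>v u"
    using Cons.prems[of \<alpha>] h unfolding eigenvalue_def eigenvector_def by auto
  have "tensor_power h (length (\<alpha> # l)) *\<^sub>v kron_vec u v = prod_list (\<alpha> # l) \<cdot>\<^sub>v kron_vec u v"
    using kron_mat_mult_vec[OF h tensor_power_carrier[OF h] u(1) v(1)] kron_vec_smult[OF u(1) v(1)]
    by (simp add: u(3) v(3))
  moreover have "kron_vec u v \<in> carrier_vec (n ^ length (\<alpha> # l))" using u v by simp
  moreover have "kron_vec u v \<noteq> 0\<^sub>v (n ^ length (\<alpha> # l))" using kron_vec_nonzero u v by simp
  ultimately show ?case by blast
qed

text \<open>The operator \<open>h\<^sup>\<otimes>\<^sup>a \<otimes> 1 + 1 \<otimes> h\<^sup>\<otimes>\<^sup>b\<close>. Its eigenvalues are the sums of a product of \<open>a\<close> and a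
  product of \<open>b\<close> eigenvalues of \<open>h\<close>, so its determinant turns multiplicative relations with
  value \<open>-1\<close> into a polynomial condition on the entries of \<open>h\<close>.\<close>
definition kron_sum :: "nat \<Rightarrow> complex mat \<Rightarrow> nat \<Rightarrow> nat \<Rightarrow> complex mat" where
  "kron_sum n h a b = kron_mat (tensor_power h a) (1\<^sub>m (n ^ b)) + kron_mat (1\<^sub>m (n ^ a)) (tensor_power h b)"

lemma kron_sum_carrier [simp]:
  "h \<in> carrier_mat n n \<Longrightarrow> kron_sum n h a b \<in> carrier_mat (n ^ a * n ^ b) (n ^ a * n ^ b)"
  unfolding kron_sum_def by (intro add_carrier_mat kron_mat_carrier) auto

lemma det_kron_sum_eq_0:
  assumes h: "h \<in> carrier_mat n n"
    and ev: "\<And>\<alpha>. \<alpha> \<in> set l \<union> set l' \<Longrightarrow> eigenvalue h \<alpha>"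
    and "prod_list l = - prod_list l'"
  shows "det (kron_sum n h (length l) (length l')) = 0"
proof -
  let ?a = "length l" and ?b = "length l'"
  obtain v where v: "v \<in> carrier_vec (n ^ ?a)" "v \<noteq> 0\<^sub>v (n ^ ?a)"
    "tensor_power h ?a *\<^sub>v v = prod_list l \<cdot>\<^sub>v v"
    using tensor_power_eigenvector[OF h, of l] ev by blast
  obtain w where w: "w \<in> carrier_vec (n ^ ?b)" "w \<noteq> 0\<^sub>v (n ^ ?b)"
    "tensor_power h ?b *\<^sub>v w = prod_list l' \<cdot>\<^sub>v w"
    using tensor_power_eigenvector[OF h, of l'] ev by blast
  let ?u = "kron_vec v w" and ?N = "n ^ ?a * n ^ ?b"
  have u: "?u \<in> carrier_vec ?N" using v w by simp
  have 1: "kron_mat (tensor_power h ?a) (1\<^sub>m (n ^ ?b)) *\<^sub>v ?u = prod_list l \<cdot>\<^sub>v ?u"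
    using kron_mat_mult_vec[OF tensor_power_carrier[OF h] one_carrier_mat v(1) w(1)]
      kron_vec_smult[OF v(1) w(1), of "prod_list l" 1] w(1) by (simp add: v(3))
  have 2: "kron_mat (1\<^sub>m (n ^ ?a)) (tensor_power h ?b) *\<^sub>v ?u = prod_list l' \<cdot>\<^sub>v ?u"
    using kron_mat_mult_vec[OF one_carrier_mat tensor_power_carrier[OF h] v(1) w(1)]
      kron_vec_smult[OF v(1) w(1), of 1 "prod_list l'"] v(1) by (simp add: w(3))
  have "kron_sum n h ?a ?b *\<^sub>v ?u = prod_list l \<cdot>\<^sub>v ?u + prod_list l' \<cdot>\<^sub>v ?u"
    unfolding kron_sum_def
    by (subst add_mult_distrib_mat_vec[where nr = ?N, OF _ _ u]) (use h in \<open>simp_all add: 1 2\<close>)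
  also have "\<dots> = 0\<^sub>v ?N" using u assms(3) by (intro eq_vecI) auto
  finally show ?thesis
    using det_0_iff_vec_prod_zero[OF kron_sum_carrier[OF h]] u kron_vec_nonzero[OF v(1) w(1) v(2) w(2)] by blast
qed

lemma kron_mat_one: "kron_mat (1\<^sub>m n) (1\<^sub>m m) = 1\<^sub>m (n * m)"
proof (rule eq_matI)
  fix i j assume "i < dim_row (1\<^sub>m (n * m))" "j < dim_col (1\<^sub>m (n * m))"
  then have ij: "i < n * m" "j < n * m" by auto
  have "i = j \<longleftrightarrow> i div m = j div m \<and> i mod m = j mod m" by (metis div_mult_mod_eq)
  then show "kron_mat (1\<^sub>m n) (1\<^sub>m m) $$ (i, j) = 1\<^sub>m (n * m) $$ (i, j)"
    using ij div_mod_less[OF ij(1)] div_mod_less[OF ij(2)] by (auto simp: kron_mat_def)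
qed (simp_all add: kron_mat_def)

lemma tensor_power_one: "tensor_power (1\<^sub>m n) a = 1\<^sub>m (n ^ a)"
  by (induction a) (simp_all add: kron_mat_one)

lemma det_kron_sum_one: "det (kron_sum n (1\<^sub>m n) a b) \<noteq> 0"
proof -
  have "kron_sum n (1\<^sub>m n) a b = 2 \<cdot>\<^sub>m 1\<^sub>m (n ^ a * n ^ b)"
    unfolding kron_sum_def tensor_power_one kron_mat_one by (rule eq_matI) auto
  then show ?thesis by (simp add: det_smult)
qed

text \<open>The determinant is a polynomial in the entries of \<open>h x y\<close>, and functions of finite rank form
  a ring.\<close>
lemma separable_det_kron_sum:
  assumes h: "\<And>x y. x \<in> X \<Longrightarrow> y \<in> X \<Longrightarrow> h x y \<in> carrier_mat n n"
    and sep: "\<And>i j. i < n \<Longrightarrow> j < n \<Longrightarrow> separable X UNIV (\<lambda>x y. h x y $$ (i, j))"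
  shows "separable X UNIV (\<lambda>x y. det (kron_sum n (h x y) a b))"
proof -
  have cong: "separable X UNIV \<Phi>"
    if "separable X UNIV \<Psi>" "\<And>x y. x \<in> X \<Longrightarrow> y \<in> X \<Longrightarrow> \<Phi> x y = \<Psi> x y" for \<Phi> \<Psi>
    using that unfolding separable_def by auto
  have tp: "separable X UNIV (\<lambda>x y. tensor_power (h x y) a $$ (i, j))" if "i < n ^ a" "j < n ^ a" for a i j
    using that
  proof (induction a arbitrary: i j)
    case 0
    show ?case unfolding tensor_power.simps by (rule separable_const)
  next
    case (Suc a)
    let ?m = "n ^ a"
    have ij: "i < n * ?m" "j < n * ?m" using Suc.prems by simp_all
    have "separable X UNIV (\<lambda>x y. h x y $$ (i div ?m, j div ?m) * tensor_power (h x y) a $$ (i mod ?m, j mod ?m))"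
      using div_mod_less[OF ij(1)] div_mod_less[OF ij(2)]
      by (intro separable_mult_UNIV sep Suc.IH) auto
    then show ?case
    proof (rule cong)
      fix x y assume "x \<in> X" "y \<in> X"
      from kron_mat_index[OF h[OF this] tensor_power_carrier[OF h[OF this]] ij]
      show "tensor_power (h x y) (Suc a) $$ (i, j) =
          h x y $$ (i div ?m, j div ?m) * tensor_power (h x y) a $$ (i mod ?m, j mod ?m)"
        by simp
    qed
  qed
  let ?N = "n ^ a * n ^ b"
  have entry: "separable X UNIV (\<lambda>x y. kron_sum n (h x y) a b $$ (i, j))" if ij: "i < ?N" "j < ?N" for i j
  proof -
    let ?m = "n ^ b"
    note d = div_mod_less[OF ij(1)] div_mod_less[OF ij(2)]
    have "separable X UNIV (\<lambda>x y. tensor_power (h x y) a $$ (i div ?m, j div ?m) * 1\<^sub>m ?m $$ (i mod ?m, j mod ?m))"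
      using d by (intro separable_mult_UNIV separable_const tp) auto
    moreover have "separable X UNIV (\<lambda>x y. 1\<^sub>m (n ^ a) $$ (i div ?m, j div ?m) * tensor_power (h x y) b $$ (i mod ?m, j mod ?m))"
      using d by (intro separable_mult_UNIV separable_const tp) auto
    ultimately show ?thesis
    proof (rule separable_add)
      fix x y assume "x \<in> X" "y \<in> X"
      note c = tensor_power_carrier[OF h[OF this], of a] tensor_power_carrier[OF h[OF this], of b]
      show "kron_sum n (h x y) a b $$ (i, j) =
        tensor_power (h x y) a $$ (i div ?m, j div ?m) * 1\<^sub>m ?m $$ (i mod ?m, j mod ?m) +
        1\<^sub>m (n ^ a) $$ (i div ?m, j div ?m) * tensor_power (h x y) b $$ (i mod ?m, j mod ?m)"
        using kron_mat_carrier[OF one_carrier_mat c(2), of "n ^ a"] ij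
          kron_mat_index[OF c(1) one_carrier_mat ij] kron_mat_index[OF one_carrier_mat c(2) ij]
        unfolding kron_sum_def by simp
    qed
  qed
  have "separable X UNIV (\<lambda>x y. \<Sum>p\<in>{p. p permutes {0..<?N}}.
      signof p * (\<Prod>i = 0..<?N. kron_sum n (h x y) a b $$ (i, p i)))"
  proof (intro separable_sum separable_mult_UNIV separable_const separable_prod)
    fix p i assume "p \<in> {p. p permutes {0..<?N}}" "i \<in> {0..<?N}"
    then have "p i < ?N" using permutes_in_image[of p "{0..<?N}" i] by auto
    then show "separable X UNIV (\<lambda>x y. kron_sum n (h x y) a b $$ (i, p i))"
      using \<open>i \<in> {0..<?N}\<close> by (intro entry) auto
  qed (auto intro: finite_permutations)
  then show ?thesis
    by (rule cong) (rule det_def'[OF kron_sum_carrier[OF h]])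
qed

section \<open>Powers of a matrix as exponential polynomials\<close>

lemma binomial_polynomial: "\<exists>p::complex poly. \<forall>k. poly p (of_nat k) = of_nat (k choose m)"
proof -
  have "poly (Polynomial.smult (1 / fact m) (\<Prod>i=0..<m. [:- of_nat i, 1:])) (of_nat k) = (of_nat (k choose m) :: complex)" for k
  proof -
    have "poly (\<Prod>i=0..<m. [:- of_nat i, 1:]) (of_nat k) = (\<Prod>i=0..<m. of_nat k - of_nat i :: complex)"
      by (simp add: poly_prod)
    then show ?thesis
      by (simp add: binomial_gbinomial gbinomial_prod_rev)
  qed
  then show ?thesis by blast
qed

text \<open>Above the diagonal, the entry at distance \<open>j - i\<close> of the \<open>k\<close>-th power of a Jordan block is
  the binomial coefficient of \<open>k\<close> over \<open>j - i\<close>, a polynomial in \<open>k\<close>, times the power of \<open>a\<close>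
  with exponent \<open>k - (j - i)\<close>.\<close>
lemma half_value_jordan_block:
  assumes "finite E" "a \<in> E" "a \<noteq> 0" "i < n" "j < n"
  shows "\<exists>c. half_value E \<mu> 1 (\<lambda>k. (jordan_block n a ^\<^sub>m k) $$ (i, j)) c"
proof (cases "i \<le> j")
  case True
  obtain p where p: "\<And>k. poly p (of_nat k) = (of_nat (k choose (j - i)) :: complex)"
    using binomial_polynomial by blast
  define m where "m \<alpha> = (if \<alpha> = a then 1 else 0 :: nat)" for \<alpha>
  have m: "(\<Prod>\<alpha>\<in>E. \<alpha> ^ m \<alpha>) = a"
    using assms(1,2) by (subst prod.remove[of E a]) (auto simp: m_def)
  have "half_value E \<mu> 1
      (\<lambda>k. poly (Polynomial.smult (1 / a ^ (j - i)) p) (of_nat k) * (\<Prod>\<alpha>\<in>E. \<alpha> ^ m \<alpha>) ^ k)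
      (poly (Polynomial.smult (1 / a ^ (j - i)) p) (1/2) * (\<Prod>\<alpha>\<in>E. \<mu> \<alpha> ^ m \<alpha>))"
    by (rule half_value.monomial) (simp add: m_def)
  moreover have "poly (Polynomial.smult (1 / a ^ (j - i)) p) (of_nat k) * (\<Prod>\<alpha>\<in>E. \<alpha> ^ m \<alpha>) ^ k
      = (jordan_block n a ^\<^sub>m k) $$ (i, j)" for k
  proof (cases "j - i \<le> k")
    case le: True
    then have "a ^ k = a ^ (j - i) * a ^ (k + i - j)" using True by (simp flip: power_add)
    then show ?thesis using True assms by (simp add: m p jordan_block_pow)
  next
    case False
    then show ?thesis using True assms by (simp add: m p jordan_block_pow binomial_eq_0)
  qed
  ultimately show ?thesis by auto
next
  case False
  then show ?thesis using assms half_value_const[of E \<mu> 1 0]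
    by (intro exI[of _ 0]) (simp add: jordan_block_pow)
qed

lemma half_value_jordan_matrix:
  assumes "finite E" "0 \<notin> E" "snd ` set n_as \<subseteq> E"
    and "i < sum_list (map fst n_as)" "j < sum_list (map fst n_as)"
  shows "\<exists>c. half_value E \<mu> 1 (\<lambda>k. (jordan_matrix n_as ^\<^sub>m k) $$ (i, j)) c"
  unfolding jordan_matrix_pow using assms(3-5)
proof (induction n_as arbitrary: i j)
  case (Cons na n_as)
  obtain n a where na: "na = (n, a)" by (cases na)
  define D where "D k = diag_block_mat (map (\<lambda>(n, a). jordan_block n a ^\<^sub>m k) n_as)" for k
  define N where "N = sum_list (map fst n_as)"
  have dimD: "dim_row (D k) = N \<and> dim_col (D k) = N" for k
  proof -
    have "jordan_matrix n_as \<in> carrier_mat N N" unfolding N_def by (rule carrier_matI) (rule jordan_matrix_dim)+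
    from pow_carrier_mat[OF this, of k] have "D k \<in> carrier_mat N N"
      unfolding D_def jordan_matrix_pow[symmetric] .
    then show ?thesis by auto
  qed
  have ij: "i < n + N" "j < n + N" using Cons.prems(2,3) by (simp_all add: na N_def)
  have eq: "diag_block_mat (map (\<lambda>(n, a). jordan_block n a ^\<^sub>m k) (na # n_as)) $$ (i, j) =
      (if i < n then if j < n then (jordan_block n a ^\<^sub>m k) $$ (i, j) else 0
       else if j < n then 0 else D k $$ (i - n, j - n))" for k
    using ij dimD[of k] by (auto simp: na Let_def D_def[symmetric])
  show ?case
  proof (cases "i < n \<longleftrightarrow> j < n")
    case True
    show ?thesis
    proof (cases "i < n")
      case i: True
      have "a \<in> E" "a \<noteq> 0" using Cons.prems(1) assms(2) by (auto simp: na)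
      from half_value_jordan_block[OF assms(1) this i, of j \<mu>] i True
      show ?thesis unfolding eq by (simp only: if_True simp_thms)
    next
      case False
      have "\<exists>c. half_value E \<mu> 1 (\<lambda>k. D k $$ (i - n, j - n)) c"
        unfolding D_def by (rule Cons.IH) (use Cons.prems(1) False True ij in \<open>auto simp: N_def\<close>)
      with False True show ?thesis unfolding eq by simp
    qed
  next
    case False
    then have "(if i < n then if j < n then (jordan_block n a ^\<^sub>m k) $$ (i, j) else 0
       else if j < n then 0 else D k $$ (i - n, j - n)) = 0" for k by auto
    then show ?thesis unfolding eq using half_value_const[of E \<mu> 1 0] by (intro exI[of _ 0]) simp
  qed
qed simp

lemma mat_mult_index:
  assumes "A \<in> carrier_mat n n" "B \<in> carrier_mat n n" "i < n" "j < n"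
  shows "(A * B) $$ (i, j) = (\<Sum>b<n. A $$ (i, b) * B $$ (b, j))"
  using assms by (auto simp: scalar_prod_def lessThan_atLeast0)

text \<open>By the Jordan normal form it suffices to look at a Jordan block. The eigenvalue \<open>0\<close> is
  excluded because a nilpotent block contributes sequences with finite support, which are not
  exponential polynomials.\<close>
lemma half_value_matrix_power:
  assumes h: "h \<in> carrier_mat n n" and ev: "\<not> eigenvalue h 0" and E: "E = Collect (eigenvalue h)"
  shows "finite E" and "card E \<le> n"
    and "\<exists>c. \<forall>i<n. \<forall>j<n. half_value E \<mu> 1 (\<lambda>k. (h ^\<^sub>m k) $$ (i, j)) (c i j)"
proof -
  have cp0: "char_poly h \<noteq> 0" using degree_monic_char_poly[OF h] by auto
  have E': "E = {\<alpha>. poly (char_poly h) \<alpha> = 0}"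
    unfolding E using eigenvalue_root_char_poly[OF h] by blast
  show fin: "finite E" unfolding E' by (rule poly_roots_finite[OF cp0])
  show "card E \<le> n"
    unfolding E' using card_poly_roots_bound[OF cp0] degree_monic_char_poly[OF h] by simp
  obtain as where "char_poly h = (\<Prod>a\<leftarrow>as. [:- a, 1:])" using char_poly_factorized[OF h] by blast
  from jordan_nf_exists[OF h this] obtain n_as where jnf: "jordan_nf h n_as" by blast
  from jordan_nf_powE[OF h jnf] obtain P Q where PQ: "P \<in> carrier_mat n n" "Q \<in> carrier_mat n n"
    and cp: "char_poly h = (\<Prod>(na, a)\<leftarrow>n_as. [:- a, 1:] ^ na)"
    and pow: "\<And>k. h ^\<^sub>m k = P * jordan_matrix n_as ^\<^sub>m k * Q" by blast
  have J: "jordan_matrix n_as \<in> carrier_mat n n"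
    using jnf h unfolding jordan_nf_def similar_mat_def similar_mat_wit_def Let_def by auto
  then have N: "sum_list (map fst n_as) = n" using jordan_matrix_dim(1)[of n_as] by auto
  have roots: "snd ` set n_as \<subseteq> E"
  proof
    fix a assume "a \<in> snd ` set n_as"
    then obtain na where na: "(na, a) \<in> set n_as" by auto
    then have "na \<noteq> 0" using jnf unfolding jordan_nf_def by force
    then have "poly (\<Prod>(na, a)\<leftarrow>n_as. [:- a, 1:] ^ na) a = 0"
      using na by (auto simp: poly_prod_list prod_list_zero_iff o_def intro!: rev_image_eqI)
    then show "a \<in> E" unfolding E' cp by simp
  qed
  have E0: "0 \<notin> E" unfolding E using ev by simp
  have "\<exists>c. half_value E \<mu> 1 (\<lambda>k. (h ^\<^sub>m k) $$ (i, j)) c" if ij: "i < n" "j < n" for i j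
  proof -
    define c where "c a b = (SOME c. half_value E \<mu> 1 (\<lambda>k. (jordan_matrix n_as ^\<^sub>m k) $$ (a, b)) c)" for a b
    have c: "half_value E \<mu> 1 (\<lambda>k. (jordan_matrix n_as ^\<^sub>m k) $$ (a, b)) (c a b)"
      if "a < n" "b < n" for a b
      unfolding c_def
      by (rule someI_ex) (use half_value_jordan_matrix[OF fin E0 roots, unfolded N] that in blast)
    have "half_value E \<mu> 1 (\<lambda>k. \<Sum>b<n. (\<Sum>a<n. P $$ (i, a) * (jordan_matrix n_as ^\<^sub>m k) $$ (a, b)) * Q $$ (b, j))
        (\<Sum>b<n. (\<Sum>a<n. P $$ (i, a) * c a b) * Q $$ (b, j))"
    proof (intro half_value_sum)
      fix b assume b: "b \<in> {..<n}"
      have "half_value E \<mu> 1 (\<lambda>k. \<Sum>a<n. P $$ (i, a) * (jordan_matrix n_as ^\<^sub>m k) $$ (a, b))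
        (\<Sum>a<n. P $$ (i, a) * c a b)"
      proof (intro half_value_sum)
        fix a assume a: "a \<in> {..<n}"
        show "half_value E \<mu> 1 (\<lambda>k. P $$ (i, a) * (jordan_matrix n_as ^\<^sub>m k) $$ (a, b)) (P $$ (i, a) * c a b)"
          using half_value_mult[OF half_value_const[of E \<mu> 0 "P $$ (i, a)"] c[of a b]] a b
          by (simp only: lessThan_iff add_0)
      qed simp
      from half_value_mult[OF this half_value_const[of E \<mu> 0 "Q $$ (b, j)"], unfolded add_0_right]
      show "half_value E \<mu> 1
          (\<lambda>k. (\<Sum>a<n. P $$ (i, a) * (jordan_matrix n_as ^\<^sub>m k) $$ (a, b)) * Q $$ (b, j))
          ((\<Sum>a<n. P $$ (i, a) * c a b) * Q $$ (b, j))" .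
    qed simp
    moreover have "(h ^\<^sub>m k) $$ (i, j) =
      (\<Sum>b<n. (\<Sum>a<n. P $$ (i, a) * (jordan_matrix n_as ^\<^sub>m k) $$ (a, b)) * Q $$ (b, j))" for k
    proof -
      have "jordan_matrix n_as ^\<^sub>m k \<in> carrier_mat n n" using J by simp
      note JC = this
      show ?thesis
        unfolding pow mat_mult_index[OF mult_carrier_mat[OF PQ(1) JC] PQ(2) ij]
        by (rule sum.cong) (simp_all add: mat_mult_index[OF PQ(1) JC ij(1)])
    qed
    ultimately show ?thesis by auto
  qed
  then show "\<exists>c. \<forall>i<n. \<forall>j<n. half_value E \<mu> 1 (\<lambda>k. (h ^\<^sub>m k) $$ (i, j)) (c i j)"
    by (intro exI[of _ "\<lambda>i j. SOME c. half_value E \<mu> 1 (\<lambda>k. (h ^\<^sub>m k) $$ (i, j)) c"])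
      (blast intro: someI_ex)
qed

section \<open>Symmetric closed sets of matrices\<close>

definition matrix_coordinates :: "nat \<Rightarrow> (complex mat \<Rightarrow> complex) set" where
  "matrix_coordinates n = (\<lambda>(i, j). \<lambda>x\<in>carrier_mat n n. x $$ (i, j)) ` ({..<n} \<times> {..<n})"

text \<open>Substituting \<open>1/2\<close> entrywise commutes with the function \<open>p\<close> at the cost of monomials with
  exponents up to \<open>d\<close>. The point is that \<open>d\<close> is the same for all sequences \<open>Y\<close> of matrices,
  all \<open>E\<close> and all \<open>\<mu>\<close>.\<close>
definition half_value_degree :: "nat \<Rightarrow> (complex mat \<Rightarrow> complex) \<Rightarrow> nat \<Rightarrow> bool" where
  "half_value_degree n p d \<longleftrightarrow> (\<forall>E \<mu> Y y. (\<forall>k. Y k \<in> carrier_mat n n) \<longrightarrow> y \<in> carrier_mat n n \<longrightarrow>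
    (\<forall>i<n. \<forall>j<n. half_value E \<mu> 1 (\<lambda>k. Y k $$ (i, j)) (y $$ (i, j))) \<longrightarrow>
    half_value E \<mu> d (\<lambda>k. p (Y k)) (p y))"

lemma half_value_degreeI:
  assumes "\<And>E \<mu> Y y. (\<And>k. Y k \<in> carrier_mat n n) \<Longrightarrow> y \<in> carrier_mat n n \<Longrightarrow>
    (\<And>i j. i < n \<Longrightarrow> j < n \<Longrightarrow> half_value E \<mu> 1 (\<lambda>k. Y k $$ (i, j)) (y $$ (i, j))) \<Longrightarrow>
    half_value E \<mu> d (\<lambda>k. p (Y k)) (p y)"
  shows "half_value_degree n p d"
  using assms unfolding half_value_degree_def by simp

lemma half_value_degreeD:
  assumes "half_value_degree n p d" "\<And>k. Y k \<in> carrier_mat n n" "y \<in> carrier_mat n n"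
    "\<And>i j. i < n \<Longrightarrow> j < n \<Longrightarrow> half_value E \<mu> 1 (\<lambda>k. Y k $$ (i, j)) (y $$ (i, j))"
  shows "half_value E \<mu> d (\<lambda>k. p (Y k)) (p y)"
  using assms unfolding half_value_degree_def by simp

lemma half_value_degree_mono:
  assumes "half_value_degree n p d" "d \<le> d'"
  shows "half_value_degree n p d'"
  by (rule half_value_degreeI) (rule half_value_mono[OF half_value_degreeD[OF assms(1)] assms(2)])

lemma polynomial_half_value_degree:
  assumes "p \<in> generated_algebra (carrier_mat n n) (matrix_coordinates n)"
  shows "\<exists>d. half_value_degree n p d"
  using assms
proof induction
  case (const c)
  show ?case by (intro exI[of _ 0] half_value_degreeI) (simp add: half_value_const)
next
  case (gen f)
  then obtain i j where "i < n" "j < n" "f = (\<lambda>x\<in>carrier_mat n n. x $$ (i, j))"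
    unfolding matrix_coordinates_def by auto
  then show ?case by (intro exI[of _ 1] half_value_degreeI) simp
next
  case (add f g)
  then obtain d d' where "half_value_degree n f d" "half_value_degree n g d'" by blast
  then have fg: "half_value_degree n f (max d d')" "half_value_degree n g (max d d')"
    by (auto elim: half_value_degree_mono)
  show ?case
    by (intro exI[of _ "max d d'"] half_value_degreeI)
      (simp add: half_value.add half_value_degreeD[OF fg(1)] half_value_degreeD[OF fg(2)])
next
  case (mult f g)
  then obtain d d' where fg: "half_value_degree n f d" "half_value_degree n g d'" by blast
  show ?case
    by (intro exI[of _ "d + d'"] half_value_degreeI)
      (simp add: half_value_mult half_value_degreeD[OF fg(1)] half_value_degreeD[OF fg(2)])
qed

lemma pow_mat_add:
  assumes A: "(A :: complex mat) \<in> carrier_mat n n"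
  shows "A ^\<^sub>m (a + b) = A ^\<^sub>m a * A ^\<^sub>m b"
proof (induction b)
  case 0
  show ?case using A by simp
next
  case (Suc b)
  have "A ^\<^sub>m a \<in> carrier_mat n n" "A ^\<^sub>m b \<in> carrier_mat n n" using A by simp_all
  from assoc_mult_mat[OF this A] show ?case using Suc by simp
qed

text \<open>Moving negative exponents to the other side turns a relation with value \<open>-1\<close> into two words
  \<open>l\<close>, \<open>l'\<close> in the eigenvalues with \<open>prod_list l = - prod_list l'\<close>, whose lengths are at most
  \<open>n * N\<close>.\<close>
lemma no_relation_minus_one:
  assumes h: "h \<in> carrier_mat n n" and E: "finite E" "E = Collect (eigenvalue h)" "0 \<notin> E" "card E \<le> n"
    and det: "\<And>a b. a \<le> n * N \<Longrightarrow> b \<le> n * N \<Longrightarrow> det (kron_sum n h a b) \<noteq> 0"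
    and m: "\<And>\<alpha>. \<alpha> \<in> E \<Longrightarrow> \<bar>m \<alpha>\<bar> \<le> int N"
  shows "(\<Prod>\<alpha>\<in>E. \<alpha> powi m \<alpha>) \<noteq> -1"
proof
  assume rel: "(\<Prod>\<alpha>\<in>E. \<alpha> powi m \<alpha>) = -1"
  obtain es where es: "set es = E" "distinct es" using E(1) finite_distinct_list by blast
  define word where "word f = concat (map (\<lambda>\<alpha>. replicate (f \<alpha>) \<alpha>) es)" for f :: "complex \<Rightarrow> nat"
  have prod_word: "prod_list (word f) = (\<Prod>\<alpha>\<in>E. \<alpha> ^ f \<alpha>)" for f
  proof -
    have "prod_list (concat (map (\<lambda>\<alpha>. replicate (f \<alpha>) \<alpha>) xs)) = prod_list (map (\<lambda>\<alpha>. \<alpha> ^ f \<alpha>) xs)" for xs :: "complex list"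
      by (induction xs) simp_all
    then show ?thesis unfolding word_def es(1)[symmetric] by (simp add: prod.distinct_set_conv_list[OF es(2)])
  qed
  have set_word: "set (word f) \<subseteq> E" for f unfolding word_def es(1)[symmetric] by auto
  have length_word: "length (word f) \<le> n * N" if "\<And>\<alpha>. \<alpha> \<in> E \<Longrightarrow> f \<alpha> \<le> N" for f
  proof -
    have "length (word f) = (\<Sum>\<alpha>\<in>E. f \<alpha>)"
      unfolding word_def es(1)[symmetric]
      by (simp add: length_concat o_def sum.distinct_set_conv_list[OF es(2)])
    also have "\<dots> \<le> card E * N" using sum_bounded_above[of E f N] that by simp
    also have "\<dots> \<le> n * N" using E(4) by simp
    finally show ?thesis .
  qed
  define l where "l = word (\<lambda>\<alpha>. nat (m \<alpha>))"
  define l' where "l' = word (\<lambda>\<alpha>. nat (- m \<alpha>))"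
  have powi: "\<alpha> ^ nat (m \<alpha>) = (\<alpha> powi m \<alpha>) * \<alpha> ^ nat (- m \<alpha>)" if "\<alpha> \<in> E" for \<alpha>
  proof -
    have "\<alpha> \<noteq> 0" using that E(3) by auto
    then show ?thesis by (cases "m \<alpha> \<ge> 0") (auto simp: power_int_def field_simps)
  qed
  have "prod_list l = (\<Prod>\<alpha>\<in>E. (\<alpha> powi m \<alpha>) * \<alpha> ^ nat (- m \<alpha>))"
    unfolding l_def prod_word by (rule prod.cong) (simp_all add: powi)
  also have "\<dots> = - prod_list l'" unfolding prod.distrib rel l'_def prod_word by simp
  finally have "det (kron_sum n h (length l) (length l')) = 0"
    using set_word[of "\<lambda>\<alpha>. nat (m \<alpha>)"] set_word[of "\<lambda>\<alpha>. nat (- m \<alpha>)"] E(2)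
    by (intro det_kron_sum_eq_0[OF h]) (auto simp: l_def l'_def)
  moreover have "length l \<le> n * N" "length l' \<le> n * N"
    unfolding l_def l'_def using m by (intro length_word; fastforce)+
  ultimately show False using det by blast
qed

text \<open>For \<open>z\<close>, \<open>w\<close> in \<open>Z\<close> and \<open>h = z w\<inverse>\<close> the matrices \<open>Y k = h\<^sup>k w\<close> lie in \<open>Z\<close>. If \<open>\<Phi> z w\<close> is
  nonzero, their entries can be evaluated at \<open>k = 1/2\<close> consistently up to degree \<open>d\<close>. The
  resulting matrix \<open>y\<close> satisfies the equations of \<open>Z\<close> because all \<open>Y k\<close> do, and \<open>y w\<inverse> y = z\<close>
  because \<open>Y k w\<inverse> Y k = Y (2 k)\<close>. Hence \<open>\<Phi>\<close> is diagonal on \<open>D\<close>, and its finite rank bounds the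
  size of \<open>D\<close>.\<close>
theorem symmetric_matrix_set_finite:
  fixes n :: nat and T :: "(complex mat \<Rightarrow> complex) set"
  assumes T: "T \<subseteq> generated_algebra (carrier_mat n n) (matrix_coordinates n)"
    and Z: "Z = {x \<in> carrier_mat n n. \<forall>f\<in>T. f x = 0}"
    and inv: "\<And>x. x \<in> Z \<Longrightarrow> \<iota> x \<in> carrier_mat n n \<and> x * \<iota> x = 1\<^sub>m n \<and> \<iota> x * x = 1\<^sub>m n"
    and sym: "\<And>x y. x \<in> Z \<Longrightarrow> y \<in> Z \<Longrightarrow> x * \<iota> y * x \<in> Z"
    and D: "D \<subseteq> Z" "\<And>z w y. z \<in> D \<Longrightarrow> w \<in> D \<Longrightarrow> z \<noteq> w \<Longrightarrow> y \<in> Z \<Longrightarrow> y * \<iota> w * y \<noteq> z"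
  shows "finite D"
proof -
  have ZC: "x \<in> carrier_mat n n" if "x \<in> Z" for x using that Z by blast
  have fin: "finite (matrix_coordinates n)" unfolding matrix_coordinates_def by simp
  obtain T0 where T0: "finite T0" "T0 \<subseteq> T"
    "\<And>x. x \<in> carrier_mat n n \<Longrightarrow> (\<forall>f\<in>T0. f x = 0) \<Longrightarrow> (\<forall>f\<in>T. f x = 0)"
    using finitely_many_equations[OF fin T] by blast
  have "\<exists>d. \<forall>p\<in>T0. half_value_degree n p d"
    using T0(1,2)
  proof (induction T0 rule: finite_induct)
    case (insert p T0)
    then obtain d where d: "\<forall>p\<in>T0. half_value_degree n p d" by blast
    have "p \<in> generated_algebra (carrier_mat n n) (matrix_coordinates n)" using insert.prems T by blast
    from polynomial_half_value_degree[OF this] obtain d' where d': "half_value_degree n p d'" ..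
    have "half_value_degree n q (max d d')" if "q \<in> insert p T0" for q
      using that d d' half_value_degree_mono[of n q d "max d d'"] half_value_degree_mono[of n q d' "max d d'"]
      by auto
    then show ?case by blast
  qed simp
  then obtain d0 where d0: "\<forall>p\<in>T0. half_value_degree n p d0" ..
  \<comment> \<open>degree 2 is needed for the identity \<open>y w\<inverse> y = z\<close>, degree \<open>d0\<close> for the equations of \<open>Z\<close>\<close>
  define d where "d = max 2 d0"
  define N where "N = d * (2 * d + 1) ^ n"
  define \<Phi> where "\<Phi> z w = (\<Prod>a\<le>n * N. \<Prod>b\<le>n * N. det (kron_sum n (z * \<iota> w) a b))" for z w
  have key: "\<exists>y\<in>Z. y * \<iota> w * y = z" if zw: "z \<in> Z" "w \<in> Z" and nz: "\<Phi> z w \<noteq> 0" for z w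
  proof -
    define h where "h = z * \<iota> w"
    have zC: "z \<in> carrier_mat n n" and wC: "w \<in> carrier_mat n n" using ZC zw by auto
    have iC: "\<iota> w \<in> carrier_mat n n" and wi: "w * \<iota> w = 1\<^sub>m n" and iw: "\<iota> w * w = 1\<^sub>m n"
      using inv[OF zw(2)] by auto
    have hC: "h \<in> carrier_mat n n" unfolding h_def using zC iC by simp
    have pC: "h ^\<^sub>m k \<in> carrier_mat n n" for k using hC by simp
    have det: "det (kron_sum n h a b) \<noteq> 0" if "a \<le> n * N" "b \<le> n * N" for a b
      using nz that unfolding \<Phi>_def h_def by (auto simp: prod_zero_iff)
    define E where "E = Collect (eigenvalue h)"
    have ev0: "\<not> eigenvalue h 0"
    proof
      assume "eigenvalue h 0"
      then obtain v where v: "v \<in> carrier_vec n" "v \<noteq> 0\<^sub>v n" "h *\<^sub>v v = 0 \<cdot>\<^sub>v v"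
        using hC unfolding eigenvalue_def eigenvector_def by auto
      have izC: "\<iota> z \<in> carrier_mat n n" and iz: "\<iota> z * z = 1\<^sub>m n" using inv[OF zw(1)] by auto
      have "w * (\<iota> z * h) = 1\<^sub>m n"
      proof -
        have "\<iota> z * h = (\<iota> z * z) * \<iota> w" unfolding h_def using assoc_mult_mat[OF izC zC iC] by simp
        then show ?thesis using iz iC wi by simp
      qed
      then have "v = w * (\<iota> z * h) *\<^sub>v v" using v(1) by simp
      also have "\<dots> = w * \<iota> z *\<^sub>v (h *\<^sub>v v)"
        using wC izC hC v(1) assoc_mult_mat[OF wC izC hC]
        by (metis assoc_mult_mat_vec mult_carrier_mat)
      also have "\<dots> = 0\<^sub>v n" unfolding v(3) using v(1) wC izC by (intro eq_vecI) (auto simp: scalar_prod_def)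
      finally show False using v(2) by simp
    qed
    note E = half_value_matrix_power[OF hC ev0 E_def]
    have E0: "0 \<notin> E" using ev0 by (simp add: E_def)
    have N: "d * (2 * d + 1) ^ card E \<le> N"
      unfolding N_def using E(2) by (intro mult_left_mono power_increasing) auto
    have no: "(\<Prod>\<alpha>\<in>E. \<alpha> powi m \<alpha>) \<noteq> -1" if "\<And>\<alpha>. \<alpha> \<in> E \<Longrightarrow> \<bar>m \<alpha>\<bar> \<le> int N" for m
      by (rule no_relation_minus_one[OF hC E(1) E_def E0 E(2), where N = N]) (use det that in blast)+
    obtain \<mu> where \<mu>: "\<And>\<alpha>. \<alpha> \<in> E \<Longrightarrow> \<mu> \<alpha> ^ 2 = \<alpha>"
      "\<And>m. (\<And>\<alpha>. \<alpha> \<in> E \<Longrightarrow> \<bar>m \<alpha>\<bar> \<le> int d) \<Longrightarrow> (\<Prod>\<alpha>\<in>E. \<alpha> powi m \<alpha>) = 1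
        \<Longrightarrow> (\<Prod>\<alpha>\<in>E. \<mu> \<alpha> powi m \<alpha>) = 1"
      using multiplicative_square_roots[OF E(1) E0 N no] by blast
    have \<mu>0: "\<mu> \<alpha> \<noteq> 0" if "\<alpha> \<in> E" for \<alpha> using \<mu>(1)[OF that] E0 that by auto
    have unique: "x = x'" if "half_value E \<mu> e a x" "half_value E \<mu> e a x'" "e \<le> d" for a x x' e
      using half_value_unique[OF E(1) E0 \<mu>(2) \<mu>0] half_value_mono[OF that(1,3)] half_value_mono[OF that(2,3)]
      by blast
    obtain c where c: "\<And>i j. i < n \<Longrightarrow> j < n \<Longrightarrow> half_value E \<mu> 1 (\<lambda>k. (h ^\<^sub>m k) $$ (i, j)) (c i j)"
      using E(3) by blast
    define Y where "Y k = h ^\<^sub>m k * w" for k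
    \<comment> \<open>the value of \<open>Y\<close> at \<open>k = 1/2\<close>\<close>
    define y where "y = mat n n (\<lambda>(i, j). \<Sum>l<n. c i l * w $$ (l, j))"
    have YC: "Y k \<in> carrier_mat n n" for k unfolding Y_def by (rule mult_carrier_mat[OF pC wC])
    have yC: "y \<in> carrier_mat n n" unfolding y_def by simp
    have Yy: "half_value E \<mu> 1 (\<lambda>k. Y k $$ (i, j)) (y $$ (i, j))" if ij: "i < n" "j < n" for i j
    proof -
      have "half_value E \<mu> (1 + 0) (\<lambda>k. \<Sum>l<n. (h ^\<^sub>m k) $$ (i, l) * w $$ (l, j)) (\<Sum>l<n. c i l * w $$ (l, j))"
        using ij by (intro half_value_sum half_value_mult c half_value_const) auto
      then show ?thesis
        unfolding Y_def mat_mult_index[OF pC wC ij] using ij by (simp add: y_def)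
    qed
    have YS: "Y (Suc k) = h * Y k" for k
    proof -
      have "h ^\<^sub>m Suc k = h * h ^\<^sub>m k" using pow_mat_add[OF hC, of 1 k] hC by simp
      then show ?thesis unfolding Y_def using assoc_mult_mat[OF hC pC wC] by simp
    qed
    have Y0: "Y 0 = w" unfolding Y_def using wC hC by simp
    have Y1: "Y 1 = z"
    proof -
      have "Y 1 = z * (\<iota> w * w)" using YS[of 0] assoc_mult_mat[OF zC iC wC] by (simp add: Y0 h_def)
      then show ?thesis using iw zC by simp
    qed
    \<comment> \<open>by symmetry, as \<open>Y (k + 2) = Y (k + 1) (Y k)\<inverse> Y (k + 1)\<close>\<close>
    have YZ: "Y k \<in> Z \<and> Y (Suc k) \<in> Z" for k
    proof (induction k)
      case 0
      show ?case using Y0 Y1 zw by simp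
    next
      case (Suc k)
      have i: "\<iota> (Y k) \<in> carrier_mat n n" "Y k * \<iota> (Y k) = 1\<^sub>m n" using inv Suc by blast+
      have "Y (Suc k) * \<iota> (Y k) = h"
        unfolding YS using assoc_mult_mat[OF hC YC i(1)] i(2) hC by simp
      then have "Y (Suc k) * \<iota> (Y k) * Y (Suc k) = Y (Suc (Suc k))" using YS[of "Suc k"] by simp
      then show ?case using sym[of "Y (Suc k)" "Y k"] Suc by simp
    qed
    have "p y = 0" if "p \<in> T0" for p
    proof (rule unique)
      show "half_value E \<mu> d0 (\<lambda>k. 0) (p y)"
      proof -
        have "half_value E \<mu> d0 (\<lambda>k. p (Y k)) (p y)"
          by (rule half_value_degreeD[OF _ YC yC Yy]) (use d0 that in blast)+
        moreover have "p (Y k) = 0" for k using YZ[of k] that T0(2) Z by blast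
        ultimately show ?thesis by simp
      qed
      show "half_value E \<mu> d0 (\<lambda>k. 0) 0" by (rule half_value_const)
      show "d0 \<le> d" by (simp add: d_def)
    qed
    then have yZ: "y \<in> Z" unfolding Z using T0(3)[OF yC] yC by blast
    have "y * \<iota> w * y = z"
    proof (rule eq_matI)
      fix i j assume "i < dim_row z" "j < dim_col z"
      then have ij: "i < n" "j < n" using zC by auto
      have index: "(A * \<iota> w * A) $$ (i, j) = (\<Sum>b<n. (\<Sum>a<n. A $$ (i, a) * \<iota> w $$ (a, b)) * A $$ (b, j))"
        if A: "A \<in> carrier_mat n n" for A
        unfolding mat_mult_index[OF mult_carrier_mat[OF A iC] A ij]
        by (rule sum.cong) (simp_all add: mat_mult_index[OF A iC ij(1)])
      have "half_value E \<mu> (1 + 0 + 1) (\<lambda>k. (Y k * \<iota> w * Y k) $$ (i, j)) ((y * \<iota> w * y) $$ (i, j))"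
        unfolding index[OF YC] index[OF yC]
        using ij by (intro half_value_sum half_value_mult Yy half_value_const) auto
      moreover have "Y k * \<iota> w * Y k = Y (2 * k)" for k
      proof -
        have "Y k * \<iota> w = h ^\<^sub>m k"
          unfolding Y_def using assoc_mult_mat[OF pC wC iC, of k] wi right_mult_one_mat[OF pC, of k] by simp
        then have "Y k * \<iota> w * Y k = h ^\<^sub>m k * h ^\<^sub>m k * w"
          unfolding Y_def using assoc_mult_mat[OF pC pC wC] by simp
        also have "h ^\<^sub>m k * h ^\<^sub>m k = h ^\<^sub>m (2 * k)"
          using pow_mat_add[OF hC, of k k] by (simp add: mult_2)
        finally show ?thesis unfolding Y_def .
      qed
      ultimately have 1: "half_value E \<mu> 2 (\<lambda>k. Y (2 * k) $$ (i, j)) ((y * \<iota> w * y) $$ (i, j))"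
        by (simp add: numeral_2_eq_2)
      have 2: "half_value E \<mu> 2 (\<lambda>k. Y (2 * k) $$ (i, j)) (z $$ (i, j))"
        using half_value_double[OF Yy[OF ij] \<mu>(1)] Y1 by simp
      show "(y * \<iota> w * y) $$ (i, j) = z $$ (i, j)"
        by (rule unique[OF 1 2]) (simp add: d_def)
    qed (use yC iC zC in auto)
    with yZ show ?thesis by blast
  qed
  have diag: "\<Phi> z z \<noteq> 0" if "z \<in> Z" for z
    unfolding \<Phi>_def using inv[OF that] det_kron_sum_one by (simp add: prod_zero_iff)
  have sep: "separable Z UNIV \<Phi>"
    unfolding \<Phi>_def
  proof (intro separable_prod separable_det_kron_sum)
    show "x * \<iota> y \<in> carrier_mat n n" if "x \<in> Z" "y \<in> Z" for x y
      using ZC[OF that(1)] inv[OF that(2)] by simp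
    fix i j assume ij: "i < n" "j < n"
    have "separable Z UNIV (\<lambda>x y. \<Sum>b<n. x $$ (i, b) * \<iota> y $$ (b, j))"
      by (intro separable_sum separable_single[of "\<lambda>x. x $$ (i, _)" _ "\<lambda>y. \<iota> y $$ (_, j)"]) auto
    moreover have "(x * \<iota> y) $$ (i, j) = (\<Sum>b<n. x $$ (i, b) * \<iota> y $$ (b, j))" if "x \<in> Z" "y \<in> Z" for x y
      using ZC[OF that(1)] inv[OF that(2)] ij by (intro mat_mult_index) auto
    ultimately show "separable Z UNIV (\<lambda>x y. (x * \<iota> y) $$ (i, j))"
      unfolding separable_def by auto
  qed simp_all
  then obtain L where L: "\<And>x y. x \<in> Z \<Longrightarrow> y \<in> Z \<Longrightarrow> \<Phi> x y = (\<Sum>(f, g)\<leftarrow>L. f x * g y)"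
    unfolding separable_def by blast
  have "finite D \<and> card D \<le> length L"
  proof (rule card_diagonal_le_rank)
    show "\<Phi> z w = (\<Sum>(f, g)\<leftarrow>L. f z * g w)" if "z \<in> D" "w \<in> D" for z w
      using L that D(1) by blast
    show "\<Phi> z z \<noteq> 0" if "z \<in> D" for z using diag that D(1) by blast
    show "\<Phi> z w = 0" if "z \<in> D" "w \<in> D" "z \<noteq> w" for z w
      using key[of z w] D that by blast
  qed
  then show ?thesis ..
qed

section \<open>Linear representations of affine algebraic groups\<close>

text \<open>This reformulates that multiplication is a regular map: the product ring is the image of
  \<open>A \<otimes> A\<close>.\<close>
lemma separable_comultiplication:
  assumes G: "affine_algebraic_group G A" and f: "f \<in> A"
  shows "separable (carrier G) A (\<lambda>x y. f (x \<otimes>\<^bsub>G\<^esub> y))"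
proof -
  obtain S where A: "A = generated_algebra (carrier G) S"
    using G unfolding affine_algebraic_group_def affine_variety_def by blast
  let ?X = "carrier G"
  have sep: "separable ?X A (\<lambda>x y. p (x, y))" if "p \<in> product_ring ?X A ?X A" for p
    using that unfolding product_ring_def
  proof induction
    case (const c)
    show ?case
      by (rule separable_single[of "\<lambda>x\<in>?X. c" _ "\<lambda>x\<in>?X. 1"]) (auto simp: A intro: generated_algebra.const)
  next
    case (gen p)
    then consider g where "g \<in> A" "p = (\<lambda>p\<in>?X \<times> ?X. g (fst p))" | g where "g \<in> A" "p = (\<lambda>p\<in>?X \<times> ?X. g (snd p))"
      by blast
    then show ?case
    proof cases
      case (1 g)
      then show ?thesis
        by (intro separable_single[of g _ "\<lambda>x\<in>?X. 1"]) (auto simp: A intro: generated_algebra.const)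
    next
      case (2 g)
      then show ?thesis
        by (intro separable_single[of "\<lambda>x\<in>?X. 1" _ g]) (auto simp: A intro: generated_algebra.const)
    qed
  next
    case (add p q)
    from add.IH show ?case by (rule separable_add) simp
  next
    case (mult p q)
    have "\<exists>h\<in>A. \<forall>x\<in>?X. h x = f x * g x" if "f \<in> A" "g \<in> A" for f g
      using that unfolding A by (intro bexI[of _ "\<lambda>x\<in>?X. f x * g x"] generated_algebra.mult) auto
    then show ?case using mult.IH by (rule separable_mult) simp_all
  qed
  have "(\<lambda>p\<in>?X \<times> ?X. f ((\<lambda>(x, y). x \<otimes>\<^bsub>G\<^esub> y) p)) \<in> product_ring ?X A ?X A"
    using G f unfolding affine_algebraic_group_def regular_map_def by blast
  from sep[OF this] show ?thesis unfolding separable_def by auto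
qed

lemma translate_in_coordinate_ring:
  assumes G: "affine_algebraic_group G A" and f: "f \<in> A" and a: "a \<in> carrier G"
  shows "(\<lambda>x\<in>carrier G. f (a \<otimes>\<^bsub>G\<^esub> x)) \<in> A" and "(\<lambda>x\<in>carrier G. f (x \<otimes>\<^bsub>G\<^esub> a)) \<in> A"
proof -
  obtain S where A: "A = generated_algebra (carrier G) S"
    using G unfolding affine_algebraic_group_def affine_variety_def by blast
  obtain L where L: "set L \<subseteq> A \<times> A"
    "\<forall>x\<in>carrier G. \<forall>y\<in>carrier G. f (x \<otimes>\<^bsub>G\<^esub> y) = (\<Sum>(f, g)\<leftarrow>L. f x * g y)"
    using separable_comultiplication[OF G f] unfolding separable_def by blast
  have comb: "(\<lambda>x\<in>carrier G. \<Sum>(c, g)\<leftarrow>M. c * g x) \<in> A" if "snd ` set M \<subseteq> A" for M :: "(complex \<times> ('a \<Rightarrow> complex)) list"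
    using that
  proof (induction M)
    case Nil
    show ?case unfolding A list.map sum_list.Nil by (rule generated_algebra.const)
  next
    case (Cons e M)
    obtain c g where e: "e = (c, g)" "g \<in> A" using Cons.prems by (cases e) auto
    have "(\<lambda>x\<in>carrier G. c * g x) \<in> A"
      using generated_algebra_mult'[OF generated_algebra.const generated_algebra_restrict] e(2) unfolding A by blast
    then show ?case
      using generated_algebra_add'[of "\<lambda>x. c * g x" "carrier G" S "\<lambda>x. \<Sum>(c, g)\<leftarrow>M. c * g x"] Cons
      unfolding A e(1) by (simp del: restrict_apply)
  qed
  have "(\<lambda>x\<in>carrier G. f (a \<otimes>\<^bsub>G\<^esub> x)) = (\<lambda>x\<in>carrier G. \<Sum>(c, g)\<leftarrow>map (\<lambda>(f, g). (f a, g)) L. c * g x)"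
    using L(2) a by (intro restrict_ext) (simp add: o_def case_prod_unfold)
  also have "\<dots> \<in> A" using L(1) by (intro comb) auto
  finally show "(\<lambda>x\<in>carrier G. f (a \<otimes>\<^bsub>G\<^esub> x)) \<in> A" .
  have "(\<lambda>x\<in>carrier G. f (x \<otimes>\<^bsub>G\<^esub> a)) = (\<lambda>x\<in>carrier G. \<Sum>(c, g)\<leftarrow>map (\<lambda>(f, g). (g a, f)) L. c * g x)"
    using L(2) a by (intro restrict_ext) (simp add: o_def case_prod_unfold mult.commute)
  also have "\<dots> \<in> A" using L(1) by (intro comb) auto
  finally show "(\<lambda>x\<in>carrier G. f (x \<otimes>\<^bsub>G\<^esub> a)) \<in> A" .
qed

text \<open>Take a maximal family of points of \<open>X\<close> that has a dual family in \<open>V\<close>; its size is bounded by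
  the number of spanning functions, by \<open>card_diagonal_le_rank\<close>. If the expansion of some \<open>f\<close>
  failed at a point \<open>y\<close>, then \<open>y\<close> could be added to the family.\<close>
lemma dual_points:
  fixes V :: "('a \<Rightarrow> complex) set"
  assumes lin: "\<And>f g c d. f \<in> V \<Longrightarrow> g \<in> V \<Longrightarrow> (\<lambda>x. c * f x + d * g x) \<in> V"
    and span: "\<And>f. f \<in> V \<Longrightarrow> \<exists>c. \<forall>x\<in>X. f x = (\<Sum>t<length us. c t * (us ! t) x)"
  obtains n :: nat and x v where "\<And>i. i < n \<Longrightarrow> x i \<in> X" "\<And>i. i < n \<Longrightarrow> v i \<in> V"
    "\<And>i j. i < n \<Longrightarrow> j < n \<Longrightarrow> v i (x j) = (if i = j then 1 else 0)"
    "\<And>f y. f \<in> V \<Longrightarrow> y \<in> X \<Longrightarrow> f y = (\<Sum>i<n. f (x i) * v i y)"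
proof -
  define dual where "dual n x v \<longleftrightarrow> (\<forall>i<n. x i \<in> X) \<and> (\<forall>i<n. v i \<in> V) \<and>
    (\<forall>i<n. \<forall>j<n. v i (x j) = (if i = j then 1 else 0))" for n :: nat and x :: "nat \<Rightarrow> 'a" and v
  have bound: "n \<le> length us" if d: "dual n x v" for n x v
  proof -
    define c where "c i = (SOME c. \<forall>x\<in>X. v i x = (\<Sum>t<length us. c t * (us ! t) x))" for i
    have c: "\<forall>x\<in>X. v i x = (\<Sum>t<length us. c i t * (us ! t) x)" if "i < n" for i
    proof -
      have "v i \<in> V" using d that by (simp add: dual_def)
      from someI_ex[OF span[OF this]] show ?thesis unfolding c_def .
    qed
    let ?L = "map (\<lambda>t. (\<lambda>i. c i t, \<lambda>j. (us ! t) (x j))) [0..<length us]"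
    have "finite {..<n} \<and> card {..<n} \<le> length ?L"
    proof (rule card_diagonal_le_rank)
      fix i j assume "i \<in> {..<n}" "j \<in> {..<n}"
      then have "v i (x j) = (\<Sum>t<length us. c i t * (us ! t) (x j))" using c d unfolding dual_def by auto
      then show "v i (x j) = (\<Sum>(f, g)\<leftarrow>?L. f i * g j)"
        by (simp add: o_def interv_sum_list_conv_sum_set_nat lessThan_atLeast0)
    qed (use d in \<open>auto simp: dual_def\<close>)
    then show ?thesis by simp
  qed
  have "dual 0 (\<lambda>_. undefined) (\<lambda>_. undefined)" unfolding dual_def by simp
  then have ex: "\<exists>x v. dual 0 x v" by blast
  define n where "n = (GREATEST n. \<exists>x v. dual n x v)"
  have n: "\<exists>x v. dual n x v"
    unfolding n_def by (rule GreatestI_nat[where P = "\<lambda>n. \<exists>x v. dual n x v", OF ex]) (use bound in blast)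
  then obtain x v where d: "dual n x v" by blast
  have max: "\<not> dual (Suc n) x' v'" for x' v'
  proof
    assume "dual (Suc n) x' v'"
    then have "Suc n \<le> n"
      unfolding n_def by (intro Greatest_le_nat[where b = "length us"]) (use bound in blast)+
    then show False by simp
  qed
  have d': "\<And>i. i < n \<Longrightarrow> x i \<in> X" "\<And>i. i < n \<Longrightarrow> v i \<in> V"
    "\<And>i j. i < n \<Longrightarrow> j < n \<Longrightarrow> v i (x j) = (if i = j then 1 else 0)"
    using d by (simp_all only: dual_def)
  show ?thesis
  proof (rule that[OF d'])
    fix f y assume f: "f \<in> V" and y: "y \<in> X"
    have sumV: "(\<lambda>z. f z - (\<Sum>i<m. f (x i) * v i z)) \<in> V" if "m \<le> n" for m
      using that
    proof (induction m)
      case 0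
      show ?case using f by simp
    next
      case (Suc m)
      have "(\<lambda>z. 1 * (f z - (\<Sum>i<m. f (x i) * v i z)) + (- f (x m)) * v m z) \<in> V"
        using Suc d by (intro lin) (auto simp: dual_def)
      then show ?case by (simp add: algebra_simps)
    qed
    define g where "g z = f z - (\<Sum>i<n. f (x i) * v i z)" for z
    have gV: "g \<in> V" using sumV[of n] unfolding g_def by simp
    have g0: "g (x j) = 0" if "j < n" for j
    proof -
      have "(\<Sum>i<n. f (x i) * v i (x j)) = (\<Sum>i<n. if i = j then f (x j) else 0)"
        using d that by (intro sum.cong) (auto simp: dual_def)
      then show ?thesis using that by (simp add: g_def)
    qed
    show "f y = (\<Sum>i<n. f (x i) * v i y)"
    proof (rule ccontr)
      assume "\<not> ?thesis"
      then have gy: "g y \<noteq> 0" by (simp add: g_def)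
      define x' where "x' = x(n := y)"
      \<comment> \<open>normalise the new function and correct the old ones so that they vanish at \<open>y\<close>\<close>
      define v' where "v' i = (if i = n then (\<lambda>z. (1 / g y) * g z + 0 * g z)
        else (\<lambda>z. 1 * v i z + (- v i y / g y) * g z))" for i
      have "v' i \<in> V" if "i < Suc n" for i
      proof (cases "i = n")
        case True
        then show ?thesis unfolding v'_def by (simp only: if_True simp_thms) (rule lin[OF gV gV])
      next
        case False
        then have "v i \<in> V" using that d'(2) by simp
        with False show ?thesis
          unfolding v'_def by (simp only: if_False simp_thms) (rule lin[OF _ gV])
      qed
      moreover have "v' i (x' j) = (if i = j then 1 else 0)" if "i < Suc n" "j < Suc n" for i j
        using that d gy g0 by (auto simp: v'_def x'_def dual_def less_Suc_eq)
      ultimately have "dual (Suc n) x' v'"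
        using d y unfolding dual_def by (auto simp: x'_def less_Suc_eq)
      then show False using max by blast
    qed
  qed
qed

text \<open>The right translates of the generators span a finite-dimensional right-invariant space of
  functions; here it is replaced by the larger space \<open>V\<close> of all functions whose right
  translates lie in the span \<open>U\<close> of the functions occurring in the comultiplication of the
  generators. With points \<open>x i\<close> and a dual basis \<open>v i\<close> of \<open>V\<close>, the matrix of right translation
  by \<open>y\<close> has the entries \<open>v j (x i \<otimes> y)\<close>, and every \<open>f\<close> in \<open>V\<close> is recovered from them by
  expanding right translates of \<open>f\<close> at the unit.\<close>
lemma linearization:
  fixes G :: "('a, 'b) monoid_scheme" (structure)
  assumes G: "affine_algebraic_group G A"
  obtains n :: nat and M :: "'a \<Rightarrow> complex mat" where
    "\<And>x. x \<in> carrier G \<Longrightarrow> M x \<in> carrier_mat n n"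
    "\<And>x y. x \<in> carrier G \<Longrightarrow> y \<in> carrier G \<Longrightarrow> M (x \<otimes>\<^bsub>G\<^esub> y) = M x * M y"
    "M \<one>\<^bsub>G\<^esub> = 1\<^sub>m n"
    "\<And>i j. i < n \<Longrightarrow> j < n \<Longrightarrow> (\<lambda>x\<in>carrier G. M x $$ (i, j)) \<in> A"
    "\<And>f. f \<in> A \<Longrightarrow> \<exists>p\<in>generated_algebra (carrier_mat n n) (matrix_coordinates n).
       \<forall>x\<in>carrier G. f x = p (M x)"
proof -
  obtain S where S: "finite S" "S \<subseteq> extensional (carrier G)" and A: "A = generated_algebra (carrier G) S"
    using G unfolding affine_algebraic_group_def affine_variety_def by blast
  interpret group G using G unfolding affine_algebraic_group_def by blast
  let ?C = "carrier G"
  obtain ss where ss: "set ss = S" using finite_list[OF S(1)] by blast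
  have SA: "S \<subseteq> A" unfolding A by (auto intro: generated_algebra.gen)
  define Ls where "Ls s = (SOME L. set L \<subseteq> A \<times> A \<and>
    (\<forall>x\<in>?C. \<forall>y\<in>?C. s (x \<otimes> y) = (\<Sum>(f, g)\<leftarrow>L. f x * g y)))" for s
  have Ls: "set (Ls s) \<subseteq> A \<times> A \<and> (\<forall>x\<in>?C. \<forall>y\<in>?C. s (x \<otimes> y) = (\<Sum>(f, g)\<leftarrow>Ls s. f x * g y))"
    if "s \<in> S" for s
  proof -
    have "s \<in> A" using that SA by blast
    from separable_comultiplication[OF G this] show ?thesis
      unfolding Ls_def separable_def by (rule someI_ex)
  qed
  define us where "us = map fst (concat (map Ls ss))"
  have usA: "u \<in> A" if u: "u \<in> set us" for u
  proof -
    obtain s g where s: "s \<in> S" "(u, g) \<in> set (Ls s)" using u unfolding us_def ss[symmetric] by auto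
    then show ?thesis using Ls[OF s(1)] by blast
  qed
  define U where "U = {f. \<exists>c. \<forall>x\<in>?C. f x = (\<Sum>t<length us. c t * (us ! t) x)}"
  define V where "V = {f. \<forall>y\<in>?C. (\<lambda>x. f (x \<otimes> y)) \<in> U}"
  have span_lin: "(\<lambda>x. c * f x + d * g x) \<in> U" if "f \<in> U" "g \<in> U" for f g c d
  proof -
    obtain a b where "\<forall>x\<in>?C. f x = (\<Sum>t<length us. a t * (us ! t) x)"
      "\<forall>x\<in>?C. g x = (\<Sum>t<length us. b t * (us ! t) x)"
      using \<open>f \<in> U\<close> \<open>g \<in> U\<close> unfolding U_def by blast
    then show ?thesis unfolding U_def
      by (intro CollectI exI[of _ "\<lambda>t. c * a t + d * b t"])
        (simp add: sum_distrib_left sum.distrib algebra_simps)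
  qed
  have span_comb: "(\<lambda>x. \<Sum>(f, g)\<leftarrow>L. f x * g y) \<in> U" if "set (map fst L) \<subseteq> set us"
    for L :: "(('a \<Rightarrow> complex) \<times> ('a \<Rightarrow> complex)) list" and y
    using that
  proof (induction L)
    case Nil
    show ?case unfolding U_def by (intro CollectI exI[of _ "\<lambda>t. 0"]) simp
  next
    case (Cons e L)
    obtain f g where e: "e = (f, g)" "f \<in> set us" using Cons.prems by (cases e) auto
    then obtain t where t: "t < length us" "f = us ! t" by (metis in_set_conv_nth)
    have "(\<Sum>t'<length us. (if t' = t then 1 else 0) * (us ! t') x) = f x" for x
    proof -
      have "(\<Sum>t'<length us. (if t' = t then 1 else 0) * (us ! t') x) = (\<Sum>t'<length us. if t' = t then f x else 0)"
        by (rule sum.cong) (simp_all add: t(2))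
      also have "\<dots> = f x" using t(1) by simp
      finally show ?thesis .
    qed
    then have "f \<in> U" unfolding U_def
      by (intro CollectI exI[of _ "\<lambda>t'. if t' = t then 1 else 0"]) simp
    moreover have "(\<lambda>x. \<Sum>(f, g)\<leftarrow>L. f x * g y) \<in> U" using Cons by simp
    ultimately have "(\<lambda>x. g y * f x + 1 * (\<Sum>(f, g)\<leftarrow>L. f x * g y)) \<in> U" by (rule span_lin)
    then show ?case by (simp only: e(1) list.map sum_list.Cons prod.case mult_1 mult.commute[of "g y"])
  qed
  have span_cong: "g \<in> U" if "f \<in> U" "\<And>x. x \<in> ?C \<Longrightarrow> g x = f x" for f g
    using that unfolding U_def by auto
  have SV: "s \<in> V" if s: "s \<in> S" for s
    unfolding V_def
  proof (intro CollectI ballI)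
    fix y assume y: "y \<in> ?C"
    have "set (map fst (Ls s)) \<subseteq> set us" using s unfolding us_def ss[symmetric] by auto
    from span_comb[OF this, of y] show "(\<lambda>x. s (x \<otimes> y)) \<in> U"
      by (rule span_cong) (use Ls[OF s] y in blast)
  qed
  have V_span: "f \<in> U" if "f \<in> V" for f
  proof -
    have "(\<lambda>x. f (x \<otimes> \<one>)) \<in> U" using that unfolding V_def by blast
    then show ?thesis by (rule span_cong) simp
  qed
  have V_trans: "(\<lambda>x. f (x \<otimes> y)) \<in> V" if f: "f \<in> V" and y: "y \<in> ?C" for f y
    unfolding V_def
  proof (intro CollectI ballI)
    fix y' assume y': "y' \<in> ?C"
    have "(\<lambda>x. f (x \<otimes> (y' \<otimes> y))) \<in> U" using f y y' unfolding V_def by simp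
    then show "(\<lambda>x. f (x \<otimes> y' \<otimes> y)) \<in> U" by (rule span_cong) (simp add: m_assoc y y')
  qed
  have V_lin: "(\<lambda>x. c * f x + d * g x) \<in> V" if "f \<in> V" "g \<in> V" for f g c d
    using that span_lin unfolding V_def by blast
  have span_A: "(\<lambda>x\<in>?C. f x) \<in> A" if f: "f \<in> U" for f
  proof -
    obtain c where c: "\<forall>x\<in>?C. f x = (\<Sum>t<length us. c t * (us ! t) x)"
      using f unfolding U_def by blast
    then have "(\<lambda>x\<in>?C. f x) = (\<lambda>x\<in>?C. \<Sum>t<length us. c t * (us ! t) x)" by (intro restrict_ext) simp
    also have "\<dots> \<in> A" unfolding A
    proof (intro generated_algebra_sum generated_algebra_mult')
      fix t assume "t \<in> {..<length us}"
      then show "restrict ((!) us t) ?C \<in> generated_algebra ?C S"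
        using usA[of "us ! t"] generated_algebra_restrict[of "us ! t" ?C S] unfolding A by simp
    qed (auto intro: generated_algebra.const)
    finally show ?thesis .
  qed
  obtain n :: nat and x v where xC: "\<And>i. i < n \<Longrightarrow> x i \<in> ?C" and vV: "\<And>i. i < n \<Longrightarrow> v i \<in> V"
    and dual: "\<And>i j. i < n \<Longrightarrow> j < n \<Longrightarrow> v i (x j) = (if i = j then 1 else 0)"
    and basis: "\<And>f y. f \<in> V \<Longrightarrow> y \<in> ?C \<Longrightarrow> f y = (\<Sum>i<n. f (x i) * v i y)"
    using dual_points[of V ?C us] V_lin V_span unfolding U_def by blast
  define M where "M y = mat n n (\<lambda>(i, j). v j (x i \<otimes> y))" for y
  have MC: "M y \<in> carrier_mat n n" for y by (simp add: M_def)
  have Mmult: "M (y \<otimes> z) = M y * M z" if "y \<in> ?C" "z \<in> ?C" for y z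
  proof (rule eq_matI)
    fix i j assume "i < dim_row (M y * M z)" "j < dim_col (M y * M z)"
    then have ij: "i < n" "j < n" using MC[of y] MC[of z] by auto
    have "v j (x i \<otimes> (y \<otimes> z)) = v j ((x i \<otimes> y) \<otimes> z)" using ij xC that by (simp add: m_assoc)
    also have "\<dots> = (\<Sum>l<n. v j (x l \<otimes> z) * v l (x i \<otimes> y))"
      using basis[OF V_trans[OF vV[OF ij(2)] that(2)], of "x i \<otimes> y"] ij xC that by simp
    finally show "M (y \<otimes> z) $$ (i, j) = (M y * M z) $$ (i, j)"
      unfolding mat_mult_index[OF MC MC ij] using ij by (simp add: M_def mult.commute)
  qed (simp_all add: M_def)
  have M1: "M \<one> = 1\<^sub>m n"
    by (rule eq_matI) (use xC dual in \<open>auto simp: M_def\<close>)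
  have MA: "(\<lambda>y\<in>?C. M y $$ (i, j)) \<in> A" if ij: "i < n" "j < n" for i j
  proof -
    have "(\<lambda>y\<in>?C. M y $$ (i, j)) = (\<lambda>y\<in>?C. (\<lambda>y\<in>?C. v j y) (x i \<otimes> y))"
      using ij xC by (intro restrict_ext) (simp add: M_def)
    also have "\<dots> \<in> A"
      by (rule translate_in_coordinate_ring(1)[OF G span_A[OF V_span[OF vV[OF ij(2)]]] xC[OF ij(1)]])
    finally show ?thesis .
  qed
  let ?R = "generated_algebra (carrier_mat n n) (matrix_coordinates n)"
  have coord: "(\<lambda>m\<in>carrier_mat n n. m $$ (i, j)) \<in> ?R" if "i < n" "j < n" for i j
    by (rule generated_algebra.gen) (use that in \<open>auto simp: matrix_coordinates_def\<close>)
  have poly: "\<exists>p\<in>?R. \<forall>y\<in>?C. f y = p (M y)" if "f \<in> A" for f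
    using that unfolding A
  proof induction
    case (const c)
    show ?case by (rule bexI[of _ "\<lambda>m\<in>carrier_mat n n. c"]) (use MC in \<open>auto intro: generated_algebra.const\<close>)
  next
    case (gen s)
    let ?p = "\<lambda>m\<in>carrier_mat n n. \<Sum>i<n. (\<Sum>j<n. s (x j) * m $$ (i, j)) * v i \<one>"
    have "?p \<in> ?R"
      by (intro generated_algebra_sum generated_algebra_mult' generated_algebra.const coord) auto
    moreover have "s y = ?p (M y)" if y: "y \<in> ?C" for y
    proof -
      have "s (x i \<otimes> y) = (\<Sum>j<n. s (x j) * M y $$ (i, j))" if i: "i < n" for i
        using basis[OF SV[OF gen], of "x i \<otimes> y"] i y xC by (simp add: M_def)
      moreover have "s y = (\<Sum>i<n. s (x i \<otimes> y) * v i \<one>)"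
        using basis[OF V_trans[OF SV[OF gen] y], of \<one>] y by simp
      ultimately show ?thesis using MC by simp
    qed
    ultimately show ?case by blast
  next
    case (add f g)
    then obtain p q where "p \<in> ?R" "\<forall>y\<in>?C. f y = p (M y)" "q \<in> ?R" "\<forall>y\<in>?C. g y = q (M y)" by blast
    then show ?case using MC
      by (intro bexI[of _ "\<lambda>m\<in>carrier_mat n n. p m + q m"] generated_algebra.add) simp_all
  next
    case (mult f g)
    then obtain p q where "p \<in> ?R" "\<forall>y\<in>?C. f y = p (M y)" "q \<in> ?R" "\<forall>y\<in>?C. g y = q (M y)" by blast
    then show ?case using MC
      by (intro bexI[of _ "\<lambda>m\<in>carrier_mat n n. p m * q m"] generated_algebra.mult) simp_all
  qed
  show ?thesis by (rule that[OF MC Mmult M1 MA poly])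
qed

lemma regular_functions_separate_points:
  assumes "affine_variety X A" "x \<in> X" "y \<in> X" "\<And>f. f \<in> A \<Longrightarrow> f x = f y"
  shows "x = y"
proof -
  have "algebra_point X A (\<lambda>f. f x)" unfolding algebra_point_def using assms(2) by simp
  then have "\<exists>!z. z \<in> X \<and> (\<forall>f\<in>A. f x = f z)" using assms(1) unfolding affine_variety_def by blast
  then show ?thesis using assms(2-4) by blast
qed

section \<open>Symmetric closed sets in affine algebraic groups\<close>

text \<open>The Zariski closed subsets, in the form that the basis theorem uses; see
  \<open>closed_subgroup_zero_set\<close>.\<close>
definition zero_set :: "'a set \<Rightarrow> ('a \<Rightarrow> complex) set \<Rightarrow> 'a set \<Rightarrow> bool" where
  "zero_set X A Z \<longleftrightarrow> (\<exists>T\<subseteq>A. Z = {x \<in> X. \<forall>f\<in>T. f x = 0})"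

text \<open>Transport along a linearization \<open>M\<close>. The image of \<open>Z\<close> is closed in the space of all
  matrices, not only in the image of the group: a matrix at which all polynomials vanishing on
  the image of \<open>Z\<close> vanish defines a homomorphism from the coordinate ring to the complex
  numbers, hence a point of the group, and this point belongs to \<open>Z\<close>.\<close>
theorem symmetric_zero_set_finite:
  fixes G :: "('a, 'b) monoid_scheme" (structure)
  assumes G: "affine_algebraic_group G A"
    and Z: "zero_set (carrier G) A Z"
    and sym: "\<And>x y. x \<in> Z \<Longrightarrow> y \<in> Z \<Longrightarrow> x \<otimes> inv y \<otimes> x \<in> Z"
    and D: "D \<subseteq> Z" "\<And>z w y. z \<in> D \<Longrightarrow> w \<in> D \<Longrightarrow> z \<noteq> w \<Longrightarrow> y \<in> Z \<Longrightarrow> y \<otimes> inv w \<otimes> y \<noteq> z"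
  shows "finite D"
proof -
  interpret group G using G unfolding affine_algebraic_group_def by blast
  have var: "affine_variety (carrier G) A" using G unfolding affine_algebraic_group_def by blast
  let ?C = "carrier G"
  obtain T where T: "T \<subseteq> A" "Z = {x \<in> ?C. \<forall>f\<in>T. f x = 0}" using Z unfolding zero_set_def by blast
  obtain n :: nat and M where M: "\<And>x. x \<in> ?C \<Longrightarrow> M x \<in> carrier_mat n n"
    "\<And>x y. x \<in> ?C \<Longrightarrow> y \<in> ?C \<Longrightarrow> M (x \<otimes> y) = M x * M y" "M \<one> = 1\<^sub>m n"
    "\<And>i j. i < n \<Longrightarrow> j < n \<Longrightarrow> (\<lambda>x\<in>?C. M x $$ (i, j)) \<in> A"
    "\<And>f. f \<in> A \<Longrightarrow> \<exists>p\<in>generated_algebra (carrier_mat n n) (matrix_coordinates n). \<forall>x\<in>?C. f x = p (M x)"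
    by (rule linearization[OF G], rule that)
  let ?R = "generated_algebra (carrier_mat n n) (matrix_coordinates n)"
  have inj: "inj_on M ?C"
  proof (rule inj_onI)
    fix x y assume xy: "x \<in> ?C" "y \<in> ?C" "M x = M y"
    show "x = y"
    proof (rule regular_functions_separate_points[OF var xy(1,2)])
      fix f assume "f \<in> A"
      from M(5)[OF this] show "f x = f y" using xy by auto
    qed
  qed
  have ZC: "Z \<subseteq> ?C" using T(2) by blast
  define T' where "T' = {p \<in> ?R. \<forall>x\<in>Z. p (M x) = 0}"
  have MZ: "M ` Z = {m \<in> carrier_mat n n. \<forall>p\<in>T'. p m = 0}"
  proof (intro subset_antisym subsetI)
    fix m assume "m \<in> M ` Z"
    then obtain x where x: "x \<in> Z" "m = M x" by blast
    then have "x \<in> ?C" using ZC by blast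
    then show "m \<in> {m \<in> carrier_mat n n. \<forall>p\<in>T'. p m = 0}"
      using x M(1)[of x] by (simp add: T'_def)
  next
    fix m assume "m \<in> {m \<in> carrier_mat n n. \<forall>p\<in>T'. p m = 0}"
    then have m: "m \<in> carrier_mat n n" and zero: "\<And>p. p \<in> T' \<Longrightarrow> p m = 0" by auto
    \<comment> \<open>the value of \<open>pol f\<close> at \<open>m\<close> depends only on \<open>f\<close>, as \<open>m\<close> is a zero of every polynomial in \<open>T'\<close>\<close>
    define pol where "pol f = (SOME p. p \<in> ?R \<and> (\<forall>x\<in>?C. f x = p (M x)))" for f
    have pol: "pol f \<in> ?R \<and> (\<forall>x\<in>?C. f x = pol f (M x))" if "f \<in> A" for f
    proof -
      have "\<exists>p. p \<in> ?R \<and> (\<forall>x\<in>?C. f x = p (M x))" using M(5)[OF that] by blast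
      from someI_ex[OF this] show ?thesis unfolding pol_def .
    qed
    define \<phi> where "\<phi> f = pol f m" for f
    have \<phi>: "\<phi> f = p m" if f: "f \<in> A" and p: "p \<in> ?R" "\<And>x. x \<in> ?C \<Longrightarrow> f x = p (M x)" for f p
    proof -
      let ?d = "\<lambda>m\<in>carrier_mat n n. pol f m + (\<lambda>m\<in>carrier_mat n n. (\<lambda>m\<in>carrier_mat n n. -1) m * p m) m"
      have "?d \<in> ?R" using pol[OF f] p(1)
        by (intro generated_algebra.add generated_algebra.mult generated_algebra.const) auto
      moreover have "?d (M x) = 0" if "x \<in> Z" for x
        using that ZC M(1)[of x] p(2)[of x] pol[OF f] by auto
      ultimately have "?d m = 0" unfolding T'_def using zero unfolding T'_def by blast
      then show ?thesis using m by (simp add: \<phi>_def)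
    qed
    obtain S where A: "A = generated_algebra ?C S" using var unfolding affine_variety_def by blast
    have "algebra_point ?C A \<phi>"
      unfolding algebra_point_def
    proof (intro conjI allI ballI)
      fix c
      have "\<phi> (\<lambda>x\<in>?C. c) = (\<lambda>m\<in>carrier_mat n n. c) m"
      proof (rule \<phi>)
        show "(\<lambda>x\<in>?C. c) \<in> A" unfolding A by (rule generated_algebra.const)
        show "(\<lambda>m\<in>carrier_mat n n. c) \<in> ?R" by (rule generated_algebra.const)
      qed (use M(1) in simp)
      then show "\<phi> (\<lambda>x\<in>?C. c) = c" using m by simp
    next
      fix f g assume fg: "f \<in> A" "g \<in> A"
      have "\<phi> (\<lambda>x\<in>?C. f x + g x) = (\<lambda>m\<in>carrier_mat n n. pol f m + pol g m) m"
      proof (rule \<phi>)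
        show "(\<lambda>x\<in>?C. f x + g x) \<in> A" using fg unfolding A by (rule generated_algebra.add)
        show "(\<lambda>m\<in>carrier_mat n n. pol f m + pol g m) \<in> ?R"
          by (rule generated_algebra.add) (use pol fg in blast)+
      qed (use pol[OF fg(1)] pol[OF fg(2)] M(1) in simp)
      then show "\<phi> (\<lambda>x\<in>?C. f x + g x) = \<phi> f + \<phi> g" using m by (simp add: \<phi>_def)
    next
      fix f g assume fg: "f \<in> A" "g \<in> A"
      have "\<phi> (\<lambda>x\<in>?C. f x * g x) = (\<lambda>m\<in>carrier_mat n n. pol f m * pol g m) m"
      proof (rule \<phi>)
        show "(\<lambda>x\<in>?C. f x * g x) \<in> A" using fg unfolding A by (rule generated_algebra.mult)
        show "(\<lambda>m\<in>carrier_mat n n. pol f m * pol g m) \<in> ?R"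
          by (rule generated_algebra.mult) (use pol fg in blast)+
      qed (use pol[OF fg(1)] pol[OF fg(2)] M(1) in simp)
      then show "\<phi> (\<lambda>x\<in>?C. f x * g x) = \<phi> f * \<phi> g" using m by (simp add: \<phi>_def)
    qed
    with var have "\<exists>!b. b \<in> ?C \<and> (\<forall>f\<in>A. \<phi> f = f b)" by (simp only: affine_variety_def)
    then obtain b where b: "b \<in> ?C" "\<And>f. f \<in> A \<Longrightarrow> \<phi> f = f b" by blast
    have "f b = 0" if f: "f \<in> T" for f
    proof -
      have fA: "f \<in> A" using f T(1) by blast
      have "pol f \<in> T'" unfolding T'_def using pol[OF fA] f T(2) by auto
      from zero[OF this] show ?thesis using b(2)[OF fA] by (simp add: \<phi>_def)
    qed
    then have "b \<in> Z" using b(1) T(2) by blast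
    moreover have "M b = m"
    proof (rule eq_matI)
      fix i j assume "i < dim_row m" "j < dim_col m"
      then have ij: "i < n" "j < n" using m by auto
      have "\<phi> (\<lambda>x\<in>?C. M x $$ (i, j)) = (\<lambda>m\<in>carrier_mat n n. m $$ (i, j)) m"
      proof (rule \<phi>[OF M(4)[OF ij]])
        show "(\<lambda>m\<in>carrier_mat n n. m $$ (i, j)) \<in> ?R"
          by (rule generated_algebra.gen) (use ij in \<open>auto simp: matrix_coordinates_def\<close>)
      qed (use M(1) in simp)
      then show "M b $$ (i, j) = m $$ (i, j)" using b(2)[OF M(4)[OF ij]] b(1) m by simp
    qed (use m M(1)[OF b(1)] in auto)
    ultimately show "m \<in> M ` Z" by blast
  qed
  define \<iota> where "\<iota> m = M (inv (inv_into ?C M m))" for m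
  have \<iota>: "\<iota> (M x) = M (inv x)" if "x \<in> ?C" for x
    unfolding \<iota>_def inv_into_f_f[OF inj that] ..
  have "finite (M ` D)"
  proof (rule symmetric_matrix_set_finite[OF _ MZ, where \<iota> = \<iota>])
    show "T' \<subseteq> ?R" unfolding T'_def by blast
  next
    fix m assume "m \<in> M ` Z"
    then obtain x where x: "x \<in> ?C" "m = M x" using ZC by blast
    show "\<iota> m \<in> carrier_mat n n \<and> m * \<iota> m = 1\<^sub>m n \<and> \<iota> m * m = 1\<^sub>m n"
      using x M(1)[of "inv x"] M(2)[of x "inv x"] M(2)[of "inv x" x] M(3) by (simp add: \<iota>)
  next
    fix m m' assume "m \<in> M ` Z" "m' \<in> M ` Z"
    then obtain x y where xy: "x \<in> Z" "y \<in> Z" "m = M x" "m' = M y" by blast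
    have C: "x \<in> ?C" "y \<in> ?C" using xy ZC by auto
    have "m * \<iota> m' * m = M (x \<otimes> inv y \<otimes> x)" using C by (simp add: xy \<iota> M(2))
    then show "m * \<iota> m' * m \<in> M ` Z" using sym[OF xy(1,2)] by simp
  next
    show "M ` D \<subseteq> M ` Z" using D(1) by blast
  next
    fix mz mw my assume *: "mz \<in> M ` D" "mw \<in> M ` D" "mz \<noteq> mw" "my \<in> M ` Z"
    then obtain z w y where zw: "z \<in> D" "w \<in> D" "mz = M z" "mw = M w" and y: "y \<in> Z" "my = M y" by blast
    have C: "z \<in> ?C" "w \<in> ?C" "y \<in> ?C" using zw y D(1) ZC by auto
    have "my * \<iota> mw * my = M (y \<otimes> inv w \<otimes> y)" using C by (simp add: zw y \<iota> M(2))
    moreover have "z \<noteq> w" using *(3) zw(3,4) by blast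
    then have "y \<otimes> inv w \<otimes> y \<noteq> z" by (rule D(2)[OF zw(1,2) _ y(1)])
    ultimately show "my * \<iota> mw * my \<noteq> mz"
      using inj_on_eq_iff[OF inj, of "y \<otimes> inv w \<otimes> y" z] C by (simp add: zw(3))
  qed
  then show ?thesis
    by (rule finite_imageD) (use inj D(1) ZC in \<open>auto intro: inj_on_subset\<close>)
qed

lemma zero_set_Int:
  assumes "zero_set X A Y" "zero_set X A Z"
  shows "zero_set X A (Y \<inter> Z)"
proof -
  obtain T T' where "T \<subseteq> A" "Y = {x \<in> X. \<forall>f\<in>T. f x = 0}" "T' \<subseteq> A" "Z = {x \<in> X. \<forall>f\<in>T'. f x = 0}"
    using assms unfolding zero_set_def by blast
  then show ?thesis unfolding zero_set_def by (intro exI[of _ "T \<union> T'"]) blast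
qed

lemma zero_set_vimage:
  assumes "regular_map X A Y B \<phi>" "zero_set Y B Z"
  shows "zero_set X A {x \<in> X. \<phi> x \<in> Z}"
proof -
  obtain T where T: "T \<subseteq> B" "Z = {y \<in> Y. \<forall>f\<in>T. f y = 0}" using assms(2) unfolding zero_set_def by blast
  have \<phi>: "\<phi> x \<in> Y" if "x \<in> X" for x using assms(1) that unfolding regular_map_def by blast
  let ?T = "(\<lambda>f. \<lambda>x\<in>X. f (\<phi> x)) ` T"
  have "?T \<subseteq> A" using assms(1) T(1) unfolding regular_map_def by blast
  moreover have "{x \<in> X. \<phi> x \<in> Z} = {x \<in> X. \<forall>f\<in>?T. f x = 0}" using \<phi> unfolding T(2) by auto
  ultimately show ?thesis unfolding zero_set_def by blast
qed

lemma zero_set_equalizer: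
  assumes A: "A = generated_algebra X S" and Y: "affine_variety Y B"
    and \<phi>: "regular_map X A Y B \<phi>" and \<psi>: "regular_map X A Y B \<psi>"
  shows "zero_set X A {x \<in> X. \<phi> x = \<psi> x}"
proof -
  let ?d = "\<lambda>f. \<lambda>x\<in>X. f (\<phi> x) + (-1) * f (\<psi> x)"
  have Y': "\<phi> x \<in> Y" "\<psi> x \<in> Y" if "x \<in> X" for x
    using \<phi> \<psi> that unfolding regular_map_def by blast+
  have "?d ` B \<subseteq> A"
  proof
    fix g assume "g \<in> ?d ` B"
    then obtain f where f: "f \<in> B" "g = ?d f" by blast
    have "(\<lambda>x\<in>X. f (\<phi> x)) \<in> A" "(\<lambda>x\<in>X. f (\<psi> x)) \<in> A"
      using \<phi> \<psi> f(1) unfolding regular_map_def by blast+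
    then show "g \<in> A" unfolding f(2) A
      by (intro generated_algebra_add' generated_algebra_mult' generated_algebra.const)
  qed
  moreover have "{x \<in> X. \<phi> x = \<psi> x} = {x \<in> X. \<forall>g\<in>?d ` B. g x = 0}"
    using regular_functions_separate_points[OF Y Y'] by auto
  ultimately show ?thesis unfolding zero_set_def by blast
qed

lemma regular_map_comp:
  assumes \<phi>: "regular_map X A Y B \<phi>" and \<psi>: "regular_map Y B W C \<psi>"
  shows "regular_map X A W C (\<lambda>x. \<psi> (\<phi> x))"
  unfolding regular_map_def
proof (intro conjI ballI)
  have \<phi>Y: "\<phi> x \<in> Y" if "x \<in> X" for x using \<phi> that unfolding regular_map_def by blast
  show "(\<lambda>x. \<psi> (\<phi> x)) \<in> X \<rightarrow> W" using \<phi>Y \<psi> unfolding regular_map_def by blast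
  fix f assume "f \<in> C"
  then have "(\<lambda>y\<in>Y. f (\<psi> y)) \<in> B" using \<psi> unfolding regular_map_def by blast
  then have "(\<lambda>x\<in>X. (\<lambda>y\<in>Y. f (\<psi> y)) (\<phi> x)) \<in> A" using \<phi> unfolding regular_map_def by blast
  moreover have "(\<lambda>x\<in>X. (\<lambda>y\<in>Y. f (\<psi> y)) (\<phi> x)) = (\<lambda>x\<in>X. f (\<psi> (\<phi> x)))"
    by (rule restrict_ext) (simp add: \<phi>Y)
  ultimately show "(\<lambda>x\<in>X. f (\<psi> (\<phi> x))) \<in> A" by simp
qed

lemma regular_map_translate:
  fixes G :: "('a, 'b) monoid_scheme" (structure)
  assumes G: "affine_algebraic_group G A" and ab: "a \<in> carrier G" "b \<in> carrier G"
  shows "regular_map (carrier G) A (carrier G) A (\<lambda>x. a \<otimes> x \<otimes> b)"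
proof -
  interpret group G using G unfolding affine_algebraic_group_def by blast
  have "regular_map (carrier G) A (carrier G) A (\<lambda>x. a \<otimes> x)"
    "regular_map (carrier G) A (carrier G) A (\<lambda>x. x \<otimes> b)"
    using translate_in_coordinate_ring[OF G] ab unfolding regular_map_def by auto
  then show ?thesis by (rule regular_map_comp)
qed

section \<open>Orbits of the fixed point subgroup\<close>

context group
begin

lemma l_coset_eq_iff:
  assumes H: "subgroup H G" and x: "x \<in> carrier G" and y: "y \<in> carrier G"
  shows "x <# H = y <# H \<longleftrightarrow> inv x \<otimes> y \<in> H"
proof
  assume "x <# H = y <# H"
  then have "y \<in> x <# H" using lcos_self[OF y H] by simp
  then show "inv x \<otimes> y \<in> H" using subgroup.lcos_module_imp[OF H is_group x] by simp
next
  assume "inv x \<otimes> y \<in> H"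
  then have "y \<in> x <# H" using subgroup.lcos_module_rev[OF H is_group x y] by simp
  then show "x <# H = y <# H" using l_repr_independence[OF _ x H] by simp
qed

lemma l_coset_transport_iff:
  assumes H: "subgroup H G" and C: "a \<in> carrier G" "g \<in> carrier G" "h \<in> carrier G"
  shows "a <# (g <# H) = h <# H \<longleftrightarrow> inv h \<otimes> a \<otimes> g \<in> H"
proof -
  have "a <# (g <# H) = (a \<otimes> g) <# H" using lcos_m_assoc[OF subgroup.subset[OF H]] C by simp
  then show ?thesis using l_coset_eq_iff[OF H, of h "a \<otimes> g"] C by (auto simp: m_assoc)
qed

end

text \<open>The orbits are fibred over the \<open>G\<close>-orbits of triples by \<open>img\<close>, and each fibre is finite.
  With a base point given by \<open>g0\<close> and \<open>k0\<close>, an element \<open>a\<close> that carries its image to that of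
  \<open>(g, k)\<close> yields \<open>a\<inverse>\<theta>(a)\<close> in the symmetric closed set \<open>Z\<close>. If two such values are related by
  \<open>y \<in> Z\<close>, then \<open>a1 (y z2\<inverse>) a2\<inverse>\<close> is fixed by \<open>\<theta>\<close> and carries the second point to the first
  one.\<close>
theorem (in group) finitely_many_fixed_point_orbits:
  assumes G: "affine_algebraic_group G A"
    and \<theta>: "\<theta> \<in> iso G G" "regular_map (carrier G) A (carrier G) A \<theta>"
    and \<theta>2: "\<And>x. x \<in> carrier G \<Longrightarrow> \<theta> (\<theta> x) = x"
    and K: "K = fixed_points G \<theta>"
    and P: "subgroup P G" "zero_set (carrier G) A P"
    and P': "subgroup P' G" "zero_set (carrier G) A P'" "\<theta> ` P' = P'"
    and Q: "Q = P' \<inter> K"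
    and fin: "finite (orbits G ((lcosets P) \<times> (lcosets (\<theta> ` P)) \<times> (lcosets P')) (diagonal_action3 G))"
  shows "finite (orbits (G\<lparr>carrier := K\<rparr>) ((lcosets P) \<times> (lcosets\<^bsub>G\<lparr>carrier := K\<rparr>\<^esub> Q)) (diagonal_action2 G))"
proof -
  let ?C = "carrier G" and ?K = "G\<lparr>carrier := K\<rparr>"
  interpret \<theta>: group_hom G G \<theta>
    using \<theta>(1) by unfold_locales (simp add: iso_def)
  have cancel: "inv x \<otimes> (x \<otimes> y) = y" "x \<otimes> (inv x \<otimes> y) = y" if "x \<in> ?C" "y \<in> ?C" for x y
    using that by (simp_all flip: m_assoc)
  note grp = m_assoc inv_mult_group cancel
  have KC: "k \<in> ?C" and K\<theta>: "\<theta> k = k" if "k \<in> K" for k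
    using that unfolding K fixed_points_def by auto
  have Ksub: "subgroup K G"
    unfolding K fixed_points_def by unfold_locales auto
  have Qsub: "subgroup Q G" unfolding Q by (rule subgroups_Inter_pair[OF P'(1) Ksub])
  have \<theta>P: "subgroup (\<theta> ` P) G" by (rule \<theta>.subgroup_img_is_subgroup[OF P(1)])
  have \<theta>P_iff: "x \<in> \<theta> ` P \<longleftrightarrow> \<theta> x \<in> P" if "x \<in> ?C" for x
    using \<theta>2 that subgroup.mem_carrier[OF P(1)] by (metis imageE imageI)
  have \<theta>P': "\<theta> x \<in> P'" if "x \<in> P'" for x using P'(3) that by blast
  define img where "img g k = (g <# P, \<theta> g <# (\<theta> ` P), k <# P')" for g k
  define pt where "pt g k = (g <# P, k <# Q)" for g k
  define orbK where "orbK e = orbit ?K (diagonal_action2 G) e" for e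
  define trans where "trans a g k g' k' \<longleftrightarrow>
    inv g' \<otimes> a \<otimes> g \<in> P \<and> inv g' \<otimes> \<theta> a \<otimes> g \<in> P \<and> inv k' \<otimes> a \<otimes> k \<in> P'" for a g k g' k'
  have img_trans: "diagonal_action3 G a (img g k) = img g' k' \<longleftrightarrow> trans a g k g' k'"
    if C: "a \<in> ?C" "g \<in> ?C" "g' \<in> ?C" "k \<in> K" "k' \<in> K" for a g k g' k'
  proof -
    have "inv (\<theta> g') \<otimes> a \<otimes> \<theta> g \<in> \<theta> ` P \<longleftrightarrow> inv g' \<otimes> \<theta> a \<otimes> g \<in> P"
      using \<theta>P_iff[of "inv (\<theta> g') \<otimes> a \<otimes> \<theta> g"] C \<theta>2 by simp
    then show ?thesis
      using C KC l_coset_transport_iff[OF P(1), of a g g'] l_coset_transport_iff[OF \<theta>P, of a "\<theta> g" "\<theta> g'"]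
        l_coset_transport_iff[OF P'(1), of a k k']
      by (simp add: img_def trans_def diagonal_action3_def)
  qed
  have pt_trans: "diagonal_action2 G m (pt g k) = pt g' k' \<longleftrightarrow> inv g' \<otimes> m \<otimes> g \<in> P \<and> inv k' \<otimes> m \<otimes> k \<in> Q"
    if C: "m \<in> ?C" "g \<in> ?C" "g' \<in> ?C" "k \<in> K" "k' \<in> K" for m g k g' k'
    using C KC l_coset_transport_iff[OF P(1), of m g g'] l_coset_transport_iff[OF Qsub, of m k k']
    by (simp add: pt_def diagonal_action2_def)
  have orbK_eq: "orbK (pt g k) = orbK (pt g' k')"
    if C: "m \<in> K" "g \<in> ?C" "g' \<in> ?C" "k \<in> K" "k' \<in> K"
      and m: "inv g' \<otimes> m \<otimes> g \<in> P" "inv k' \<otimes> m \<otimes> k \<in> Q" for m g k g' k'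
  proof -
    have act: "diagonal_action2 G (x \<otimes> y) (pt g k) = diagonal_action2 G x (diagonal_action2 G y (pt g k))"
      if "x \<in> ?C" "y \<in> ?C" "g \<in> ?C" "k \<in> ?C" for x y g k
      using that lcos_m_assoc[of "g <# P" x y] lcos_m_assoc[of "k <# Q" x y]
        l_coset_subset_G[OF subgroup.subset[OF P(1)], of g] l_coset_subset_G[OF subgroup.subset[OF Qsub], of k]
      by (simp add: pt_def diagonal_action2_def)
    have mC: "m \<in> ?C" using C KC by blast
    have eq: "diagonal_action2 G m (pt g k) = pt g' k'" using pt_trans[OF mC C(2-5)] m by blast
    have eq': "diagonal_action2 G (inv m) (pt g' k') = pt g k"
    proof -
      have "diagonal_action2 G (inv m \<otimes> m) (pt g k) = pt g k"
        using pt_trans[of \<one> g g k k] C KC mC subgroup.one_closed[OF P(1)] subgroup.one_closed[OF Qsub] by simp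
      then show ?thesis using act[of "inv m" m g k] eq C KC mC by simp
    qed
    have sub: "orbK (pt g' k') \<subseteq> orbK (pt g k)"
      if "m \<in> K" "g \<in> ?C" "k \<in> ?C" "diagonal_action2 G m (pt g k) = pt g' k'" for m g k g' k'
    proof
      fix e assume "e \<in> orbK (pt g' k')"
      then obtain x where x: "x \<in> K" "e = diagonal_action2 G x (pt g' k')" unfolding orbK_def orbit_def by auto
      then have "e = diagonal_action2 G (x \<otimes> m) (pt g k)" using act[of x m g k] that KC by simp
      moreover have "x \<otimes> m \<in> K" using subgroup.m_closed[OF Ksub] x that by blast
      ultimately show "e \<in> orbK (pt g k)" unfolding orbK_def orbit_def by auto
    qed
    have "inv m \<in> K" using subgroup.m_inv_closed[OF Ksub] C by blast
    from sub[OF this _ _ eq'] sub[OF C(1) _ _ eq] show ?thesis using C KC by blast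
  qed
  have key: "finite {orbK (pt g k) | g k. g \<in> ?C \<and> k \<in> K \<and> (\<exists>a\<in>?C. trans a g0 k0 g k)}" (is "finite ?O")
    if g0: "g0 \<in> ?C" and k0: "k0 \<in> K" for g0 k0
  proof -
    have k0C: "k0 \<in> ?C" using KC k0 by blast
    define c where "c x = inv g0 \<otimes> x \<otimes> g0" for x
    define c' where "c' x = inv k0 \<otimes> x \<otimes> k0" for x
    have c: "c (x \<otimes> y) = c x \<otimes> c y" "c (inv x) = inv (c x)" "c x \<in> ?C" if "x \<in> ?C" "y \<in> ?C" for x y
      using that g0 by (simp_all add: c_def grp)
    have c': "c' (x \<otimes> y) = c' x \<otimes> c' y" "c' (inv x) = inv (c' x)" "c' x \<in> ?C" if "x \<in> ?C" "y \<in> ?C" for x y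
      using that k0C by (simp_all add: c'_def grp)
    define Z where "Z = {x \<in> ?C. c x \<in> P} \<inter> {x \<in> ?C. c (\<theta> x) \<in> P} \<inter> {x \<in> ?C. c' x \<in> P'} \<inter> {x \<in> ?C. \<theta> x = inv x}"
    have Z: "x \<in> Z \<longleftrightarrow> x \<in> ?C \<and> c x \<in> P \<and> c (\<theta> x) \<in> P \<and> c' x \<in> P' \<and> \<theta> x = inv x" for x
      unfolding Z_def by blast
    obtain S where A: "A = generated_algebra ?C S" and var: "affine_variety ?C A"
      using G unfolding affine_algebraic_group_def affine_variety_def by blast
    have reg_inv: "regular_map ?C A ?C A (\<lambda>x. inv x)" using G unfolding affine_algebraic_group_def by blast
    have reg_c: "regular_map ?C A ?C A c" "regular_map ?C A ?C A c'"
      unfolding c_def c'_def using g0 k0C by (auto intro: regular_map_translate[OF G])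
    have Zzero: "zero_set ?C A Z"
      unfolding Z_def
      by (intro zero_set_Int zero_set_vimage[OF _ P(2)] zero_set_vimage[OF _ P'(2)]
          zero_set_equalizer[OF A var] regular_map_comp[OF \<theta>(2)] reg_c reg_inv \<theta>(2))
    have Zsym: "x \<otimes> inv y \<otimes> x \<in> Z" if "x \<in> Z" "y \<in> Z" for x y
      using that unfolding Z
      by (auto simp: c c' subgroup.m_closed[OF P(1)] subgroup.m_inv_closed[OF P(1)]
          subgroup.m_closed[OF P'(1)] subgroup.m_inv_closed[OF P'(1)] grp)
    have zZ: "inv a \<otimes> \<theta> a \<in> Z" if a: "a \<in> ?C" "trans a g0 k0 g k" "g \<in> ?C" "k \<in> K" for a g k
    proof -
      have kC: "k \<in> ?C" using KC a by blast
      have p: "inv g \<otimes> a \<otimes> g0 \<in> P" "inv g \<otimes> \<theta> a \<otimes> g0 \<in> P" "inv k \<otimes> a \<otimes> k0 \<in> P'"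
        using a unfolding trans_def by auto
      have p': "inv k \<otimes> \<theta> a \<otimes> k0 \<in> P'"
        using \<theta>P'[OF p(3)] a k0C kC K\<theta>[OF k0] K\<theta>[OF a(4)] by simp
      have "c (inv a \<otimes> \<theta> a) = inv (inv g \<otimes> a \<otimes> g0) \<otimes> (inv g \<otimes> \<theta> a \<otimes> g0)"
        using a g0 by (simp add: c_def grp)
      moreover have "c (\<theta> (inv a \<otimes> \<theta> a)) = inv (inv g \<otimes> \<theta> a \<otimes> g0) \<otimes> (inv g \<otimes> a \<otimes> g0)"
        using a g0 \<theta>2 by (simp add: c_def grp)
      moreover have "c' (inv a \<otimes> \<theta> a) = inv (inv k \<otimes> a \<otimes> k0) \<otimes> (inv k \<otimes> \<theta> a \<otimes> k0)"
        using a k0C kC by (simp add: c'_def grp)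
      moreover have "\<theta> (inv a \<otimes> \<theta> a) = inv (inv a \<otimes> \<theta> a)" using a \<theta>2 by (simp add: grp)
      ultimately show ?thesis unfolding Z
        using p p' a subgroup.m_closed[OF P(1)] subgroup.m_inv_closed[OF P(1)]
          subgroup.m_closed[OF P'(1)] subgroup.m_inv_closed[OF P'(1)] by simp
    qed
    have related: "orbK (pt g1 k1) = orbK (pt g2 k2)"
      if 1: "a1 \<in> ?C" "trans a1 g0 k0 g1 k1" "g1 \<in> ?C" "k1 \<in> K"
        and 2: "a2 \<in> ?C" "trans a2 g0 k0 g2 k2" "g2 \<in> ?C" "k2 \<in> K"
        and y: "y \<in> Z" "y \<otimes> inv (inv a2 \<otimes> \<theta> a2) \<otimes> y = inv a1 \<otimes> \<theta> a1"
      for a1 g1 k1 a2 g2 k2 y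
    proof -
      define z2 where "z2 = inv a2 \<otimes> \<theta> a2"
      have z2: "z2 \<in> Z" unfolding z2_def by (rule zZ[OF 2])
      have C: "y \<in> ?C" "z2 \<in> ?C" "k1 \<in> ?C" "k2 \<in> ?C" using y(1) z2 Z KC 1 2 by auto
      \<comment> \<open>the candidate for an element of \<open>K\<close> that carries the second point to the first\<close>
      define m where "m = a1 \<otimes> (y \<otimes> inv z2) \<otimes> inv a2"
      have \<theta>a1: "\<theta> a1 = a1 \<otimes> (y \<otimes> inv z2 \<otimes> y)"
        using y(2) 1(1) by (simp add: z2_def cancel)
      have \<theta>a2: "\<theta> a2 = a2 \<otimes> z2" using 2(1) by (simp add: z2_def cancel)
      have "\<theta> y = inv y" "\<theta> z2 = inv z2" using y(1) z2 Z by auto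
      then have "\<theta> m = a1 \<otimes> (y \<otimes> inv z2 \<otimes> y) \<otimes> (inv y \<otimes> z2) \<otimes> inv (a2 \<otimes> z2)"
        using C 1(1) 2(1) by (simp add: m_def \<theta>a1 \<theta>a2)
      also have "\<dots> = m" using C 1(1) 2(1) by (simp add: m_def grp)
      finally have mK: "m \<in> K" unfolding K fixed_points_def using C 1(1) 2(1) by (simp add: m_def)
      have "inv g1 \<otimes> m \<otimes> g2 = (inv g1 \<otimes> a1 \<otimes> g0) \<otimes> (c y \<otimes> inv (c z2)) \<otimes> inv (inv g2 \<otimes> a2 \<otimes> g0)"
        using C 1 2 g0 by (simp add: m_def c_def grp)
      also have "\<dots> \<in> P"
        by (rule subgroup.m_closed[OF P(1) subgroup.m_closed[OF P(1) _ subgroup.m_closed[OF P(1) _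
              subgroup.m_inv_closed[OF P(1)]]] subgroup.m_inv_closed[OF P(1)]])
          (use 1(2) 2(2) y(1) z2 in \<open>simp_all add: Z trans_def\<close>)
      finally have mP: "inv g1 \<otimes> m \<otimes> g2 \<in> P" .
      have "inv k1 \<otimes> m \<otimes> k2 = (inv k1 \<otimes> a1 \<otimes> k0) \<otimes> (c' y \<otimes> inv (c' z2)) \<otimes> inv (inv k2 \<otimes> a2 \<otimes> k0)"
        using C 1 2 k0C by (simp add: m_def c'_def grp)
      also have "\<dots> \<in> P'"
        by (rule subgroup.m_closed[OF P'(1) subgroup.m_closed[OF P'(1) _ subgroup.m_closed[OF P'(1) _
              subgroup.m_inv_closed[OF P'(1)]]] subgroup.m_inv_closed[OF P'(1)]])
          (use 1(2) 2(2) y(1) z2 in \<open>simp_all add: Z trans_def\<close>)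
      finally have "inv k1 \<otimes> m \<otimes> k2 \<in> P'" .
      moreover have "inv k1 \<otimes> m \<otimes> k2 \<in> K"
        by (rule subgroup.m_closed[OF Ksub subgroup.m_closed[OF Ksub
              subgroup.m_inv_closed[OF Ksub 1(4)] mK] 2(4)])
      ultimately have "inv k1 \<otimes> m \<otimes> k2 \<in> Q" unfolding Q ..
      from orbK_eq[OF mK 2(3) 1(3) 2(4) 1(4) mP this] show ?thesis by simp
    qed
    define ok where "ok u t \<longleftrightarrow> (case t of (a, g, k) \<Rightarrow>
      u = orbK (pt g k) \<and> g \<in> ?C \<and> k \<in> K \<and> a \<in> ?C \<and> trans a g0 k0 g k)" for u t
    define af where "af u = fst (SOME t. ok u t)" for u
    define gf where "gf u = fst (snd (SOME t. ok u t))" for u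
    define kf where "kf u = snd (snd (SOME t. ok u t))" for u
    have f: "u = orbK (pt (gf u) (kf u)) \<and> gf u \<in> ?C \<and> kf u \<in> K \<and>
        af u \<in> ?C \<and> trans (af u) g0 k0 (gf u) (kf u)" if u: "u \<in> ?O" for u
    proof -
      have "\<exists>t. ok u t" using u unfolding ok_def by blast
      then have "ok u (SOME t. ok u t)" by (rule someI_ex)
      then show ?thesis unfolding ok_def af_def gf_def kf_def by (simp add: case_prod_unfold)
    qed
    define z where "z u = inv (af u) \<otimes> \<theta> (af u)" for u
    have zZ': "z u \<in> Z" if "u \<in> ?O" for u
      unfolding z_def using f[OF that] by (intro zZ) auto
    have rel: "u = w" if uw: "u \<in> ?O" "w \<in> ?O" and y: "y \<in> Z" "y \<otimes> inv (z w) \<otimes> y = z u" for u w y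
    proof -
      have "orbK (pt (gf u) (kf u)) = orbK (pt (gf w) (kf w))"
        by (rule related[of "af u" _ _ "af w" _ _ y]) (use f[OF uw(1)] f[OF uw(2)] y in \<open>auto simp: z_def\<close>)
      then show ?thesis using f[OF uw(1)] f[OF uw(2)] by simp
    qed
    \<comment> \<open>an element \<open>x\<close> of \<open>Z\<close> is related to itself by \<open>y = x\<close>\<close>
    have inj: "inj_on z ?O"
    proof (rule inj_onI)
      fix u w assume uw: "u \<in> ?O" "w \<in> ?O" "z u = z w"
      have "z u \<in> ?C" using zZ'[OF uw(1)] Z by blast
      then show "u = w" using rel[OF uw(1,2) zZ'[OF uw(1)]] uw(3) by simp
    qed
    have "finite (z ` ?O)"
    proof (rule symmetric_zero_set_finite[OF G Zzero Zsym])
      show "z ` ?O \<subseteq> Z" by (rule image_subsetI) (rule zZ')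
      fix zu zw y assume *: "zu \<in> z ` ?O" "zw \<in> z ` ?O" "zu \<noteq> zw" "y \<in> Z"
      obtain u where u: "u \<in> ?O" "zu = z u" using *(1) by (rule imageE)
      obtain w where w: "w \<in> ?O" "zw = z w" using *(2) by (rule imageE)
      show "y \<otimes> inv zw \<otimes> y \<noteq> zu"
      proof
        assume "y \<otimes> inv zw \<otimes> y = zu"
        then have "u = w" using rel[OF u(1) w(1) *(4)] u(2) w(2) by simp
        with *(3) u(2) w(2) show False by simp
      qed
    qed
    then show ?thesis by (rule finite_imageD) (rule inj)
  qed
  let ?E3 = "(lcosets P) \<times> (lcosets (\<theta> ` P)) \<times> (lcosets P')"
  define fibre where "fibre u = {orbK (pt g k) | g k. g \<in> ?C \<and> k \<in> K \<and> img g k \<in> u}" for u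
  have fibre: "finite (fibre u)" if u: "u \<in> orbits G ?E3 (diagonal_action3 G)" for u
  proof (cases "\<exists>g k. g \<in> ?C \<and> k \<in> K \<and> img g k \<in> u")
    case True
    then obtain g0 k0 where 0: "g0 \<in> ?C" "k0 \<in> K" "img g0 k0 \<in> u" by blast
    obtain e where e: "e \<in> ?E3" "u = orbit G (diagonal_action3 G) e" using u unfolding orbits_def by blast
    have "fibre u \<subseteq> {orbK (pt g k) | g k. g \<in> ?C \<and> k \<in> K \<and> (\<exists>a\<in>?C. trans a g0 k0 g k)}"
    proof -
      have "\<exists>a\<in>?C. trans a g0 k0 g k" if gk: "g \<in> ?C" "k \<in> K" "img g k \<in> u" for g k
      proof -
        obtain x y where xy: "x \<in> ?C" "img g0 k0 = diagonal_action3 G x e"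
          "y \<in> ?C" "img g k = diagonal_action3 G y e"
          using 0(3) gk(3) unfolding e(2) orbit_def by auto
        obtain X1 X2 X3 where X1: "e = (X1, X2, X3)" by (cases e)
        have "X1 \<in> lcosets P" "X2 \<in> lcosets (\<theta> ` P)" "X3 \<in> lcosets P'" using e(1) unfolding X1 by simp_all
        then have X: "X1 \<subseteq> ?C" "X2 \<subseteq> ?C" "X3 \<subseteq> ?C"
          using subsetD[OF lcosets_subset_PowG[OF P(1)]] subsetD[OF lcosets_subset_PowG[OF \<theta>P]]
            subsetD[OF lcosets_subset_PowG[OF P'(1)]] by (blast dest: PowD)+
        have act: "(y \<otimes> inv x) <# (x <# X) = y <# X" if "X \<subseteq> ?C" for X
          using that xy lcos_m_assoc[of X "y \<otimes> inv x" x] by (simp add: m_assoc)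
        have "diagonal_action3 G (y \<otimes> inv x) (img g0 k0) = img g k"
          unfolding xy(2,4) X1 by (simp add: diagonal_action3_def act X)
        then show ?thesis using img_trans[of "y \<otimes> inv x" g0 g k0 k] xy 0 gk by auto
      qed
      then show ?thesis unfolding fibre_def by blast
    qed
    then show ?thesis by (rule finite_subset) (rule key[OF 0(1,2)])
  next
    case False
    then have "fibre u = {}" unfolding fibre_def by blast
    then show ?thesis by simp
  qed
  have "orbits ?K ((lcosets P) \<times> (lcosets\<^bsub>?K\<^esub> Q)) (diagonal_action2 G)
      \<subseteq> (\<Union>u\<in>orbits G ?E3 (diagonal_action3 G). fibre u)"
  proof
    fix v assume "v \<in> orbits ?K ((lcosets P) \<times> (lcosets\<^bsub>?K\<^esub> Q)) (diagonal_action2 G)"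
    then obtain g k where gk: "g \<in> ?C" "k \<in> K" "v = orbK (pt g k)"
      unfolding orbits_def LCOSETS_def orbK_def pt_def by (auto simp: l_coset_def)
    define u where "u = orbit G (diagonal_action3 G) (img g k)"
    have "img g k \<in> ?E3" using gk KC unfolding img_def LCOSETS_def by auto
    then have "u \<in> orbits G ?E3 (diagonal_action3 G)" unfolding u_def orbits_def
      by (intro CollectI exI[of _ "img g k"] conjI refl)
    moreover have "v \<in> fibre u"
    proof -
      have "trans \<one> g k g k" using gk KC subgroup.one_closed[OF P(1)] subgroup.one_closed[OF P'(1)]
        by (simp add: trans_def)
      then have "diagonal_action3 G \<one> (img g k) = img g k" using img_trans[of \<one> g g k k] gk by simp
      then have "img g k \<in> u" unfolding u_def orbit_def by force
      then show ?thesis unfolding fibre_def using gk by (intro CollectI exI[of _ g] exI[of _ k] conjI)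
    qed
    ultimately show "v \<in> (\<Union>u\<in>orbits G ?E3 (diagonal_action3 G). fibre u)" by blast
  qed
  then show ?thesis by (rule finite_subset) (rule finite_UN_I[OF fin fibre])
qed

lemma closed_subgroup_zero_set:
  assumes "affine_variety (carrier G) A" "closed_subgroup G A H"
  shows "zero_set (carrier G) A H"
proof -
  obtain S where "A = generated_algebra (carrier G) S" using assms(1) unfolding affine_variety_def by blast
  from closedin_zariski_iff[OF this] show ?thesis
    using assms(2) unfolding closed_subgroup_def zero_set_def by blast
qed

theorem theorem1:
  fixes G :: "('a, 'b) monoid_scheme" and A :: "('a \<Rightarrow> complex) set"
    and \<theta> :: "'a \<Rightarrow> 'a" and K P Q P' :: "'a set"
  assumes "connected_reductive_group G A"
    and "nontrivial_involution G A \<theta>"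
    and "K = fixed_points G \<theta>"
    and "parabolic_subgroup G A P"
    and "parabolic_subgroup (G\<lparr>carrier := K\<rparr>) (restrict_ring K A) Q"
    and "parabolic_subgroup G A P'"
    and "\<theta> ` P' = P'"
    and "P' \<inter> K = Q"
    and "finite (orbits G
           ((lcosets\<^bsub>G\<^esub> P) \<times> (lcosets\<^bsub>G\<^esub> (\<theta> ` P)) \<times> (lcosets\<^bsub>G\<^esub> P'))
           (diagonal_action3 G))"
  shows "finite (orbits (G\<lparr>carrier := K\<rparr>)
           ((lcosets\<^bsub>G\<^esub> P) \<times> (lcosets\<^bsub>G\<lparr>carrier := K\<rparr>\<^esub> Q)) (diagonal_action2 G))"
proof -
  have G: "affine_algebraic_group G A" using assms(1) unfolding connected_reductive_group_def by blast
  then have grp: "group G" and var: "affine_variety (carrier G) A"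
    unfolding affine_algebraic_group_def by blast+
  have \<theta>: "\<theta> \<in> iso G G" "regular_map (carrier G) A (carrier G) A \<theta>"
    "\<And>x. x \<in> carrier G \<Longrightarrow> \<theta> (\<theta> x) = x"
    using assms(2) unfolding nontrivial_involution_def algebraic_automorphism_def by blast+
  have cl: "closed_subgroup G A P" "closed_subgroup G A P'"
    using assms(4,6) unfolding parabolic_subgroup_def by blast+
  then have sub: "subgroup P G" "subgroup P' G" unfolding closed_subgroup_def by blast+
  show ?thesis
    by (rule group.finitely_many_fixed_point_orbits[OF grp G \<theta> assms(3) sub(1)
          closed_subgroup_zero_set[OF var cl(1)] sub(2) closed_subgroup_zero_set[OF var cl(2)]
          assms(7) assms(8)[symmetric] assms(9)])
qed

end
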